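(* Let $d>k\ge 1$ be integers, $1<p<q<\infty$, and let $a,b,\gamma\in\mathbb{R}$ satisfy $$k+a>0,\qquad b<d-p+a,\qquad q\,\mathrm{H}_{a-b+\gamma}>d-k .$$ Then $S_{a,b,\gamma}(q)>0$ if and only if both of the following conditions are satisfied: $$a1)\ (d-p)q\le dp,\qquad a2)\ \gamma\ge b .$$ If in addition $p<d$, then (taking $q=p^*:=\frac{dp}{d-p}$) $$S_{a,b,\gamma}(p^* )=\inf_{u\in\mathcal D^{1,p}(\mathbb{R}^d;|y|^a|z|^{-b}dz)\setminus\{0\}}\frac{\displaystyle\int_{\mathbb{R}^d}|y|^a|z|^{-b}|\nabla u|^p\,dz}{\Big(\displaystyle\int_{\mathbb{R}^d}|y|^{(a-b+\gamma)\frac{p^*}{p}}|z|^{-\gamma\frac{p^*}{p}}|u|^{p^*}\,dz\Big)^{\frac{p}{p^*}}}\le S .$$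
   Context: Identify $\mathbb{R}^d\equiv\mathbb{R}^{d-k}\times\mathbb{R}^k\ni(x,y)=z$. For $t\in\mathbb{R}$ put $\mathrm{H}_t=\frac{d-p+t}{p}$. If $k+a>0$ and $b<d-p+a$, the Hardy inequality $\mathrm{H}_{a-b}^p\int_{\mathbb{R}^d}|y|^a|z|^{-b-p}|u|^p\,dz\le\int_{\mathbb{R}^d}|y|^a|z|^{-b}|\nabla u|^p\,dz$ holds for $u\in C^\infty_c(\mathbb{R}^d)$; $\mathcal D^{1,p}(\mathbb{R}^d;|y|^a|z|^{-b}dz)$ denotes the completion of $C^\infty_c(\mathbb{R}^d)$ with respect to the norm $\big(\int_{\mathbb{R}^d}|y|^a|z|^{-b}|\nabla u|^p\,dz\big)^{1/p}$, identified with a space of functions through this inequality. Define $$S_{a,b,\gamma}(q)=\inf_{u\in\mathcal D^{1,p}(\mathbb{R}^d;|y|^a|z|^{-b}dz)\setminus\{0\}}\frac{\int_{\mathbb{R}^d}|y|^a|z|^{-b}|\nabla u|^p\,dz}{\big(\int_{\mathbb{R}^d}|y|^{-d+q\mathrm{H}_{a-b+\gamma}}|z|^{-\gamma\frac qp}|u|^q\,dz\big)^{\frac pq}}$$ (the quotient is read as $0$ if the denominator is infinite). For $p<d$, $S$ is the Sobolev constant: $S=\inf_{u\in\mathcal D^{1,p}(\mathbb{R}^d)\setminus\{0\}}\frac{\int_{\mathbb{R}^d}|\nabla u|^p\,dz}{(\int_{\mathbb{R}^d}|u|^{p^*}\,dz)^{p/p^*}}$, where $\mathcal D^{1,p}(\mathbb{R}^d)$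 is the completion of $C_c^\infty(\mathbb{R}^d)$ in the norm $\|\nabla u\|_{L^p}$. In the last assertion (concerning $q=p^*$) the hypothesis $q\,\mathrm{H}_{a-b+\gamma}>d-k$ is read with $q=p^*$. *)

theory Defs
  imports "HOL-Analysis.Analysis"
begin

section \<open>Test functions and gradients\<close>

definition grad :: "('a::euclidean_space \<Rightarrow> real) \<Rightarrow> 'a \<Rightarrow> 'a" where
  "grad f x = (THE D. GDERIV f x :> D)"

text \<open>\<open>Ck_fun n f\<close>: \<open>f\<close> is of class \<open>C\<^sup>n\<close> on the whole space.  As partial derivatives are taken
  of differentiable functions only, the derivative in direction \<open>i\<close> is \<open>grad f x \<bullet> i\<close>.\<close>

primrec Ck_fun :: "nat \<Rightarrow> ('a::euclidean_space \<Rightarrow> real) \<Rightarrow> bool" where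
  "Ck_fun 0 f \<longleftrightarrow> continuous_on UNIV f"
| "Ck_fun (Suc n) f \<longleftrightarrow> f differentiable_on UNIV \<and> (\<forall>i\<in>Basis. Ck_fun n (\<lambda>x. grad f x \<bullet> i))"

definition test_funs :: "('a::euclidean_space \<Rightarrow> real) set" where
  "test_funs = {f. (\<forall>n. Ck_fun n f) \<and> compact (closure {x. f x \<noteq> 0})}"


section \<open>Weighted homogeneous Sobolev spaces\<close>

text \<open>\<open>D1p w h p u G\<close> says that \<open>u\<close> belongs to the completion of the test functions in the norm
  \<open>(\<integral> w |\<nabla>u|\<^sup>p)\<^sup>1\<^sup>/\<^sup>p\<close> and that \<open>G\<close> is its gradient.  Here \<open>h\<close> is the weight on the left-hand side of
  a Hardy inequality \<open>c \<integral> h |u|\<^sup>p \<le> \<integral> w |\<nabla>u|\<^sup>p\<close>, \<open>c > 0\<close>: an element of the completion is the class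
  of a sequence of test functions whose gradients are Cauchy in \<open>L\<^sup>p(w)\<close>; it is identified with the
  limit \<open>u\<close> of the sequence in \<open>L\<^sup>p(h)\<close>, and its norm is the \<open>L\<^sup>p(w)\<close> norm of the limit \<open>G\<close> of the
  gradients.  Both \<open>u\<close> and \<open>G\<close> are representatives modulo null sets.\<close>

definition D1p ::
  "('a::euclidean_space \<Rightarrow> real) \<Rightarrow> ('a \<Rightarrow> real) \<Rightarrow> real \<Rightarrow> ('a \<Rightarrow> real) \<Rightarrow> ('a \<Rightarrow> 'a) \<Rightarrow> bool" where
  "D1p w h p u G \<longleftrightarrow>
     u \<in> borel_measurable borel \<and> G \<in> borel_measurable borel \<and>
     (\<exists>\<phi>. (\<forall>n. \<phi> n \<in> test_funs) \<and>
        (\<lambda>n. \<integral>\<^sup>+z. ennreal (w z * norm (grad (\<phi> n) z - G z) powr p) \<partial>lborel) \<longlonglongrightarrow> 0 \<and>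
        (\<lambda>n. \<integral>\<^sup>+z. ennreal (h z * \<bar>\<phi> n z - u z\<bar> powr p) \<partial>lborel) \<longlonglongrightarrow> 0)"

text \<open>Powers of extended nonnegative numbers, for exponents \<open>r > 0\<close>.\<close>

definition ennreal_pow :: "ennreal \<Rightarrow> real \<Rightarrow> ennreal" where
  "ennreal_pow x r = (if x = top then top else ennreal (enn2real x powr r))"

text \<open>The infimum over nonzero \<open>u\<close> of \<open>\<integral> w |\<nabla>u|\<^sup>p / (\<integral> v |u|\<^sup>q)\<^sup>p\<^sup>/\<^sup>q\<close>.  Division on
  \<^typ>\<open>ennreal\<close> yields \<open>0\<close> if the denominator is infinite.\<close>

definition best_const ::
  "('a::euclidean_space \<Rightarrow> real) \<Rightarrow> ('a \<Rightarrow> real) \<Rightarrow> ('a \<Rightarrow> real) \<Rightarrow> real \<Rightarrow> real \<Rightarrow> ennreal" where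
  "best_const w h v p q =
     (INF (u, G) \<in> {(u, G). D1p w h p u G \<and> \<not> (AE z in lborel. u z = 0)}.
        (\<integral>\<^sup>+z. ennreal (w z * norm (G z) powr p) \<partial>lborel) /
        ennreal_pow (\<integral>\<^sup>+z. ennreal (v z * \<bar>u z\<bar> powr q) \<partial>lborel) (p / q))"


section \<open>The constants\<close>

text \<open>The weight \<open>|y|\<^sup>\<alpha> |z|\<^sup>\<beta>\<close> for \<open>z = (x, y)\<close>; its values on the null set \<open>y = 0\<close> are
  irrelevant.\<close>

definition wt :: "real \<Rightarrow> real \<Rightarrow> 'x::euclidean_space \<times> 'y::euclidean_space \<Rightarrow> real" where
  "wt \<alpha> \<beta> z = norm (snd z) powr \<alpha> * norm z powr \<beta>"

definition Hconst :: "nat \<Rightarrow> real \<Rightarrow> real \<Rightarrow> real" where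
  "Hconst d p t = (real d - p + t) / p"

text \<open>The infimum of the quotients
  \<open>\<integral> |y|\<^sup>a |z|\<^sup>-\<^sup>b |\<nabla>u|\<^sup>p / (\<integral> |y|\<^sup>\<alpha> |z|\<^sup>\<beta> |u|\<^sup>q)\<^sup>p\<^sup>/\<^sup>q\<close> over nonzero \<open>u\<close> in the completion with
  respect to \<open>\<integral> |y|\<^sup>a |z|\<^sup>-\<^sup>b |\<nabla>u|\<^sup>p\<close>.\<close>

definition weighted_inf ::
  "('x::euclidean_space \<times> 'y::euclidean_space) itself \<Rightarrow>
     real \<Rightarrow> real \<Rightarrow> real \<Rightarrow> real \<Rightarrow> real \<Rightarrow> real \<Rightarrow> ennreal" where
  "weighted_inf _ p a b \<alpha> \<beta> q =
     best_const (wt a (- b) :: 'x \<times> 'y \<Rightarrow> real) (wt a (- b - p)) (wt \<alpha> \<beta>) p q"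

definition S_const ::
  "('x::euclidean_space \<times> 'y::euclidean_space) itself \<Rightarrow>
     real \<Rightarrow> real \<Rightarrow> real \<Rightarrow> real \<Rightarrow> real \<Rightarrow> ennreal" where
  "S_const T p a b \<gamma> q =
     weighted_inf T p a b
       (- real DIM('x \<times> 'y) + q * Hconst DIM('x \<times> 'y) p (a - b + \<gamma>)) (- (\<gamma> * q / p)) q"

definition crit_exp :: "nat \<Rightarrow> real \<Rightarrow> real" where
  "crit_exp d p = real d * p / (real d - p)"

text \<open>For \<open>1 < p < d\<close> the unweighted space is the case \<open>a = b = 0\<close> of the weighted one; the
  corresponding Hardy weight is \<open>|z|\<^sup>-\<^sup>p\<close>.\<close>

definition Sobolev_const :: "'a::euclidean_space itself \<Rightarrow> real \<Rightarrow> ennreal" where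
  "Sobolev_const _ p =
     best_const (\<lambda>_::'a. 1) (\<lambda>z. norm z powr (- p)) (\<lambda>_. 1) p (crit_exp DIM('a) p)"

end

theory Submission
  imports Defs
begin

text \<open>Sufficiency rests on a weak-type estimate for the layers \<open>{\<tau> < |u| < 2\<tau>}\<close>, which Maz'ya's truncation
  argument with \<open>\<tau> = 2\<^sup>j\<close> turns into the strong inequality.  If \<open>|u(z)| \<ge> 2\<tau>\<close>, then every ray from \<open>z = (x, y)\<close>
  crosses the layer.  Only directions close to \<open>(0, y/|y|)\<close> are used: along them \<open>|y|\<close> and \<open>|z|\<close> become comparable
  to \<open>|y| + t\<close> and \<open>|z| + t\<close>, so that the dual weight need not be locally integrable.  Averaging over these
  directions yields a radius at which the mass of a ball about \<open>z\<close> is controlled by the energy of the layer in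
  it, since otherwise the integral along the rays would be too small.  Vitali's covering lemma sums these
  balls.  As \<open>|y| \<le> |z|\<close>, the case \<open>\<gamma> \<ge> b\<close> reduces to \<open>\<gamma> = b\<close> with \<open>a + \<gamma> - b\<close> in place of \<open>a\<close>.

  Necessity is tested with rescaled bumps: shrinking to \<open>(0, e)\<close> for a1), and of size comparable to \<open>r\<close> about \<open>(x\<^sub>0, r e)\<close> with
  \<open>r \<rightarrow> 0\<close> for a2), where \<open>|e| = |x\<^sub>0| = 1\<close>.  At \<open>(0, e)\<close> all weights equal \<open>1\<close>, which gives the comparison with the
  Sobolev constant.\<close>

section \<open>Test functions\<close>

text \<open>Fix z, let V(t) be the size of the mass of the ball of radius t about z, M a bound for
  the energy of the layer, and X(t) = V(t) \<tau>^q / M^(q/p). If the energy of the layer in the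
  ball of radius 2 t is at most M X(t) / c for every t, the integral along the rays is at most
  \<tau> times a constant times the integral of min(1, X/c)^(1/p) X^(-1/q) dt/t. As V grows at least
  like a fixed positive power of t, this is small for large c, uniformly in z and u: the trivial
  bound M gives convergence at infinity, and p < q gives it at 0. For \<gamma> = b, condition a1)
  enters through V(t)^(p/q) \<le> t^(d-p) (|y| + t)^a (|z| + t)^(-b), where the gap is the power of
  t / (|y| + t) with exponent dp/q - (d - p). The resulting estimate is linear in the energy of the
  layer, the factor M^(q/p-1) being kept apart; this linearity permits the sum over disjoint balls
  and then over disjoint layers, with M the total energy throughout. Lower bounds for the infima are
  proved for test functions and reach the completion by Fatou's lemma.\<close>

lemma grad_eqI:
  assumes "GDERIV f x :> D"
  shows "grad f x = D"
  unfolding grad_def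
proof (rule the_equality, rule assms)
  fix E assume "GDERIV f x :> E"
  then have "(\<lambda>h. inner h E) = (\<lambda>h. inner h D)"
    using assms unfolding gderiv_def by (rule has_derivative_unique)
  then have "inner h (E - D) = 0" for h
    by (simp add: inner_diff_right fun_eq_iff)
  then show "E = D" by (metis eq_iff_diff_eq_0 inner_eq_zero_iff)
qed

lemma GDERIV_grad:
  fixes f :: "'a::euclidean_space \<Rightarrow> real"
  assumes "f differentiable (at x)"
  shows "GDERIV f x :> grad f x"
proof -
  obtain f' where f': "(f has_derivative f') (at x)" using assms unfolding differentiable_def by blast
  then interpret bounded_linear f' by (rule has_derivative_bounded_linear)
  define D where "D = (\<Sum>i\<in>Basis. f' i *\<^sub>R i)"
  have "f' h = inner h D" for h
  proof -
    have "f' h = f' (\<Sum>i\<in>Basis. (h \<bullet> i) *\<^sub>R i)" by (simp add: euclidean_representation)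
    also have "\<dots> = (\<Sum>i\<in>Basis. (h \<bullet> i) * f' i)" by (simp add: sum scaleR)
    also have "\<dots> = inner h D" by (simp add: D_def inner_sum_right mult.commute)
    finally show ?thesis .
  qed
  then have "f' = (\<lambda>h. inner h D)" by auto
  with f' have "GDERIV f x :> D" by (simp add: gderiv_def)
  then show ?thesis using grad_eqI by metis
qed

lemma continuous_on_grad:
  fixes f :: "'a::euclidean_space \<Rightarrow> real"
  assumes "Ck_fun (Suc 0) f"
  shows "continuous_on UNIV (grad f)"
proof -
  have "continuous_on UNIV (\<lambda>x. \<Sum>i\<in>Basis. (grad f x \<bullet> i) *\<^sub>R i)"
    using assms by (intro continuous_on_sum continuous_on_scaleR continuous_on_const) auto
  then show ?thesis by (simp add: euclidean_representation)
qed

lemma test_fun_GDERIV: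
  fixes f :: "'a::euclidean_space \<Rightarrow> real"
  assumes "f \<in> test_funs"
  shows "GDERIV f x :> grad f x"
proof -
  have "Ck_fun (Suc 0) f" using assms unfolding test_funs_def by blast
  then show ?thesis by (intro GDERIV_grad) (simp add: differentiable_on_def)
qed

lemma test_fun_continuous:
  fixes f :: "'a::euclidean_space \<Rightarrow> real"
  assumes "f \<in> test_funs"
  shows "continuous_on UNIV f" "continuous_on UNIV (grad f)"
proof -
  have "Ck_fun 0 f" "Ck_fun (Suc 0) f" using assms unfolding test_funs_def by blast+
  then show "continuous_on UNIV f" "continuous_on UNIV (grad f)" 
    by (simp_all add: continuous_on_grad del: Ck_fun.simps(2))
qed

lemma test_fun_measurable:
  fixes f :: "'a::euclidean_space \<Rightarrow> real"
  assumes "f \<in> test_funs"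
  shows "f \<in> borel_measurable borel" "grad f \<in> borel_measurable borel"
  using test_fun_continuous[OF assms] by (auto intro: borel_measurable_continuous_onI)

lemma test_fun_support:
  fixes f :: "'a::euclidean_space \<Rightarrow> real"
  assumes "f \<in> test_funs"
  obtains R where "R > 0" "\<And>z. norm z \<ge> R \<Longrightarrow> f z = 0" "\<And>z. norm z \<ge> R \<Longrightarrow> grad f z = 0"
proof -
  have "bounded {x. f x \<noteq> 0}"
    using assms bounded_subset[OF compact_imp_bounded closure_subset] unfolding test_funs_def by blast
  then obtain R where R: "\<And>x. f x \<noteq> 0 \<Longrightarrow> norm x \<le> R" unfolding bounded_iff by blast
  have f0: "f z = 0" if "norm z > R" for z using R[of z] that by force
  have g0: "grad f z = 0" if "norm z > R" for z
  proof (rule grad_eqI)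
    have op: "open {z::'a. norm z > R}" by (intro open_Collect_less continuous_intros)
    have "((\<lambda>_. 0) has_derivative (\<lambda>h. inner h 0)) (at z)" by simp
    from has_derivative_transform_within_open[OF this op] show "GDERIV f z :> 0"
      unfolding gderiv_def using that f0 by simp
  qed
  \<comment> \<open>The gradient is known to vanish for |z| > R only; the enlarged radius gives the
    non-strict form and is positive whatever the sign of \<open>R\<close>.\<close>
  show thesis by (rule that[of "\<bar>R\<bar> + 1"]) (auto intro!: f0 g0)
qed

lemma test_fun_bounded:
  fixes f :: "'a::euclidean_space \<Rightarrow> real"
  assumes "f \<in> test_funs"
  obtains K where "K > 0" "\<And>z. \<bar>f z\<bar> \<le> K" "\<And>z. norm (grad f z) \<le> K"
proof -
  obtain R where R: "R > 0" "\<And>z. norm z \<ge> R \<Longrightarrow> f z = 0" "\<And>z. norm z \<ge> R \<Longrightarrow> grad f z = 0"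
    using test_fun_support[OF assms] by blast
  have "bounded (f ` cball 0 R)" "bounded (grad f ` cball 0 R)"
    using test_fun_continuous[OF assms]
    by (auto intro!: compact_imp_bounded compact_continuous_image intro: continuous_on_subset)
  then obtain K1 K2 where "\<forall>z\<in>cball 0 R. \<bar>f z\<bar> \<le> K1" "\<forall>z\<in>cball 0 R. norm (grad f z) \<le> K2"
    unfolding bounded_iff by auto
  then have K: "norm z \<le> R \<Longrightarrow> \<bar>f z\<bar> \<le> K1" "norm z \<le> R \<Longrightarrow> norm (grad f z) \<le> K2" for z
    by auto
  show thesis
  proof (rule that[of "max 1 (max K1 K2)"])
    fix z show "\<bar>f z\<bar> \<le> max 1 (max K1 K2)" using K(1)[of z] R(2)[of z] by (cases "norm z \<le> R") auto
    show "norm (grad f z) \<le> max 1 (max K1 K2)" using K(2)[of z] R(3)[of z] by (cases "norm z \<le> R") auto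
  qed auto
qed

lemma grad_affine:
  fixes f :: "'a::euclidean_space \<Rightarrow> real"
  assumes "GDERIV f (s *\<^sub>R (z - z0)) :> D"
  shows "GDERIV (\<lambda>z. c * f (s *\<^sub>R (z - z0))) z :> (c * s) *\<^sub>R D"
proof -
  have "(f has_derivative (\<lambda>h. inner h D)) (at (s *\<^sub>R (z - z0)))" using assms by (simp add: gderiv_def)
  moreover have "((\<lambda>z. s *\<^sub>R (z - z0)) has_derivative (\<lambda>h. s *\<^sub>R h)) (at z)"
    by (auto intro!: derivative_eq_intros)
  ultimately have "((f \<circ> (\<lambda>z. s *\<^sub>R (z - z0))) has_derivative (\<lambda>h. inner h D) \<circ> (\<lambda>h. s *\<^sub>R h)) (at z)"
    using diff_chain_at by blast
  from has_derivative_mult_right[OF this, of c] show ?thesis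
    by (simp add: gderiv_def o_def mult.assoc)
qed

text \<open>The factor \<open>c\<close> serves the induction: differentiating pulls out another
  \<open>s\<close>, so a partial derivative has the same form again, with \<open>c * s\<close> and a
  partial derivative of \<open>f\<close>.\<close>

lemma Ck_fun_affine:
  fixes f :: "'a::euclidean_space \<Rightarrow> real"
  assumes "Ck_fun n f"
  shows "Ck_fun n (\<lambda>z. c * f (s *\<^sub>R (z - z0)))"
  using assms
proof (induction n arbitrary: f c)
  case 0
  then have c: "continuous_on UNIV f" by simp
  have "continuous_on UNIV (\<lambda>z. s *\<^sub>R (z - z0))" by (intro continuous_intros)
  from continuous_on_compose2[OF c this] have "continuous_on UNIV (\<lambda>z. f (s *\<^sub>R (z - z0)))" by simp
  then show ?case by (simp add: continuous_on_mult_left)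
next
  case (Suc n)
  have D: "GDERIV (\<lambda>z. c * f (s *\<^sub>R (z - z0))) z :> (c * s) *\<^sub>R grad f (s *\<^sub>R (z - z0))" for z
    using Suc.prems by (intro grad_affine GDERIV_grad) (simp add: differentiable_on_def)
  have "(\<lambda>z. grad (\<lambda>z. c * f (s *\<^sub>R (z - z0))) z \<bullet> i)
      = (\<lambda>z. (c * s) * (grad f (s *\<^sub>R (z - z0)) \<bullet> i))" for i
    by (auto simp: grad_eqI[OF D])
  moreover have "Ck_fun n (\<lambda>z. (c * s) * (grad f (s *\<^sub>R (z - z0)) \<bullet> i))" if "i \<in> Basis" for i
    using Suc.IH[of "\<lambda>z. grad f z \<bullet> i" "c * s"] Suc.prems that by simp
  moreover have "(\<lambda>z. c * f (s *\<^sub>R (z - z0))) differentiable_on UNIV"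
    using D unfolding differentiable_on_def gderiv_def differentiable_def by auto
  ultimately show ?case by simp
qed

lemma test_fun_affine:
  fixes f :: "'a::euclidean_space \<Rightarrow> real"
  assumes "f \<in> test_funs" "s > 0"
  shows "(\<lambda>z. f (s *\<^sub>R (z - z0))) \<in> test_funs"
    and "grad (\<lambda>z. f (s *\<^sub>R (z - z0))) z = s *\<^sub>R grad f (s *\<^sub>R (z - z0))"
proof -
  obtain R where R: "R > 0" "\<And>z. norm z \<ge> R \<Longrightarrow> f z = 0" "\<And>z. norm z \<ge> R \<Longrightarrow> grad f z = 0"
    using test_fun_support[OF assms(1)] by blast
  have "{x. f (s *\<^sub>R (x - z0)) \<noteq> 0} \<subseteq> cball z0 (R / s)"
  proof clarify
    fix x assume "f (s *\<^sub>R (x - z0)) \<noteq> 0"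
    with R(2) have "norm (s *\<^sub>R (x - z0)) < R" by (meson not_less)
    then have "s * norm (x - z0) < R" using assms(2) by (simp only: norm_scaleR abs_of_pos)
    with assms(2) show "x \<in> cball z0 (R / s)"
      by (simp add: dist_norm norm_minus_commute pos_le_divide_eq mult.commute)
  qed
  then have "compact (closure {x. f (s *\<^sub>R (x - z0)) \<noteq> 0})"
    using bounded_subset[OF bounded_cball] by (simp add: compact_closure)
  moreover have "Ck_fun n (\<lambda>z. f (s *\<^sub>R (z - z0)))" for n
    using Ck_fun_affine[of n f 1 s z0] assms(1) by (simp add: test_funs_def)
  ultimately show "(\<lambda>z. f (s *\<^sub>R (z - z0))) \<in> test_funs" by (simp add: test_funs_def)
  show "grad (\<lambda>z. f (s *\<^sub>R (z - z0))) z = s *\<^sub>R grad f (s *\<^sub>R (z - z0))"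
    using grad_affine[OF test_fun_GDERIV[OF assms(1)], where c = 1] by (auto intro: grad_eqI)
qed

section \<open>A smooth bump function built from exp (-1/t)\<close>

definition flat :: "nat \<Rightarrow> real \<Rightarrow> real" where
  "flat m t = (if t > 0 then exp (- 1 / t) / t ^ m else 0)"

text \<open>The term of order \<open>m + 2\<close> in the series of exp (1/t) bounds it from below;
  this absorbs t^m and leaves t^2. The quadratic bound is what makes the derivative at 0
  vanish.\<close>

lemma flat_le: "\<bar>flat m t\<bar> \<le> fact (m + 2) * t\<^sup>2"
proof (cases "t > 0")
  case True
  have "(1 / t) ^ (m + 2) / fact (m + 2) \<le> exp (1 / t)"
  proof -
    have "(\<Sum>n\<in>{m+2}. inverse (fact n) *\<^sub>R (1 / t) ^ n) \<le> exp (1 / t)"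
      unfolding exp_def using True
      by (intro sum_le_suminf summable_exp_generic) auto
    then show ?thesis by (simp add: divide_inverse mult.commute)
  qed
  then have "1 \<le> fact (m + 2) * t ^ (m + 2) * exp (1 / t)"
    using True by (simp add: field_simps del: fact_Suc)
  then have "exp (- 1 / t) \<le> fact (m + 2) * t ^ (m + 2)"
    using True by (simp add: exp_minus field_simps del: fact_Suc)
  moreover have "fact (m + 2) * t ^ (m + 2) = fact (m + 2) * t\<^sup>2 * t ^ m"
    by (simp only: power_add mult_ac)
  ultimately have "exp (- 1 / t) / t ^ m \<le> fact (m + 2) * t\<^sup>2"
    using True by (simp only: pos_divide_le_eq zero_less_power)
  then show ?thesis using True by (simp add: flat_def)
qed (simp add: flat_def)

text \<open>Up to linear combinations the family exp (-1/t) / t^m is closed under differentiation,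
  which replaces the usual polynomials in 1/t. For t > 0 this is the quotient rule; at 0 the
  difference quotient is bounded by a multiple of |h|.\<close>

lemma DERIV_flat: "DERIV (flat m) t :> flat (m + 2) t - real m * flat (m + 1) t"
proof -
  consider "t > 0" | "t < 0" | "t = 0" by linarith
  then show ?thesis
  proof cases
    case 1
    have "((\<lambda>t. exp (- 1 / t) / t ^ m) has_real_derivative
        flat (m + 2) t - real m * flat (m + 1) t) (at t)"
    \<comment> \<open>With \<open>m = Suc n\<close> the derivative of t^m can be written without the
      truncated exponent m - 1.\<close>
    proof (cases m)
      case 0
      then show ?thesis using 1
        by (auto intro!: derivative_eq_intros simp: flat_def field_simps power2_eq_square)
    next
      case (Suc n)
      have P: "((\<lambda>t. t ^ m) has_real_derivative real m * t ^ n) (at t)"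
        using DERIV_pow[of m t] Suc by simp
      have E: "((\<lambda>t. exp (- 1 / t)) has_real_derivative exp (- 1 / t) / t\<^sup>2) (at t)"
        using 1 by (auto intro!: derivative_eq_intros simp: field_simps power2_eq_square)
      have "t ^ m \<noteq> 0" using 1 by simp
      from DERIV_divide[OF E P this] show ?thesis
        by (rule DERIV_cong) (use 1 in \<open>simp add: flat_def Suc field_simps power2_eq_square\<close>)
    qed
    then show ?thesis
      by (rule has_field_derivative_transform_within_open[where S="{0<..}"]) (use 1 in \<open>auto simp: flat_def\<close>)
  next
    case 2
    have "((\<lambda>t. 0) has_real_derivative flat (m + 2) t - real m * flat (m + 1) t) (at t)"
      using 2 by (simp add: flat_def)
    then show ?thesis
      by (rule has_field_derivative_transform_within_open[where S="{..<0}"]) (use 2 in \<open>auto simp: flat_def\<close>)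
  next
    case 3
    have "((\<lambda>h. flat m h / h) \<longlongrightarrow> 0) (at 0)"
    proof (rule Lim_null_comparison)
      have "norm (flat m h / h) \<le> fact (m + 2) * \<bar>h\<bar>" if "h \<noteq> 0" for h
      proof -
        have "fact (m + 2) * h\<^sup>2 = (fact (m + 2) * \<bar>h\<bar>) * \<bar>h\<bar>"
          by (simp add: power2_eq_square del: fact_Suc)
        then show ?thesis
          using flat_le[of m h] that unfolding real_norm_def abs_divide by (subst pos_divide_le_eq) simp_all
      qed
      then show "\<forall>\<^sub>F h in at 0. norm (flat m h / h) \<le> fact (m + 2) * \<bar>h\<bar>"
        by (auto simp: eventually_at_filter)
      show "((\<lambda>h. fact (m + 2) * \<bar>h\<bar>) \<longlongrightarrow> 0) (at (0::real))"
        by (auto intro!: tendsto_eq_intros)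
    qed
    then show ?thesis using 3 by (simp add: DERIV_def flat_def)
  qed
qed

text \<open>A set of functions closed under partial derivatives, so that differentiability of its
  members yields all orders by induction. Multiplication by coordinates is included because the
  gradient of 1 - |z|^2 is -2z.\<close>

inductive_set flat_class :: "('a::euclidean_space \<Rightarrow> real) set" where
  flat: "(\<lambda>z. flat m (1 - z \<bullet> z)) \<in> flat_class"
| add: "f \<in> flat_class \<Longrightarrow> g \<in> flat_class \<Longrightarrow> (\<lambda>z. f z + g z) \<in> flat_class"
| scale: "f \<in> flat_class \<Longrightarrow> (\<lambda>z. c * f z) \<in> flat_class"
| coord: "f \<in> flat_class \<Longrightarrow> (\<lambda>z. (z \<bullet> i) * f z) \<in> flat_class"

text \<open>Induction on the generation of the class: the chain rule turns a generator into a
  coordinate times a combination of two generators, and the sum and product rules stay in the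
  class.\<close>

lemma flat_class_GDERIV:
  fixes f :: "'a::euclidean_space \<Rightarrow> real"
  assumes "f \<in> flat_class"
  shows "\<exists>G. (\<forall>x. GDERIV f x :> G x) \<and> (\<forall>j. (\<lambda>x. G x \<bullet> j) \<in> flat_class)"
  using assms
proof induction
  case (flat m)
  define G where "G x = (flat (m + 2) (1 - x \<bullet> x) - real m * flat (m + 1) (1 - x \<bullet> x)) *\<^sub>R (-2 *\<^sub>R x)" for x :: 'a
  have "GDERIV (\<lambda>z. flat m (1 - z \<bullet> z)) x :> G x" for x :: 'a
    unfolding G_def
  proof (rule GDERIV_DERIV_compose[OF _ DERIV_flat])
    show "GDERIV (\<lambda>z. 1 - z \<bullet> z) x :> -2 *\<^sub>R x"
      unfolding gderiv_def by (auto intro!: derivative_eq_intros simp: inner_commute)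
  qed
  moreover have "(\<lambda>x. G x \<bullet> j) \<in> flat_class" for j
  proof -
    have "(\<lambda>x. (-2) * ((x \<bullet> j) * (flat (m + 2) (1 - x \<bullet> x) + (- real m) * flat (m + 1) (1 - x \<bullet> x)))) \<in> flat_class"
      by (intro flat_class.intros)
    moreover have "(\<lambda>x. (-2) * ((x \<bullet> j) * (flat (m + 2) (1 - x \<bullet> x) + (- real m) * flat (m + 1) (1 - x \<bullet> x))))
        = (\<lambda>x. G x \<bullet> j)" by (simp add: G_def fun_eq_iff)
    ultimately show ?thesis by simp
  qed
  ultimately show ?case by blast
next
  case (add f g)
  then obtain F G where "\<forall>x. GDERIV f x :> F x" "\<forall>j. (\<lambda>x. F x \<bullet> j) \<in> flat_class"
    "\<forall>x. GDERIV g x :> G x" "\<forall>j. (\<lambda>x. G x \<bullet> j) \<in> flat_class" by blast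
  then show ?case
    by (intro exI[of _ "\<lambda>x. F x + G x"]) (auto intro: GDERIV_add flat_class.add simp: inner_add_left)
next
  case (scale f c)
  then obtain F where F: "\<forall>x. GDERIV f x :> F x" "\<forall>j. (\<lambda>x. F x \<bullet> j) \<in> flat_class" by blast
  have "GDERIV (\<lambda>z. c * f z) x :> c *\<^sub>R F x" for x
    using GDERIV_mult[OF GDERIV_const[of c x], of f "F x"] F by simp
  then show ?case using F
    by (intro exI[of _ "\<lambda>x. c *\<^sub>R F x"]) (auto intro: flat_class.scale)
next
  case (coord f i)
  then obtain F where F: "\<forall>x. GDERIV f x :> F x" "\<forall>j. (\<lambda>x. F x \<bullet> j) \<in> flat_class" by blast
  have "GDERIV (\<lambda>z. (z \<bullet> i) * f z) x :> (x \<bullet> i) *\<^sub>R F x + f x *\<^sub>R i" for x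
    using F by (intro GDERIV_mult) (auto simp: gderiv_def intro!: derivative_eq_intros)
  moreover have "(\<lambda>x. ((x \<bullet> i) *\<^sub>R F x + f x *\<^sub>R i) \<bullet> j) \<in> flat_class" for j
  proof -
    have "(\<lambda>x. (x \<bullet> i) * (F x \<bullet> j) + (i \<bullet> j) * f x) \<in> flat_class"
      using F coord by (intro flat_class.intros) auto
    then show ?thesis by (simp add: inner_add_left mult.commute)
  qed
  ultimately show ?case by (intro exI[of _ "\<lambda>x. (x \<bullet> i) *\<^sub>R F x + f x *\<^sub>R i"]) blast
qed

lemma flat_class_Ck_fun:
  fixes f :: "'a::euclidean_space \<Rightarrow> real"
  assumes "f \<in> flat_class"
  shows "Ck_fun n f"
  using assms
proof (induction n arbitrary: f)
  case 0
  then obtain G where "\<forall>x. GDERIV f x :> G x" using flat_class_GDERIV by blast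
  then show ?case by (auto simp: gderiv_def continuous_on_eq_continuous_at intro: has_derivative_continuous)
next
  case (Suc n)
  then obtain G where G: "\<forall>x. GDERIV f x :> G x" "\<forall>j. (\<lambda>x. G x \<bullet> j) \<in> flat_class"
    using flat_class_GDERIV by blast
  then have "grad f = G" using grad_eqI by blast
  with G Suc.IH show ?case
    by (auto simp: gderiv_def differentiable_on_def differentiable_def)
qed

text \<open>The witness is exp (-1 / (1 - |z|^2)) in the unit ball, continued by 0.\<close>

lemma bump_exists:
  obtains f :: "'a::euclidean_space \<Rightarrow> real"
  where "f \<in> test_funs" "f 0 \<noteq> 0" "\<And>z. norm z \<ge> 1 \<Longrightarrow> f z = 0"
proof -
  define f where "f z = flat 0 (1 - z \<bullet> z)" for z :: 'a
  have z: "f z = 0" if "norm z \<ge> 1" for z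
  proof -
    have "1 \<le> (norm z)\<^sup>2" using that by (simp add: one_le_power)
    then show ?thesis by (simp add: f_def flat_def power2_norm_eq_inner)
  qed
  then have "{x. f x \<noteq> 0} \<subseteq> cball 0 1" by (force simp: not_le)
  then have "compact (closure {x. f x \<noteq> 0})"
    using bounded_subset[OF bounded_cball] by (simp add: compact_closure)
  moreover have "f \<in> flat_class" unfolding f_def by (rule flat_class.flat)
  ultimately have "f \<in> test_funs" using flat_class_Ck_fun by (auto simp: test_funs_def)
  moreover have "f 0 \<noteq> 0" by (simp add: f_def flat_def)
  ultimately show thesis using that z by blast
qed

section \<open>Integrals of the weights\<close>

text \<open>After taking logarithms, |ln B - ln A| \<le> ln L, and multiplication by
  \<open>s\<close> costs the factor |s| whatever its sign. This is the tool for freezing a weight on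
  a set where its base varies by a bounded factor.\<close>

lemma powr_comparable:
  fixes A B L s :: real
  assumes "A > 0" "L \<ge> 1" "A \<le> L * B" "B \<le> L * A"
  shows "B powr s \<le> L powr \<bar>s\<bar> * A powr s" "L powr (- \<bar>s\<bar>) * A powr s \<le> B powr s"
proof -
  have B: "B > 0" using assms by (smt (verit) mult_nonneg_nonpos)
  have l: "\<bar>ln B - ln A\<bar> \<le> ln L"
  proof -
    have "ln A \<le> ln L + ln B" "ln B \<le> ln L + ln A"
      using assms B by (simp_all flip: ln_mult_pos)
    then show ?thesis by linarith
  qed
  then have "\<bar>s * (ln B - ln A)\<bar> \<le> \<bar>s\<bar> * ln L"
    by (simp add: abs_mult mult_left_mono)
  then have "s * ln B \<le> \<bar>s\<bar> * ln L + s * ln A" "- \<bar>s\<bar> * ln L + s * ln A \<le> s * ln B"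
    by (simp_all add: algebra_simps abs_le_iff)
  then show "B powr s \<le> L powr \<bar>s\<bar> * A powr s" "L powr (- \<bar>s\<bar>) * A powr s \<le> B powr s"
    using assms B by (simp_all add: powr_def flip: exp_add)
qed

lemma dyadic_shell:
  fixes \<rho> r :: real
  assumes "0 < \<rho>" "\<rho> < r"
  obtains n :: nat where "\<rho> < r * 2 powr (- real n)" "r * 2 powr (- real n) \<le> 2 * \<rho>"
proof -
  define L where "L = log 2 (r / \<rho>)"
  have L0: "L > 0" using assms by (simp add: L_def)
  have r: "r = \<rho> * 2 powr L" using assms by (simp add: L_def)
  \<comment> \<open>\<open>\<lceil>L\<rceil> - 1\<close> and not the floor: n < L \<le> n + 1 is
    needed with strict inequality on the left, also for integral \<open>L\<close>.\<close>
  define n where "n = nat (\<lceil>L\<rceil> - 1)"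
  have n: "real n < L" "L \<le> real n + 1" using L0 unfolding n_def by linarith+
  have "r * 2 powr (- real n) = \<rho> * 2 powr (L - real n)"
    by (simp add: r flip: powr_add)
  moreover have "2 powr 0 < 2 powr (L - real n)" "2 powr (L - real n) \<le> 2 powr 1"
    using n by (intro powr_less_mono powr_mono; simp)+
  ultimately show thesis using assms by (intro that[of n]) auto
qed

text \<open>On the shell where \<open>\<rho>\<close> lies between r 2^(-n-1) and r 2^(-n), its power
  is comparable to that of the outer radius, and the shells contribute a geometric series with ratio
  2^(-(D + \<beta>)). With F = 1 this integrates a power of |y|, with F = |y|^\<alpha> the product
  weight.\<close>

lemma nn_integral_powr_shells:
  fixes F :: "'a \<Rightarrow> ennreal" and \<rho> :: "'a \<Rightarrow> real"
  assumes [measurable]: "F \<in> borel_measurable M" "\<rho> \<in> borel_measurable M"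
    and nonneg: "\<And>x. \<rho> x \<ge> 0" and "C \<ge> 0"
    and bound: "\<And>r. r > 0 \<Longrightarrow> (\<integral>\<^sup>+x. F x * indicator {x. \<rho> x < r} x \<partial>M) \<le> ennreal (C * r powr D)"
    and pos: "D + \<beta> > 0"
  shows "\<exists>C'\<ge>0. \<forall>r>0. (\<integral>\<^sup>+x. F x * ennreal (\<rho> x powr \<beta>) * indicator {x. \<rho> x < r} x \<partial>M)
           \<le> ennreal (C' * r powr (D + \<beta>))"
proof -
  define \<theta> where "\<theta> = 2 powr (- (D + \<beta>))"
  have \<theta>: "0 < \<theta>" "\<theta> < 1" using pos by (simp_all add: \<theta>_def powr_less_one)
  define K where "K = 2 powr \<bar>\<beta>\<bar> * C / (1 - \<theta>)"
  have "(\<integral>\<^sup>+x. F x * ennreal (\<rho> x powr \<beta>) * indicator {x. \<rho> x < r} x \<partial>M)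
           \<le> ennreal (K * r powr (D + \<beta>))" if r: "r > 0" for r
  proof -
    define rn where "rn n = r * 2 powr (- real n)" for n :: nat
    have rn: "rn n > 0" for n using r by (simp add: rn_def)
    define c where "c n = 2 powr \<bar>\<beta>\<bar> * rn n powr \<beta>" for n
    have c: "c n \<ge> 0" for n by (simp add: c_def)
    have pw: "ennreal (\<rho> x powr \<beta>) * indicator {x. \<rho> x < r} x
        \<le> (\<Sum>n. ennreal (c n) * indicator {x. \<rho> x < rn n} x)" for x
    proof (cases "0 < \<rho> x \<and> \<rho> x < r")
      case True
      then obtain n where n: "\<rho> x < rn n" "rn n \<le> 2 * \<rho> x"
        unfolding rn_def using dyadic_shell by blast
      have "\<rho> x powr \<beta> \<le> c n" unfolding c_def
        using powr_comparable(1)[of "rn n" 2 "\<rho> x" \<beta>] n rn by simp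
      then have "ennreal (\<rho> x powr \<beta>) * indicator {x. \<rho> x < r} x
          \<le> (\<Sum>n\<in>{n}. ennreal (c n) * indicator {x. \<rho> x < rn n} x)"
        using True n by (simp add: ennreal_leI)
      also have "\<dots> \<le> (\<Sum>n. ennreal (c n) * indicator {x. \<rho> x < rn n} x)"
        by (rule sum_le_suminf) auto
      finally show ?thesis .
    next
      case False
      \<comment> \<open>Points with \<open>\<rho> x = 0\<close> contribute nothing, even for
        negative \<beta>, since \<open>0 powr \<beta> = 0\<close>.\<close>
      then have "\<rho> x = 0 \<or> \<not> \<rho> x < r" using nonneg[of x] by auto
      then show ?thesis by auto
    qed
    have "(\<integral>\<^sup>+x. F x * ennreal (\<rho> x powr \<beta>) * indicator {x. \<rho> x < r} x \<partial>M)
        \<le> (\<integral>\<^sup>+x. (\<Sum>n. ennreal (c n) * (F x * indicator {x. \<rho> x < rn n} x)) \<partial>M)"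
    proof (rule nn_integral_mono)
      fix x
      have "F x * ennreal (\<rho> x powr \<beta>) * indicator {x. \<rho> x < r} x
          \<le> F x * (\<Sum>n. ennreal (c n) * indicator {x. \<rho> x < rn n} x)"
        unfolding mult.assoc by (rule mult_left_mono[OF pw]) simp
      also have "\<dots> = (\<Sum>n. ennreal (c n) * (F x * indicator {x. \<rho> x < rn n} x))"
        by (simp add: mult_ac flip: ennreal_suminf_cmult)
      finally show "F x * ennreal (\<rho> x powr \<beta>) * indicator {x. \<rho> x < r} x \<le> \<dots>" .
    qed
    also have "\<dots> = (\<Sum>n. ennreal (c n) * (\<integral>\<^sup>+x. F x * indicator {x. \<rho> x < rn n} x \<partial>M))"
      by (subst nn_integral_suminf) (auto simp: nn_integral_cmult)
    also have "\<dots> \<le> (\<Sum>n. ennreal (2 powr \<bar>\<beta>\<bar> * C * r powr (D + \<beta>) * \<theta> ^ n))"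
    proof (intro suminf_le summableI)
      fix n
      have "ennreal (c n) * (\<integral>\<^sup>+x. F x * indicator {x. \<rho> x < rn n} x \<partial>M)
          \<le> ennreal (c n) * ennreal (C * rn n powr D)"
        by (intro mult_left_mono bound rn) simp
      also have "\<dots> = ennreal (c n * (C * rn n powr D))"
        using c by (simp add: ennreal_mult')
      also have "c n * (C * rn n powr D) = 2 powr \<bar>\<beta>\<bar> * C * r powr (D + \<beta>) * \<theta> ^ n"
      proof -
        have "rn n powr \<beta> * rn n powr D = rn n powr (D + \<beta>)" by (simp add: powr_add)
        also have "\<dots> = r powr (D + \<beta>) * (2 powr (- real n)) powr (D + \<beta>)"
          unfolding rn_def using r by (simp add: powr_mult)
        also have "(2 powr (- real n)) powr (D + \<beta>) = \<theta> ^ n"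
          by (simp add: \<theta>_def powr_powr algebra_simps flip: powr_realpow)
        finally have *: "rn n powr \<beta> * rn n powr D = r powr (D + \<beta>) * \<theta> ^ n" .
        have "c n * (C * rn n powr D) = 2 powr \<bar>\<beta>\<bar> * C * (rn n powr \<beta> * rn n powr D)"
          by (simp only: c_def mult_ac)
        then show ?thesis unfolding * by (simp only: mult_ac)
      qed
      finally show "ennreal (c n) * (\<integral>\<^sup>+x. F x * indicator {x. \<rho> x < rn n} x \<partial>M)
        \<le> ennreal (2 powr \<bar>\<beta>\<bar> * C * r powr (D + \<beta>) * \<theta> ^ n)" .
    qed
    also have "\<dots> = ennreal (\<Sum>n. 2 powr \<bar>\<beta>\<bar> * C * r powr (D + \<beta>) * \<theta> ^ n)"
      using \<theta> \<open>C \<ge> 0\<close> by (intro suminf_ennreal2 summable_mult summable_geometric) auto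
    also have "(\<Sum>n. 2 powr \<bar>\<beta>\<bar> * C * r powr (D + \<beta>) * \<theta> ^ n) = K * r powr (D + \<beta>)"
      using \<theta> by (subst suminf_mult) (auto simp: suminf_geometric K_def summable_geometric)
    finally show ?thesis .
  qed
  moreover have "K \<ge> 0" using \<theta> \<open>C \<ge> 0\<close> by (simp add: K_def)
  ultimately show ?thesis by blast
qed

lemma nn_integral_norm_powr_ball:
  assumes "real DIM('y::euclidean_space) + \<alpha> > 0"
  shows "\<exists>C\<ge>0. \<forall>r>0. (\<integral>\<^sup>+y. ennreal (norm (y::'y) powr \<alpha>) * indicator {y. norm y < r} y \<partial>lborel)
           \<le> ennreal (C * r powr (real DIM('y) + \<alpha>))"
proof -
  have "(\<integral>\<^sup>+y. 1 * indicator {y. norm (y::'y) < r} y \<partial>lborel)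
      \<le> ennreal (unit_ball_vol (real DIM('y)) * r powr real DIM('y))" if "r > 0" for r
  proof -
    have "{y::'y. norm y < r} = ball 0 r" by (auto simp: dist_norm)
    then show ?thesis using that by (simp add: emeasure_ball powr_realpow)
  qed
  from nn_integral_powr_shells[OF _ _ _ _ this assms] show ?thesis
    by simp
qed

text \<open>Fubini on a product of balls. The ball in x has an arbitrary centre, because the bound
  also serves balls that are close to y = 0 but far from the origin.\<close>

lemma nn_integral_norm_snd_powr_box:
  assumes "real DIM('y::euclidean_space) + \<alpha> > 0"
  shows "\<exists>C\<ge>0. \<forall>r>0. \<forall>s>0. \<forall>x0::'x::euclidean_space.
    (\<integral>\<^sup>+z. ennreal (norm (snd (z::'x \<times> 'y)) powr \<alpha>) *
        indicator (ball x0 r \<times> ball 0 s) z \<partial>lborel)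
      \<le> ennreal (C * r powr real DIM('x) * s powr (real DIM('y) + \<alpha>))"
proof -
  obtain C where C: "C \<ge> 0" "\<And>s. s > 0 \<Longrightarrow>
      (\<integral>\<^sup>+y. ennreal (norm (y::'y) powr \<alpha>) * indicator {y. norm y < s} y \<partial>lborel)
           \<le> ennreal (C * s powr (real DIM('y) + \<alpha>))"
    using nn_integral_norm_powr_ball[OF assms] by blast
  define \<omega> where "\<omega> = unit_ball_vol (real DIM('x))"
  have "(\<integral>\<^sup>+z. ennreal (norm (snd (z::'x \<times> 'y)) powr \<alpha>) *
        indicator (ball x0 r \<times> ball 0 s) z \<partial>lborel)
      \<le> ennreal (\<omega> * C * r powr real DIM('x) * s powr (real DIM('y) + \<alpha>))" if "r > 0" "s > 0" for r s x0
  proof -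
    have [measurable]: "ball x0 r \<times> (ball 0 s :: 'y set) \<in> sets borel"
      by (intro borel_open open_Times) auto
    have [measurable]: "(\<lambda>z::'x \<times> 'y. norm (snd z)) \<in> borel_measurable borel"
      by (intro borel_measurable_continuous_onI continuous_intros)
    have "(\<integral>\<^sup>+z. ennreal (norm (snd (z::'x \<times> 'y)) powr \<alpha>) *
        indicator (ball x0 r \<times> ball 0 s) z \<partial>lborel)
      = (\<integral>\<^sup>+x. \<integral>\<^sup>+y. indicator (ball x0 r) x * (ennreal (norm (y::'y) powr \<alpha>) * indicator {y. norm y < s} y) \<partial>lborel \<partial>lborel)"
      unfolding lborel_prod[symmetric]
      by (subst lborel.nn_integral_fst[symmetric])
        (auto intro!: nn_integral_cong simp: lborel_prod split: split_indicator)
    also have "\<dots> = (\<integral>\<^sup>+x. indicator (ball x0 r) x * (\<integral>\<^sup>+y. ennreal (norm (y::'y) powr \<alpha>) * indicator {y. norm y < s} y \<partial>lborel) \<partial>lborel)"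
      by (intro nn_integral_cong nn_integral_cmult) auto
    also have "\<dots> = emeasure lborel (ball x0 r) * (\<integral>\<^sup>+y. ennreal (norm (y::'y) powr \<alpha>) * indicator {y. norm y < s} y \<partial>lborel)"
      by (subst nn_integral_multc) (auto intro!: borel_measurable_indicator)
    also have "\<dots> \<le> ennreal (\<omega> * r powr real DIM('x)) * ennreal (C * s powr (real DIM('y) + \<alpha>))"
      using that by (intro mult_mono C) (auto simp: emeasure_ball powr_realpow \<omega>_def)
    also have "\<dots> = ennreal (\<omega> * C * r powr real DIM('x) * s powr (real DIM('y) + \<alpha>))"
      using C(1) by (simp add: \<omega>_def mult_ac flip: ennreal_mult')
    finally show ?thesis .
  qed
  then show ?thesis using C(1) by (intro exI[of _ "\<omega> * C"]) (auto simp: \<omega>_def)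
qed

lemma wt_nonneg [simp]: "wt \<alpha> \<beta> z \<ge> 0"
  by (simp add: wt_def)

lemma borel_measurable_wt [measurable]: "wt \<alpha> \<beta> \<in> borel_measurable borel"
proof -
  have [measurable]: "(\<lambda>z. norm (snd z)) \<in> borel_measurable borel"
    by (intro borel_measurable_continuous_onI continuous_intros)
  show ?thesis unfolding wt_def by measurable
qed

lemma norm_snd_le_norm: "norm (snd z) \<le> norm z"
  by (metis norm_snd_le prod.collapse)

lemma norm_fst_le_norm: "norm (fst z) \<le> norm z"
  by (metis norm_fst_le prod.collapse)

text \<open>A ball about 0 lies in a product of balls of the same radius, which gives the growth
  r^(d + \<alpha>) for |y|^\<alpha>; the factor |z|^\<beta> is then inserted shell by shell.\<close>

lemma nn_integral_wt_ball_0: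
  assumes "real DIM('y::euclidean_space) + \<alpha> > 0" "real DIM('x::euclidean_space \<times> 'y) + \<alpha> + \<beta> > 0"
  shows "\<exists>C\<ge>0. \<forall>r>0. (\<integral>\<^sup>+z. ennreal (wt \<alpha> \<beta> (z::'x \<times> 'y)) * indicator {z. norm z < r} z \<partial>lborel)
           \<le> ennreal (C * r powr (real DIM('x \<times> 'y) + \<alpha> + \<beta>))"
proof -
  obtain C where C: "C \<ge> 0" "\<forall>r>0. \<forall>s>0. \<forall>x0.
    (\<integral>\<^sup>+z. ennreal (norm (snd (z::'x \<times> 'y)) powr \<alpha>) *
        indicator (ball x0 r \<times> ball 0 s) z \<partial>lborel)
      \<le> ennreal (C * r powr real DIM('x) * s powr (real DIM('y) + \<alpha>))"
    using nn_integral_norm_snd_powr_box[OF assms(1)] by blast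
  have bound: "(\<integral>\<^sup>+z. ennreal (norm (snd (z::'x \<times> 'y)) powr \<alpha>) * indicator {z. norm z < r} z \<partial>lborel)
      \<le> ennreal (C * r powr (real DIM('x \<times> 'y) + \<alpha>))" if "r > 0" for r
  proof -
    have "(\<integral>\<^sup>+z. ennreal (norm (snd (z::'x \<times> 'y)) powr \<alpha>) * indicator {z. norm z < r} z \<partial>lborel)
      \<le> (\<integral>\<^sup>+z. ennreal (norm (snd (z::'x \<times> 'y)) powr \<alpha>) *
        indicator (ball 0 r \<times> ball 0 r) z \<partial>lborel)"
      by (intro nn_integral_mono mult_left_mono)
        (auto split: split_indicator intro: le_less_trans[OF norm_fst_le] le_less_trans[OF norm_snd_le])
    also have "\<dots> \<le> ennreal (C * r powr real DIM('x) * r powr (real DIM('y) + \<alpha>))"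
      using C(2) that by blast
    also have "C * r powr real DIM('x) * r powr (real DIM('y) + \<alpha>) = C * r powr (real DIM('x \<times> 'y) + \<alpha>)"
      by (simp add: add.assoc flip: powr_add)
    finally show ?thesis .
  qed
  have [measurable]: "(\<lambda>z::'x \<times> 'y. norm (snd z)) \<in> borel_measurable borel"
    by (intro borel_measurable_continuous_onI continuous_intros)
  from nn_integral_powr_shells[OF _ _ _ C(1) bound, where \<beta> = \<beta>] assms(2) show ?thesis
    by (simp add: wt_def ennreal_mult' mult_ac)
qed


text \<open>Up to constants, the integral of \<^term>\<open>wt \<alpha> \<beta>\<close> over the ball of radius \<open>t\<close> about \<open>z\<close>.\<close>

definition ball_wt :: "real \<Rightarrow> real \<Rightarrow> 'x::euclidean_space \<times> 'y::euclidean_space \<Rightarrow> real \<Rightarrow> real" where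
  "ball_wt \<alpha> \<beta> z t =
     t powr real DIM('x \<times> 'y) * (norm (snd z) + t) powr \<alpha> * (norm z + t) powr \<beta>"

lemma norm_in_ball:
  fixes z :: "'x::euclidean_space \<times> 'y::euclidean_space"
  assumes "\<zeta> \<in> ball z r"
  shows "norm \<zeta> < norm z + r" "norm z - r < norm \<zeta>"
    "norm (snd \<zeta>) < norm (snd z) + r" "norm (snd z) - r < norm (snd \<zeta>)"
    "norm (fst \<zeta> - fst z) < r"
proof -
  have d: "norm (\<zeta> - z) < r" using assms by (simp add: dist_norm norm_minus_commute)
  have s: "norm (snd \<zeta> - snd z) < r" "norm (fst \<zeta> - fst z) < r"
    using d norm_snd_le_norm[of "\<zeta> - z"] norm_fst_le_norm[of "\<zeta> - z"] by simp_all
  then show "norm (fst \<zeta> - fst z) < r" by simp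
  show "norm \<zeta> < norm z + r" "norm z - r < norm \<zeta>"
    using d norm_triangle_ineq2[of \<zeta> z] norm_triangle_ineq3[of \<zeta> z] by linarith+
  show "norm (snd \<zeta>) < norm (snd z) + r" "norm (snd z) - r < norm (snd \<zeta>)"
    using s(1) norm_triangle_ineq3[of "snd \<zeta>" "snd z"] by linarith+
qed

text \<open>The ball has three possible positions: away from y = 0, where both powers are constant
  up to a factor; close to y = 0 but away from the origin, where only |z|^\<beta> is; close to the
  origin, where the bound for centred balls applies. Close means within \<open>2 * (K * t)\<close>.
  The dilation \<open>K\<close> leaves room for the enlarged balls of a covering.\<close>

lemma nn_integral_wt_ball:
  fixes \<alpha> \<beta> K :: real
  assumes \<alpha>: "real DIM('y::euclidean_space) + \<alpha> > 0"
    and \<beta>: "real DIM('x::euclidean_space \<times> 'y) + \<alpha> + \<beta> > 0" and K: "K \<ge> 1"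
  shows "\<exists>C\<ge>0. \<forall>(z::'x \<times> 'y) t. t > 0 \<longrightarrow>
    (\<integral>\<^sup>+\<zeta>. ennreal (wt \<alpha> \<beta> \<zeta>) * indicator (ball z (K * t)) \<zeta> \<partial>lborel) \<le> ennreal (C * ball_wt \<alpha> \<beta> z t)"
proof -
  let ?D = "real DIM('x \<times> 'y)" and ?m = "real DIM('x)" and ?k = "real DIM('y)"
  obtain C1 where C1: "C1 \<ge> 0" "\<forall>r>0. \<forall>s>0. \<forall>x0.
    (\<integral>\<^sup>+z. ennreal (norm (snd (z::'x \<times> 'y)) powr \<alpha>) * indicator (ball x0 r \<times> ball 0 s) z \<partial>lborel)
      \<le> ennreal (C1 * r powr ?m * s powr (?k + \<alpha>))"
    using nn_integral_norm_snd_powr_box[OF \<alpha>] by blast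
  obtain C2 where C2: "C2 \<ge> 0" "\<forall>r>0.
    (\<integral>\<^sup>+z. ennreal (wt \<alpha> \<beta> (z::'x \<times> 'y)) * indicator {z. norm z < r} z \<partial>lborel)
           \<le> ennreal (C2 * r powr (?D + \<alpha> + \<beta>))"
    using nn_integral_wt_ball_0[OF \<alpha> \<beta>] by blast
  \<comment> \<open>\<open>4 * K\<close> serves all comparisons: of \<open>A\<close> and
    \<open>B\<close> with the values on the ball if it is far from the singular set, and with
    \<open>t\<close> if it is close.\<close>
  define L where "L = 4 * K"
  define La where "La = L powr \<bar>\<alpha>\<bar>"
  define Lb where "Lb = L powr \<bar>\<beta>\<bar>"
  define E1 where "E1 = La * Lb * unit_ball_vol ?D * K powr ?D"
  define E2 where "E2 = Lb * C1 * K powr ?m * (3 * K) powr (?k + \<alpha>) * La"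
  define E3 where "E3 = C2 * (3 * K) powr (?D + \<alpha> + \<beta>) * La * Lb"
  have L: "L \<ge> 1" using K by (simp add: L_def)
  have L0: "La > 0" "Lb > 0" using L by (simp_all add: La_def Lb_def)
  have E: "E1 \<ge> 0" "E2 \<ge> 0" "E3 \<ge> 0"
    using C1(1) C2(1) L0 K by (simp_all add: E1_def E2_def E3_def)
  have "(\<integral>\<^sup>+\<zeta>. ennreal (wt \<alpha> \<beta> \<zeta>) * indicator (ball z (K * t)) \<zeta> \<partial>lborel)
      \<le> ennreal ((E1 + E2 + E3) * ball_wt \<alpha> \<beta> z t)" if t: "t > 0" for z :: "'x \<times> 'y" and t
  proof -
    let ?I = "\<integral>\<^sup>+\<zeta>. ennreal (wt \<alpha> \<beta> \<zeta>) * indicator (ball z (K * t)) \<zeta> \<partial>lborel"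
    define A where "A = norm (snd z) + t"
    define B where "B = norm z + t"
    have AB: "A > 0" "B > 0" using t by (simp_all add: A_def B_def add_nonneg_pos)
    have Kt: "K * t > 0" "t \<le> K * t" using t K by simp_all
    have Lt: "L * t = 4 * (K * t)" by (simp add: L_def)
    have V: "ball_wt \<alpha> \<beta> z t = t powr ?D * A powr \<alpha> * B powr \<beta>" by (simp add: ball_wt_def A_def B_def)
    have V0: "ball_wt \<alpha> \<beta> z t \<ge> 0" by (simp add: V)
    have yz: "norm (snd z) \<le> norm z" by (rule norm_snd_le_norm)
    have mono: "?thesis" if "?I \<le> ennreal (Ei * ball_wt \<alpha> \<beta> z t)" "Ei \<le> E1 + E2 + E3" for Ei
      using that V0 by (meson ennreal_leI mult_right_mono order_trans)
    have fourL: "4 * x \<le> L * x" if "x \<ge> 0" for x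
      using K that by (simp add: L_def mult_right_mono)
    have fA: "4 * A \<le> L * A" and fB: "4 * B \<le> L * B" using fourL AB by simp_all
    have far: "norm \<zeta> powr \<beta> \<le> Lb * B powr \<beta>" if "2 * (K * t) \<le> norm z" "\<zeta> \<in> ball z (K * t)" for \<zeta>
      unfolding Lb_def
    proof (rule powr_comparable(1)[OF AB(2) L])
      show "B \<le> L * norm \<zeta>" using norm_in_ball[OF that(2)] that(1) Kt fourL[OF norm_ge_zero, of \<zeta>] unfolding B_def by linarith
      show "norm \<zeta> \<le> L * B" using norm_in_ball[OF that(2)] that(1) Kt t fB AB B_def by linarith
    qed
    have tL: "t powr \<alpha> \<le> La * A powr \<alpha>" if "norm (snd z) < 2 * (K * t)"
      unfolding La_def
    proof (rule powr_comparable(1)[OF AB(1) L])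
      show "A \<le> L * t" using that Kt Lt A_def by linarith
      show "t \<le> L * A" using fA A_def AB t norm_ge_zero[of "snd z"] by linarith
    qed
    have tLb: "t powr \<beta> \<le> Lb * B powr \<beta>" if "norm z < 2 * (K * t)"
      unfolding Lb_def
    proof (rule powr_comparable(1)[OF AB(2) L])
      show "B \<le> L * t" using that Kt Lt B_def by linarith
      show "t \<le> L * B" using fB B_def AB t norm_ge_zero[of z] by linarith
    qed
    consider "2 * (K * t) \<le> norm (snd z)" | "norm (snd z) < 2 * (K * t)" "2 * (K * t) \<le> norm z"
      | "norm (snd z) < 2 * (K * t)" "norm z < 2 * (K * t)" by linarith
    then show ?thesis
    proof cases
      case 1
      have "?I \<le> (\<integral>\<^sup>+\<zeta>. ennreal (La * A powr \<alpha> * (Lb * B powr \<beta>)) * indicator (ball z (K * t)) \<zeta> \<partial>lborel)"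
      proof (intro nn_integral_mono)
        fix \<zeta> :: "'x \<times> 'y"
        have "wt \<alpha> \<beta> \<zeta> \<le> La * A powr \<alpha> * (Lb * B powr \<beta>)" if \<zeta>: "\<zeta> \<in> ball z (K * t)"
          unfolding wt_def
        proof (rule mult_mono)
          show "norm (snd \<zeta>) powr \<alpha> \<le> La * A powr \<alpha>"
            unfolding La_def
          proof (rule powr_comparable(1)[OF AB(1) L])
            show "A \<le> L * norm (snd \<zeta>)" using norm_in_ball[OF \<zeta>] 1 Kt fourL[OF norm_ge_zero, of "snd \<zeta>"] unfolding A_def by linarith
            show "norm (snd \<zeta>) \<le> L * A" using norm_in_ball[OF \<zeta>] 1 Kt t fA AB A_def by linarith
          qed
          show "norm \<zeta> powr \<beta> \<le> Lb * B powr \<beta>" using far[OF _ \<zeta>] 1 yz by linarith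
        qed (use L0 in auto)
        then show "ennreal (wt \<alpha> \<beta> \<zeta>) * indicator (ball z (K * t)) \<zeta>
          \<le> ennreal (La * A powr \<alpha> * (Lb * B powr \<beta>)) * indicator (ball z (K * t)) \<zeta>"
          by (auto split: split_indicator intro: ennreal_leI)
      qed
      also have "\<dots> = ennreal (La * A powr \<alpha> * (Lb * B powr \<beta>)) * ennreal (unit_ball_vol ?D * (K * t) ^ DIM('x \<times> 'y))"
        using Kt by (subst nn_integral_cmult) (auto simp: emeasure_ball intro!: borel_measurable_indicator)
      also have "\<dots> = ennreal (La * A powr \<alpha> * (Lb * B powr \<beta>) * (unit_ball_vol ?D * (K * t) powr ?D))"
        unfolding powr_realpow[OF Kt(1), symmetric] using L0 by (simp flip: ennreal_mult')
      also have "La * A powr \<alpha> * (Lb * B powr \<beta>) * (unit_ball_vol ?D * (K * t) powr ?D) = E1 * ball_wt \<alpha> \<beta> z t"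
        using K t by (simp add: E1_def V powr_mult)
      finally show ?thesis using mono E by simp
    next
      case 2
      have "?I \<le> (\<integral>\<^sup>+\<zeta>. ennreal (Lb * B powr \<beta>) * (ennreal (norm (snd (\<zeta>::'x \<times> 'y)) powr \<alpha>) * indicator (ball (fst z) (K * t) \<times> ball 0 (3 * K * t)) \<zeta>) \<partial>lborel)"
      proof (intro nn_integral_mono)
        fix \<zeta> :: "'x \<times> 'y"
        have "wt \<alpha> \<beta> \<zeta> \<le> Lb * B powr \<beta> * norm (snd \<zeta>) powr \<alpha>" if \<zeta>: "\<zeta> \<in> ball z (K * t)"
          using far[OF 2(2) \<zeta>] by (simp add: wt_def mult.commute mult_right_mono)
        moreover have "\<zeta> \<in> ball (fst z) (K * t) \<times> ball 0 (3 * K * t)" if \<zeta>: "\<zeta> \<in> ball z (K * t)"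
          using norm_in_ball[OF \<zeta>] 2(1) by (cases \<zeta>) (simp add: dist_norm norm_minus_commute)
        ultimately show "ennreal (wt \<alpha> \<beta> \<zeta>) * indicator (ball z (K * t)) \<zeta>
          \<le> ennreal (Lb * B powr \<beta>) * (ennreal (norm (snd \<zeta>) powr \<alpha>) * indicator (ball (fst z) (K * t) \<times> ball 0 (3 * K * t)) \<zeta>)"
          using L0 by (cases "\<zeta> \<in> ball z (K * t)") (auto simp: ennreal_leI simp flip: ennreal_mult')
      qed
      also have "\<dots> = ennreal (Lb * B powr \<beta>) * (\<integral>\<^sup>+\<zeta>. ennreal (norm (snd (\<zeta>::'x \<times> 'y)) powr \<alpha>) * indicator (ball (fst z) (K * t) \<times> ball 0 (3 * K * t)) \<zeta> \<partial>lborel)"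
      proof (rule nn_integral_cmult)
        have [measurable]: "ball (fst z) (K * t) \<times> (ball 0 (3 * K * t) :: 'y set) \<in> sets borel"
          by (intro borel_open open_Times) auto
        have [measurable]: "(\<lambda>z::'x \<times> 'y. norm (snd z)) \<in> borel_measurable borel"
          by (intro borel_measurable_continuous_onI continuous_intros)
        show "(\<lambda>\<zeta>::'x \<times> 'y. ennreal (norm (snd \<zeta>) powr \<alpha>) * indicator (ball (fst z) (K * t) \<times> ball 0 (3 * K * t)) \<zeta>) \<in> borel_measurable lborel"
          by measurable
      qed
      also have "\<dots> \<le> ennreal (Lb * B powr \<beta>) * ennreal (C1 * (K * t) powr ?m * (3 * K * t) powr (?k + \<alpha>))"
        using C1(2) Kt by (intro mult_left_mono) auto
      also have "\<dots> = ennreal (Lb * B powr \<beta> * (C1 * (K * t) powr ?m * (3 * K * t) powr (?k + \<alpha>)))"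
        using L0 by (simp flip: ennreal_mult')
      also have "\<dots> \<le> ennreal (E2 * ball_wt \<alpha> \<beta> z t)"
      proof (rule ennreal_leI)
        have "Lb * B powr \<beta> * (C1 * (K * t) powr ?m * (3 * K * t) powr (?k + \<alpha>))
          = (Lb * B powr \<beta> * C1 * K powr ?m * (3 * K) powr (?k + \<alpha>) * t powr ?D) * t powr \<alpha>"
          using t K by (simp add: powr_mult powr_add)
        also have "\<dots> \<le> (Lb * B powr \<beta> * C1 * K powr ?m * (3 * K) powr (?k + \<alpha>) * t powr ?D) * (La * A powr \<alpha>)"
          using tL[OF 2(1)] L0 C1(1) by (intro mult_left_mono) auto
        also have "\<dots> = E2 * ball_wt \<alpha> \<beta> z t" by (simp add: E2_def V)
        finally show "Lb * B powr \<beta> * (C1 * (K * t) powr ?m * (3 * K * t) powr (?k + \<alpha>)) \<le> E2 * ball_wt \<alpha> \<beta> z t" .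
      qed
      finally show ?thesis using mono E by simp
    next
      case 3
      have "?I \<le> (\<integral>\<^sup>+\<zeta>. ennreal (wt \<alpha> \<beta> \<zeta>) * indicator {\<zeta>. norm (\<zeta>::'x \<times> 'y) < 3 * K * t} \<zeta> \<partial>lborel)"
      proof (intro nn_integral_mono mult_left_mono)
        fix \<zeta> :: "'x \<times> 'y"
        have "norm \<zeta> < 3 * K * t" if \<zeta>: "\<zeta> \<in> ball z (K * t)" using norm_in_ball[OF \<zeta>] 3 by simp
        then show "indicator (ball z (K * t)) \<zeta> \<le> (indicator {\<zeta>. norm \<zeta> < 3 * K * t} \<zeta> :: ennreal)"
          by (auto split: split_indicator)
      qed simp
      also have "\<dots> \<le> ennreal (C2 * (3 * K * t) powr (?D + \<alpha> + \<beta>))" using C2(2) Kt by simp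
      also have "\<dots> \<le> ennreal (E3 * ball_wt \<alpha> \<beta> z t)"
      proof (rule ennreal_leI)
        have "C2 * (3 * K * t) powr (?D + \<alpha> + \<beta>) = C2 * (3 * K) powr (?D + \<alpha> + \<beta>) * t powr ?D * (t powr \<alpha> * t powr \<beta>)"
          using t K by (simp add: powr_mult powr_add)
        also have "\<dots> \<le> C2 * (3 * K) powr (?D + \<alpha> + \<beta>) * t powr ?D * ((La * A powr \<alpha>) * (Lb * B powr \<beta>))"
          using tL[OF 3(1)] tLb[OF 3(2)] C2(1) L0 by (intro mult_left_mono mult_mono) auto
        also have "\<dots> = E3 * ball_wt \<alpha> \<beta> z t" by (simp add: E3_def V)
        finally show "C2 * (3 * K * t) powr (?D + \<alpha> + \<beta>) \<le> E3 * ball_wt \<alpha> \<beta> z t" .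
      qed
      finally show ?thesis using mono E by simp
    qed
  qed
  then show ?thesis using E by (intro exI[of _ "E1 + E2 + E3"]) auto
qed

section \<open>Crossing a layer along rays\<close>

lemma nn_integral_lborel_scale:
  fixes F :: "'a::euclidean_space \<Rightarrow> ennreal"
  assumes [measurable]: "F \<in> borel_measurable borel" and t: "t > 0"
  shows "(\<integral>\<^sup>+\<zeta>. F \<zeta> \<partial>lborel) = ennreal (t powr real DIM('a)) * (\<integral>\<^sup>+\<omega>. F (z + t *\<^sub>R \<omega>) \<partial>lborel)"
proof -
  have "(\<integral>\<^sup>+\<zeta>. F \<zeta> \<partial>lborel)
    = (\<integral>\<^sup>+\<zeta>. F \<zeta> \<partial>density (distr lborel borel (\<lambda>x. z + t *\<^sub>R x)) (\<lambda>_. ennreal (\<bar>t\<bar> ^ DIM('a))))"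
    using t by (subst lborel_affine[of t z]) auto
  also have "\<dots> = (\<integral>\<^sup>+\<omega>. ennreal (t powr real DIM('a)) * F (z + t *\<^sub>R \<omega>) \<partial>lborel)"
    using t by (simp add: nn_integral_density nn_integral_distr powr_realpow)
  also have "\<dots> = ennreal (t powr real DIM('a)) * (\<integral>\<^sup>+\<omega>. F (z + t *\<^sub>R \<omega>) \<partial>lborel)"
    by (rule nn_integral_cmult) measurable
  finally show ?thesis .
qed

text \<open>With these strict inequalities the layers at the heights 2^j are pairwise disjoint, as
  the summation over j requires.\<close>

definition layer :: "('a \<Rightarrow> real) \<Rightarrow> real \<Rightarrow> 'a set" where
  "layer u \<tau> = {\<zeta>. \<tau> < \<bar>u \<zeta>\<bar> \<and> \<bar>u \<zeta>\<bar> < 2 * \<tau>}"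

lemma layer_measurable [measurable]:
  fixes u :: "'a::euclidean_space \<Rightarrow> real"
  assumes [measurable]: "u \<in> borel_measurable borel"
  shows "layer u \<tau> \<in> sets borel"
  unfolding layer_def by measurable

text \<open>Between its last value at least \<open>2\<tau>\<close> and its next value at most \<open>\<tau>\<close>, the function stays in the layer.\<close>

lemma layer_crossing:
  fixes u :: "'a::euclidean_space \<Rightarrow> real"
  assumes u: "u \<in> test_funs" and \<tau>: "\<tau> > 0" and z: "2 * \<tau> \<le> \<bar>u z\<bar>" and \<omega>: "\<omega> \<noteq> 0"
  shows "ennreal \<tau> \<le> (\<integral>\<^sup>+t. ennreal (norm \<omega> * norm (grad u (z + t *\<^sub>R \<omega>)))
      * indicator (layer u \<tau>) (z + t *\<^sub>R \<omega>) * indicator {0<..} t \<partial>lborel)"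
proof -
  define f where "f t = u (z + t *\<^sub>R \<omega>)" for t
  define k where "k t = norm \<omega> * norm (grad u (z + t *\<^sub>R \<omega>))" for t
  have ray: "continuous_on UNIV (\<lambda>t. z + t *\<^sub>R \<omega>)" by (intro continuous_intros)
  have f: "continuous_on UNIV f" unfolding f_def
    using continuous_on_compose2[OF test_fun_continuous(1)[OF u] ray] by simp
  have g: "continuous_on UNIV (\<lambda>t. grad u (z + t *\<^sub>R \<omega>))"
    using continuous_on_compose2[OF test_fun_continuous(2)[OF u] ray] by simp
  have absf: "continuous_on UNIV (\<lambda>t. \<bar>f t\<bar>)" using f by (intro continuous_intros)
  obtain R where R: "R > 0" "\<And>z. norm z \<ge> R \<Longrightarrow> u z = 0" "\<And>z. norm z \<ge> R \<Longrightarrow> grad u z = 0"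
    using test_fun_support[OF u] by blast
  \<comment> \<open>By the time \<open>T\<close> the ray has left the ball outside which
    \<open>u\<close> vanishes: |T \<omega>| = R + |z|.\<close>
  define T where "T = (R + norm z) / norm \<omega>"
  have T: "T > 0" using R(1) \<omega> by (simp add: T_def add_pos_nonneg)
  have "norm (T *\<^sub>R \<omega>) = R + norm z" using R(1) \<omega> by (simp add: T_def)
  then have "norm (z + T *\<^sub>R \<omega>) \<ge> R" using norm_diff_ineq[of "T *\<^sub>R \<omega>" z] by (simp add: add.commute)
  then have fT: "f T = 0" using R(2) by (simp add: f_def)
  \<comment> \<open>\<open>t2\<close> will be the first time with |f| \<le> \<tau>, and
    \<open>t1\<close> the last time before it with |f| \<ge> 2 \<tau>; strictly in between neither
    inequality holds.\<close>
  define S where "S = {0..T} \<inter> {t. \<bar>f t\<bar> \<le> \<tau>}"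
  have "compact S" unfolding S_def
    by (intro compact_Int_closed closed_Collect_le absf continuous_intros) auto
  moreover have "T \<in> S" using T fT \<tau> by (simp add: S_def)
  then have "S \<noteq> {}" by blast
  ultimately obtain t2 where t2S: "t2 \<in> S" "\<forall>t\<in>S. t2 \<le> t"
    using compact_attains_inf[of S] by auto
  then have t2: "t2 \<in> {0..T}" "\<bar>f t2\<bar> \<le> \<tau>" "\<And>t. t \<in> {0..T} \<Longrightarrow> \<bar>f t\<bar> \<le> \<tau> \<Longrightarrow> t2 \<le> t"
    by (auto simp: S_def)
  define S' where "S' = {0..t2} \<inter> {t. 2 * \<tau> \<le> \<bar>f t\<bar>}"
  have "compact S'" unfolding S'_def
    by (intro compact_Int_closed closed_Collect_le absf continuous_intros) auto
  moreover have "0 \<in> S'" using t2 z by (simp add: f_def S'_def)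
  then have "S' \<noteq> {}" by blast
  ultimately obtain t1 where "t1 \<in> S'" "\<forall>t\<in>S'. t \<le> t1"
    using compact_attains_sup[of S'] by auto
  then have t1: "t1 \<in> {0..t2}" "2 * \<tau> \<le> \<bar>f t1\<bar>" "\<And>t. t \<in> {0..t2} \<Longrightarrow> 2 * \<tau> \<le> \<bar>f t\<bar> \<Longrightarrow> t \<le> t1"
    by (auto simp: S'_def)
  have "t1 \<noteq> t2" using t1(2) t2(2) \<tau> by auto
  then have t12: "0 \<le> t1" "t1 < t2" "t2 \<le> T" using t1(1) t2(1) by auto
  have inside: "z + t *\<^sub>R \<omega> \<in> layer u \<tau>" if "t1 < t" "t < t2" for t
    using t2(3)[of t] t1(3)[of t] that t12 by (force simp: layer_def f_def)
  have deriv: "(f has_vector_derivative grad u (z + t *\<^sub>R \<omega>) \<bullet> \<omega>) (at t within {t1..t2})" for t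
  proof -
    have "((\<lambda>t. z + t *\<^sub>R \<omega>) has_derivative (\<lambda>h. h *\<^sub>R \<omega>)) (at t)"
      by (auto intro!: derivative_eq_intros)
    moreover have "(u has_derivative (\<lambda>h. inner h (grad u (z + t *\<^sub>R \<omega>)))) (at (z + t *\<^sub>R \<omega>))"
      using test_fun_GDERIV[OF u] by (simp add: gderiv_def)
    ultimately have "(u \<circ> (\<lambda>t. z + t *\<^sub>R \<omega>) has_derivative (\<lambda>h. inner h (grad u (z + t *\<^sub>R \<omega>))) \<circ> (\<lambda>h. h *\<^sub>R \<omega>)) (at t)"
      by (rule diff_chain_at)
    then show ?thesis
      by (auto simp: has_vector_derivative_def f_def[abs_def] o_def inner_commute intro: has_derivative_at_withinI)
  qed
  have I: "((\<lambda>t. grad u (z + t *\<^sub>R \<omega>) \<bullet> \<omega>) has_integral (f t2 - f t1)) {t1..t2}"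
    using t12 deriv by (intro fundamental_theorem_of_calculus) auto
  have k: "k integrable_on {t1..t2}" unfolding k_def
    by (intro integrable_continuous_real continuous_intros continuous_on_subset[OF g]) auto
  have cs: "\<bar>grad u (z + t *\<^sub>R \<omega>) \<bullet> \<omega>\<bar> \<le> norm \<omega> * norm (grad u (z + t *\<^sub>R \<omega>))" for t
    using Cauchy_Schwarz_ineq2[of \<omega> "grad u (z + t *\<^sub>R \<omega>)"] by (simp add: inner_commute)
  have "\<tau> \<le> \<bar>f t2 - f t1\<bar>" using t1(2) t2(2) \<tau> by auto
  also have "\<dots> = norm (integral {t1..t2} (\<lambda>t. grad u (z + t *\<^sub>R \<omega>) \<bullet> \<omega>))"
    using integral_unique[OF I] by simp
  also have "\<dots> \<le> integral {t1..t2} k"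
    using I k by (intro integral_norm_bound_integral)
      (auto simp: k_def cs)
  finally have "ennreal \<tau> \<le> ennreal (integral {t1..t2} k)" by (rule ennreal_leI)
  also have "\<dots> = (\<integral>\<^sup>+t. ennreal (k t) * indicator {t1..t2} t \<partial>lborel)"
    using k by (subst nn_integral_has_integral_lebesgue') (auto simp: k_def integrable_integral)
  also have "\<dots> \<le> (\<integral>\<^sup>+t. ennreal (k t) * indicator (layer u \<tau>) (z + t *\<^sub>R \<omega>) * indicator {0<..} t \<partial>lborel)"
  proof (rule nn_integral_mono_AE)
    \<comment> \<open>At the two end points the ray is outside the layer; they are discarded as null
      sets.\<close>
    have "AE t in lborel. t \<noteq> t1" "AE t in lborel. t \<noteq> t2" by (rule AE_lborel_singleton)+
    then show "AE t in lborel. ennreal (k t) * indicator {t1..t2} t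
        \<le> ennreal (k t) * indicator (layer u \<tau>) (z + t *\<^sub>R \<omega>) * indicator {0<..} t"
      by eventually_elim (use inside t12 in \<open>auto split: split_indicator\<close>)
  qed
  finally show ?thesis by (simp add: k_def)
qed

text \<open>Averaging over a ball of vectors \<omega>, instead of a piece of the unit sphere, keeps
  everything in Lebesgue measure: for fixed t the map \<omega> \<mapsto> z + t \<omega> is affine.
  Vectors within 1/2 of the unit vector \<open>e\<close> are nonzero and shorter than 2, whence the
  factor 2.\<close>

lemma layer_crossing_average:
  fixes u :: "'a::euclidean_space \<Rightarrow> real"
  assumes u: "u \<in> test_funs" and \<tau>: "\<tau> > 0" and z: "2 * \<tau> \<le> \<bar>u z\<bar>" and e: "norm e = 1"
  shows "ennreal \<tau> * emeasure lborel (ball e (1/2))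
    \<le> 2 * (\<integral>\<^sup>+t. (\<integral>\<^sup>+\<omega>. ennreal (norm (grad u (z + t *\<^sub>R \<omega>))) * indicator (layer u \<tau>) (z + t *\<^sub>R \<omega>)
          * indicator (ball e (1/2)) \<omega> \<partial>lborel) * indicator {0<..} t \<partial>lborel)"
proof -
  note [measurable] = test_fun_measurable[OF u]
  have [measurable]: "ball e (1/2) \<in> sets borel" by simp
  define g where "g \<zeta> = ennreal (norm (grad u \<zeta>)) * indicator (layer u \<tau>) \<zeta>" for \<zeta>
  have [measurable]: "g \<in> borel_measurable borel" unfolding g_def by measurable
  have "ennreal \<tau> * emeasure lborel (ball e (1/2)) = (\<integral>\<^sup>+\<omega>. ennreal \<tau> * indicator (ball e (1/2)) \<omega> \<partial>lborel)"
    by (simp add: nn_integral_cmult_indicator)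
  also have "\<dots> \<le> (\<integral>\<^sup>+\<omega>. (\<integral>\<^sup>+t. 2 * (g (z + t *\<^sub>R \<omega>) * indicator (ball e (1/2)) \<omega> * indicator {0<..} t) \<partial>lborel) \<partial>lborel)"
  proof (rule nn_integral_mono)
    fix \<omega>
    show "ennreal \<tau> * indicator (ball e (1/2)) \<omega>
      \<le> (\<integral>\<^sup>+t. 2 * (g (z + t *\<^sub>R \<omega>) * indicator (ball e (1/2)) \<omega> * indicator {0<..} t) \<partial>lborel)"
    proof (cases "\<omega> \<in> ball e (1/2)")
      case True
      then have d: "norm (e - \<omega>) < 1/2" by (simp add: dist_norm)
      have n: "norm \<omega> \<le> 2" using d norm_triangle_ineq3[of e \<omega>] e by linarith
      have "\<omega> \<noteq> 0" using d e by auto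
      from layer_crossing[OF u \<tau> z this] have "ennreal \<tau> \<le> (\<integral>\<^sup>+t. ennreal (norm \<omega> * norm (grad u (z + t *\<^sub>R \<omega>)))
      * indicator (layer u \<tau>) (z + t *\<^sub>R \<omega>) * indicator {0<..} t \<partial>lborel)" .
      also have "\<dots> \<le> (\<integral>\<^sup>+t. 2 * (g (z + t *\<^sub>R \<omega>) * indicator (ball e (1/2)) \<omega> * indicator {0<..} t) \<partial>lborel)"
      proof (rule nn_integral_mono)
        fix t
        have "ennreal (norm \<omega> * norm (grad u (z + t *\<^sub>R \<omega>))) \<le> 2 * ennreal (norm (grad u (z + t *\<^sub>R \<omega>)))"
          using n by (simp add: ennreal_mult' mult_right_mono ennreal_leI flip: ennreal_numeral)
        then show "ennreal (norm \<omega> * norm (grad u (z + t *\<^sub>R \<omega>))) * indicator (layer u \<tau>) (z + t *\<^sub>R \<omega>) * indicator {0<..} t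
          \<le> 2 * (g (z + t *\<^sub>R \<omega>) * indicator (ball e (1/2)) \<omega> * indicator {0<..} t)"
          using True by (auto simp: g_def split: split_indicator)
      qed
      finally show ?thesis using True by simp
    qed simp
  qed
  also have "\<dots> = (\<integral>\<^sup>+t. (\<integral>\<^sup>+\<omega>. 2 * (g (z + t *\<^sub>R \<omega>) * indicator (ball e (1/2)) \<omega> * indicator {0<..} t) \<partial>lborel) \<partial>lborel)"
    by (rule lborel_pair.Fubini') measurable
  also have "\<dots> = (\<integral>\<^sup>+t. 2 * ((\<integral>\<^sup>+\<omega>. g (z + t *\<^sub>R \<omega>) * indicator (ball e (1/2)) \<omega> \<partial>lborel) * indicator {0<..} t) \<partial>lborel)"
    by (simp add: nn_integral_cmult nn_integral_multc)
  also have "\<dots> = 2 * (\<integral>\<^sup>+t. (\<integral>\<^sup>+\<omega>. g (z + t *\<^sub>R \<omega>) * indicator (ball e (1/2)) \<omega> \<partial>lborel) * indicator {0<..} t \<partial>lborel)"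
    by (rule nn_integral_cmult) measurable
  finally show ?thesis by (simp add: g_def)
qed

text \<open>It replaces Hoelder's inequality and follows from \<open>x \<le> \<kappa> + \<kappa>\<^sup>1\<^sup>-\<^sup>p x\<^sup>p\<close>.\<close>

lemma nn_integral_le_of_powr:
  fixes f :: "'a \<Rightarrow> real"
  assumes [measurable]: "f \<in> borel_measurable M" "A \<in> sets M" and nonneg: "\<And>x. f x \<ge> 0"
    and A: "emeasure M A = ennreal V" "V \<ge> 0" and p: "p > 1" and \<kappa>: "\<kappa> > 0"
    and le: "(\<integral>\<^sup>+x. ennreal (f x powr p) * indicator A x \<partial>M) \<le> ennreal (\<kappa> powr p * V)"
  shows "(\<integral>\<^sup>+x. ennreal (f x) * indicator A x \<partial>M) \<le> ennreal (2 * \<kappa> * V)"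
proof -
  have young: "f x \<le> \<kappa> + \<kappa> powr (1 - p) * f x powr p" for x
  proof (cases "f x \<le> \<kappa>")
    case False
    then have "\<kappa> powr (p - 1) \<le> f x powr (p - 1)" using \<kappa> p by (intro powr_mono2) auto
    then have "\<kappa> powr (1 - p) * (\<kappa> powr (p - 1) * f x) \<le> \<kappa> powr (1 - p) * (f x powr (p - 1) * f x)"
      using nonneg by (intro mult_left_mono mult_right_mono) auto
    moreover have "\<kappa> powr (1 - p) * (\<kappa> powr (p - 1) * f x) = f x"
      using \<kappa> by (simp flip: powr_add mult.assoc)
    moreover have "f x powr (p - 1) * f x = f x powr p"
      using False \<kappa> by (simp add: powr_diff)
    ultimately show ?thesis using \<kappa> by simp
  qed (simp add: add_increasing2)
  have "(\<integral>\<^sup>+x. ennreal (f x) * indicator A x \<partial>M)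
      \<le> (\<integral>\<^sup>+x. ennreal \<kappa> * indicator A x + ennreal (\<kappa> powr (1 - p)) * (ennreal (f x powr p) * indicator A x) \<partial>M)"
  proof (rule nn_integral_mono)
    fix x
    have "ennreal (f x) \<le> ennreal \<kappa> + ennreal (\<kappa> powr (1 - p)) * ennreal (f x powr p)"
      using ennreal_leI[OF young[of x]] \<kappa> by (simp add: ennreal_mult')
    then show "ennreal (f x) * indicator A x \<le> ennreal \<kappa> * indicator A x + ennreal (\<kappa> powr (1 - p)) * (ennreal (f x powr p) * indicator A x)"
      by (auto split: split_indicator)
  qed
  also have "\<dots> = ennreal \<kappa> * emeasure M A + ennreal (\<kappa> powr (1 - p)) * (\<integral>\<^sup>+x. ennreal (f x powr p) * indicator A x \<partial>M)"
    by (subst nn_integral_add) (auto simp: nn_integral_cmult)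
  also have "\<dots> \<le> ennreal \<kappa> * ennreal V + ennreal (\<kappa> powr (1 - p)) * ennreal (\<kappa> powr p * V)"
    using le A by (intro add_mono mult_left_mono) auto
  also have "\<dots> = ennreal (\<kappa> * V + \<kappa> powr (1 - p) * (\<kappa> powr p * V))"
    using \<kappa> A by (simp add: ennreal_mult')
  also have "\<kappa> * V + \<kappa> powr (1 - p) * (\<kappa> powr p * V) = 2 * \<kappa> * V"
    using \<kappa> by (simp flip: powr_add mult.assoc)
  finally show ?thesis .
qed

section \<open>The weak-type estimate\<close>

text \<open>The measure dt/t is invariant under scaling, which is why the values do not depend on
  \<open>t0\<close>.\<close>

lemma nn_integral_tail_powr:
  fixes n t0 :: real
  assumes "n > 0" "t0 > 0"
  shows "(\<integral>\<^sup>+t. ennreal (t powr (-1) * (t / t0) powr (- n)) * indicator {t0..} t \<partial>lborel) = ennreal (1 / n)"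
    and "(\<integral>\<^sup>+t. ennreal (t powr (-1) * (t / t0) powr n) * indicator {0..t0} t \<partial>lborel) = ennreal (1 / n)"
proof -
  have "((\<lambda>t. t0 powr n * t powr (-1 - n)) has_integral t0 powr n * (- (t0 powr (-1 - n + 1)) / (-1 - n + 1))) {t0..}"
    using assms by (intro has_integral_mult_right has_integral_powr_to_inf) auto
  also have "t0 powr n * (- (t0 powr (-1 - n + 1)) / (-1 - n + 1)) = 1 / n"
    using assms by (simp add: powr_minus field_simps)
  finally have "((\<lambda>t. t powr (-1) * (t / t0) powr (- n)) has_integral 1 / n) {t0..}"
    by (rule has_integral_eq[rotated]) (use assms in \<open>auto simp: powr_divide powr_minus powr_diff field_simps\<close>)
  then show "(\<integral>\<^sup>+t. ennreal (t powr (-1) * (t / t0) powr (- n)) * indicator {t0..} t \<partial>lborel) = ennreal (1 / n)"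
    by (intro nn_integral_has_integral_lebesgue') auto
  have "((\<lambda>t. t0 powr (- n) * t powr (n - 1)) has_integral t0 powr (- n) * (t0 powr (n - 1 + 1) / (n - 1 + 1))) {0..t0}"
    using assms by (intro has_integral_mult_right has_integral_powr_from_0) auto
  also have "t0 powr (- n) * (t0 powr (n - 1 + 1) / (n - 1 + 1)) = 1 / n"
    using assms by (simp add: powr_minus field_simps)
  finally have "((\<lambda>t. t powr (-1) * (t / t0) powr n) has_integral 1 / n) {0..t0}"
    by (rule has_integral_eq[rotated]) (use assms in \<open>auto simp: powr_divide powr_minus powr_diff field_simps\<close>)
  then show "(\<integral>\<^sup>+t. ennreal (t powr (-1) * (t / t0) powr n) * indicator {0..t0} t \<partial>lborel) = ennreal (1 / n)"
    by (intro nn_integral_has_integral_lebesgue') auto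
qed

text \<open>Intermediate value theorem between 1 and \<theta>, the point where the comparison
  function t^m X(1) equals \<open>H\<close>; the growth condition makes \<open>X\<close> at least
  \<open>H\<close> at the right end and at most \<open>H\<close> at the left end.\<close>

lemma powr_growth_attains:
  fixes X :: "real \<Rightarrow> real"
  assumes m: "m > 0" and H: "H > 0" and pos: "\<And>t. t > 0 \<Longrightarrow> X t > 0" and cont: "continuous_on {0<..} X"
    and growth: "\<And>s t. 0 < s \<Longrightarrow> s \<le> t \<Longrightarrow> (t / s) powr m * X s \<le> X t"
  obtains t where "t > 0" "X t = H"
proof -
  define \<theta> where "\<theta> = (H / X 1) powr (1 / m)"
  have X1: "X 1 > 0" using pos by simp
  have \<theta>: "\<theta> > 0" "\<theta> powr m = H / X 1" using H X1 m by (simp_all add: \<theta>_def powr_powr)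
  have up: "H \<le> X (max 1 \<theta>)"
  proof -
    have "H / X 1 \<le> (max 1 \<theta>) powr m" using \<theta> m by (metis max.cobounded2 less_imp_le powr_mono2)
    then have "H \<le> (max 1 \<theta>) powr m * X 1" using X1 by (simp add: pos_divide_le_eq)
    also have "\<dots> \<le> X (max 1 \<theta>)" using growth[of 1 "max 1 \<theta>"] by simp
    finally show ?thesis .
  qed
  have low: "X (min 1 \<theta>) \<le> H"
  proof -
    let ?s = "min 1 \<theta>"
    have s: "?s > 0" using \<theta> by simp
    have "(1 / ?s) powr m * X ?s \<le> X 1" using growth[of ?s 1] s by simp
    then have "X ?s \<le> ?s powr m * X 1" using s
      by (simp only: powr_divide powr_one_eq_one) (simp add: field_simps)
    also have "?s powr m \<le> \<theta> powr m" using s m by (intro powr_mono2) auto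
    then have "?s powr m * X 1 \<le> H" using \<theta>(2) X1 by (simp add: pos_le_divide_eq)
    finally show ?thesis .
  qed
  have "\<exists>t\<ge>min 1 \<theta>. t \<le> max 1 \<theta> \<and> X t = H"
  proof (rule IVT')
    show "continuous_on {min 1 \<theta>..max 1 \<theta>} X"
      by (rule continuous_on_subset[OF cont]) (use \<theta>(1) in auto)
  qed (use low up in auto)
  then show thesis using that \<theta>(1) by (metis less_le_trans min_less_iff_conj zero_less_one)
qed

text \<open>Let X(t0) = H. Above t0 the minimum is bounded by 1 and X^(-r) decays; below t0 the
  minimum is bounded by X/c, and X^(s - r) tends to 0 with t because s > r. Both are compared with
  powers of t / t0. As \<open>c\<close> is chosen before \<open>X\<close>, the later choice of a
  radius is uniform.\<close>

lemma nn_integral_growth_bound: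
  fixes m r s \<epsilon> :: real
  assumes m: "m > 0" and r: "0 < r" "r < s" and \<epsilon>: "\<epsilon> > 0"
  shows "\<exists>c>0. \<forall>X. (\<forall>t>0. X t > 0) \<longrightarrow> continuous_on {0<..} X \<longrightarrow>
    (\<forall>s t. 0 < s \<longrightarrow> s \<le> t \<longrightarrow> (t / s) powr m * X s \<le> X t) \<longrightarrow>
    (\<integral>\<^sup>+t. ennreal (t powr (-1) * (min 1 (X t / c) powr s * X t powr (- r))) * indicator {0<..} t \<partial>lborel) \<le> ennreal \<epsilon>"
proof -
  \<comment> \<open>\<open>H\<close> makes the bound for the part above t0 equal to \<epsilon> / 2;
    \<open>c\<close> is then chosen in terms of \<open>H\<close> so that the part below t0 gives the
    other half.\<close>
  define H where "H = (\<epsilon> * (m * r) / 2) powr (- 1 / r)"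
  have H: "H > 0" "H powr (- r) = \<epsilon> * (m * r) / 2"
    using m r \<epsilon> by (simp_all add: H_def powr_powr)
  define c where "c = (\<epsilon> * (m * (s - r)) / 2 / H powr (s - r)) powr (- 1 / s)"
  have c: "c > 0" "c powr (- s) * H powr (s - r) = \<epsilon> * (m * (s - r)) / 2"
    using m r \<epsilon> H by (simp_all add: c_def powr_powr)
  have "(\<integral>\<^sup>+t. ennreal (t powr (-1) * (min 1 (X t / c) powr s * X t powr (- r))) * indicator {0<..} t \<partial>lborel) \<le> ennreal \<epsilon>"
    if X: "\<forall>t>0. X t > 0" "continuous_on {0<..} X"
      "\<forall>s t. 0 < s \<longrightarrow> s \<le> t \<longrightarrow> (t / s) powr m * X s \<le> X t" for X
  proof -
    obtain t0 where t0: "t0 > 0" "X t0 = H"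
      using powr_growth_attains[OF m H(1), of X] X by blast
    let ?F1 = "\<lambda>t. ennreal (t powr (-1) * (t / t0) powr (- (m * r))) * indicator {t0..} t"
    let ?F2 = "\<lambda>t. ennreal (t powr (-1) * (t / t0) powr (m * (s - r))) * indicator {0..t0} t"
    have "(\<integral>\<^sup>+t. ennreal (t powr (-1) * (min 1 (X t / c) powr s * X t powr (- r))) * indicator {0<..} t \<partial>lborel)
        \<le> (\<integral>\<^sup>+t. ennreal (H powr (- r)) * ?F1 t + ennreal (c powr (- s) * H powr (s - r)) * ?F2 t \<partial>lborel)"
    proof (rule nn_integral_mono)
      fix t :: real
      show "ennreal (t powr (-1) * (min 1 (X t / c) powr s * X t powr (- r))) * indicator {0<..} t
        \<le> ennreal (H powr (- r)) * ?F1 t + ennreal (c powr (- s) * H powr (s - r)) * ?F2 t"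
      proof (cases "0 < t")
        case True
        then have Xt: "X t > 0" using X(1) by blast
        show ?thesis
        proof (cases "t0 \<le> t")
          case ge: True
          have "(t / t0) powr m * H \<le> X t" using X(3) t0 ge by blast
          moreover have "(t / t0) powr m * H > 0" using True t0 H by simp
          ultimately have "X t powr (- r) \<le> ((t / t0) powr m * H) powr (- r)"
            using r by (intro powr_mono2') auto
          also have "\<dots> = H powr (- r) * (t / t0) powr (- (m * r))"
            using H True t0 by (simp add: powr_mult powr_powr)
          finally have "X t powr (- r) \<le> H powr (- r) * (t / t0) powr (- (m * r))" .
          moreover have "min 1 (X t / c) powr s \<le> 1" using r Xt c by (intro powr_le1) auto
          ultimately have "min 1 (X t / c) powr s * X t powr (- r) \<le> 1 * (H powr (- r) * (t / t0) powr (- (m * r)))"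
            by (intro mult_mono) auto
          then have "t powr (-1) * (min 1 (X t / c) powr s * X t powr (- r)) \<le> H powr (- r) * (t powr (-1) * (t / t0) powr (- (m * r)))"
            using mult_left_mono[of _ _ "t powr (-1)"] by (simp add: mult_ac)
          then have "ennreal (t powr (-1) * (min 1 (X t / c) powr s * X t powr (- r)))
            \<le> ennreal (H powr (- r)) * ?F1 t" using ge by (simp add: ennreal_leI flip: ennreal_mult')
          then show ?thesis using True by (simp add: add_increasing2)
        next
          case False
          have "(t0 / t) powr m * X t \<le> H" using X(3) t0 False True by (metis less_imp_le not_le)
          then have "X t \<le> H * (t / t0) powr m" using True t0
            by (simp add: powr_divide field_simps)
          then have *: "X t powr (s - r) \<le> (H * (t / t0) powr m) powr (s - r)"
            using Xt r by (intro powr_mono2) auto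
          have "min 1 (X t / c) powr s * X t powr (- r) \<le> (X t / c) powr s * X t powr (- r)"
            using Xt c r by (intro mult_right_mono powr_mono2) auto
          also have "\<dots> = c powr (- s) * X t powr (s - r)"
            using Xt c by (simp add: powr_divide powr_diff powr_minus field_simps)
          also have "\<dots> \<le> c powr (- s) * (H * (t / t0) powr m) powr (s - r)"
            using * by (intro mult_left_mono) auto
          also have "\<dots> = (c powr (- s) * H powr (s - r)) * (t / t0) powr (m * (s - r))"
            using H True t0 by (simp add: powr_mult powr_powr)
          finally have "t powr (-1) * (min 1 (X t / c) powr s * X t powr (- r))
             \<le> (c powr (- s) * H powr (s - r)) * (t powr (-1) * (t / t0) powr (m * (s - r)))"
            using mult_left_mono[of _ _ "t powr (-1)"] by (simp add: mult_ac)
          then have "ennreal (t powr (-1) * (min 1 (X t / c) powr s * X t powr (- r)))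
            \<le> ennreal (c powr (- s) * H powr (s - r)) * ?F2 t" using True False by (simp add: ennreal_leI flip: ennreal_mult')
          then show ?thesis using True by (simp add: add_increasing)
        qed
      qed simp
    qed
    also have "\<dots> = ennreal (H powr (- r)) * (\<integral>\<^sup>+t. ?F1 t \<partial>lborel) + ennreal (c powr (- s) * H powr (s - r)) * (\<integral>\<^sup>+t. ?F2 t \<partial>lborel)"
      by (subst nn_integral_add) (simp_all add: nn_integral_cmult)
    also have "\<dots> = ennreal (\<epsilon> * (m * r) / 2) * ennreal (1 / (m * r)) + ennreal (\<epsilon> * (m * (s - r)) / 2) * ennreal (1 / (m * (s - r)))"
      using m r t0 nn_integral_tail_powr(1)[of "m * r" t0] nn_integral_tail_powr(2)[of "m * (s - r)" t0]
      unfolding H(2) c(2) by simp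
    also have "\<dots> = ennreal (\<epsilon> / 2 + \<epsilon> / 2)"
      using m r \<epsilon> by (subst ennreal_plus) (simp_all flip: ennreal_mult')
    finally show ?thesis by simp
  qed
  with c(1) show ?thesis by blast
qed

text \<open>The case \<gamma> = b: the energy has the weight |y|^a |z|^(-b), the mass the weight
  |y|^\<alpha> |z|^\<beta>. \<open>critical\<close> is a1), and \<open>\<alpha>_gt\<close> is the
  hypothesis on q H, read as local integrability of |y|^\<alpha> in the variable y.\<close>

locale critical_weights =
  fixes p q a b \<alpha> \<beta> d :: real
    and ty :: "('x::euclidean_space \<times> 'y::euclidean_space) itself"
  assumes p: "1 < p" and pq: "p < q"
    and d_eq: "d = real DIM('x \<times> 'y)"
    and critical: "(d - p) * q \<le> d * p"
    and \<alpha>_eq: "\<alpha> = - d + q * (d - p + a) / p"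
    and \<beta>_eq: "\<beta> = - (b * q / p)"
    and \<alpha>_gt: "real DIM('y) + \<alpha> > 0"
    and b_less: "b < d - p + a"
begin

lemma exponents: "d + \<alpha> > 0" "d + \<alpha> + \<beta> > 0"
proof -
  show "d + \<alpha> > 0" using \<alpha>_gt by (simp add: d_eq)
  \<comment> \<open>The scaling degree of the mass is q/p times that of the energy, d - p + a - b,
    which is positive by \<open>b_less\<close>.\<close>
  have "d + \<alpha> + \<beta> = q * (d - p + a - b) / p"
    using p by (simp add: \<alpha>_eq \<beta>_eq field_simps)
  then show "d + \<alpha> + \<beta> > 0" using p pq b_less by simp
qed

text \<open>The least growth rate of \<open>ball_wt\<close> in its three regimes: it behaves like
  t^d for t below |y|, like t^(d + \<alpha>) between |y| and |z|, and like t^(d + \<alpha> +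
  \<beta>) beyond |z|.\<close>

definition growth_exp :: real where
  "growth_exp = min d (min (d + \<alpha>) (d + \<alpha> + \<beta>))"

lemma growth_exp_pos: "growth_exp > 0"
proof -
  have "d > 0" unfolding d_eq by (simp only: of_nat_0_less_iff DIM_positive)
  then show ?thesis using exponents by (simp add: growth_exp_def)
qed

lemma ball_wt_pos: "t > 0 \<Longrightarrow> ball_wt \<alpha> \<beta> (z :: 'x \<times> 'y) t > 0"
  by (simp add: ball_wt_def add_nonneg_pos less_imp_neq[THEN not_sym])

text \<open>From radius s to t the three factors of \<open>ball_wt\<close> are multiplied by
  \<kappa>^d, k1^\<alpha> and k2^\<beta> with \<kappa> \<ge> k1 \<ge> k2 \<ge> 1. Splitting \<kappa>
  = (\<kappa> / k1) k1 leaves bases that are at least 1 with the exponents d and d + \<alpha>; the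
  factor k2^\<beta> is at least 1 if \<beta> \<ge> 0 and at least k1^\<beta> otherwise.\<close>

lemma ball_wt_growth:
  fixes z :: "'x \<times> 'y"
  assumes "0 < s" "s \<le> t"
  shows "(t / s) powr growth_exp * ball_wt \<alpha> \<beta> z s \<le> ball_wt \<alpha> \<beta> z t"
proof -
  define \<kappa> where "\<kappa> = t / s"
  define k1 where "k1 = (norm (snd z) + t) / (norm (snd z) + s)"
  define k2 where "k2 = (norm z + t) / (norm z + s)"
  have yz: "norm (snd z) \<le> norm z" by (rule norm_snd_le_norm)
  have ratio: "(y + t) / (y + s) \<le> (x + t) / (x + s)" if "0 \<le> x" "x \<le> y" for x y
  proof -
    have "(y - x) * s \<le> (y - x) * t" using that assms by (intro mult_left_mono) auto
    then show ?thesis using that assms by (simp add: frac_le_eq divide_simps) (simp add: algebra_simps)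
  qed
  have k: "1 \<le> k2" "k2 \<le> k1" "k1 \<le> \<kappa>"
  proof -
    show "1 \<le> k2" using assms by (simp add: k2_def add_nonneg_pos)
    show "k2 \<le> k1" unfolding k1_def k2_def using yz by (intro ratio) auto
    show "k1 \<le> \<kappa>" unfolding k1_def \<kappa>_def using ratio[of 0 "norm (snd z)"] by simp
  qed
  let ?m = growth_exp
  have V: "ball_wt \<alpha> \<beta> z t = \<kappa> powr d * k1 powr \<alpha> * k2 powr \<beta> * ball_wt \<alpha> \<beta> z s"
  proof -
    have "t = \<kappa> * s" "norm (snd z) + t = k1 * (norm (snd z) + s)" "norm z + t = k2 * (norm z + s)"
      using assms by (simp_all add: \<kappa>_def k1_def k2_def add_nonneg_eq_0_iff)
    then show ?thesis unfolding ball_wt_def d_eq using k assms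
      by (simp add: powr_mult)
  qed
  have "\<kappa> powr ?m = (\<kappa> / k1) powr ?m * k1 powr ?m"
    using k by (simp flip: powr_mult)
  also have "\<dots> \<le> (\<kappa> / k1) powr d * (k1 powr (d + \<alpha>) * k2 powr \<beta>)"
  proof (rule mult_mono)
    show "(\<kappa> / k1) powr ?m \<le> (\<kappa> / k1) powr d"
      using k by (intro powr_mono) (auto simp: growth_exp_def)
    show "k1 powr ?m \<le> k1 powr (d + \<alpha>) * k2 powr \<beta>"
    proof (cases "\<beta> \<ge> 0")
      case True
      have "k1 powr ?m * 1 \<le> k1 powr (d + \<alpha>) * k2 powr \<beta>"
        using k True by (intro mult_mono powr_mono ge_one_powr_ge_zero) (auto simp: growth_exp_def)
      then show ?thesis by simp
    next
      case False
      have "k1 powr ?m \<le> k1 powr (d + \<alpha> + \<beta>)"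
        using k by (intro powr_mono) (auto simp: growth_exp_def)
      also have "\<dots> = k1 powr (d + \<alpha>) * k1 powr \<beta>" by (rule powr_add)
      also have "\<dots> \<le> k1 powr (d + \<alpha>) * k2 powr \<beta>"
        using k False by (intro mult_left_mono powr_mono2') auto
      finally show ?thesis .
    qed
  qed auto
  also have "\<dots> = \<kappa> powr d * k1 powr \<alpha> * k2 powr \<beta>"
    using k by (simp add: powr_divide powr_add)
  finally show ?thesis unfolding V \<kappa>_def[symmetric]
    by (intro mult_right_mono) (auto simp: ball_wt_def)
qed

text \<open>Comparison of exponents shows that the left-hand side is the right-hand side times the
  power of t / (|y| + t) with exponent \<open>\<epsilon>\<close>, and a1) says exactly that
  \<open>\<epsilon>\<close> \<ge> 0.\<close>

lemma ball_wt_powr_le: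
  fixes z :: "'x \<times> 'y"
  assumes t: "t > 0"
  shows "ball_wt \<alpha> \<beta> z t powr (p / q)
    \<le> t powr (d - p) * ((norm (snd z) + t) powr a * (norm z + t) powr (- b))"
proof -
  define A where "A = norm (snd z) + t"
  define B where "B = norm z + t"
  define \<epsilon> where "\<epsilon> = d * p / q - (d - p)"
  have \<epsilon>: "\<epsilon> \<ge> 0" using critical p pq by (simp add: \<epsilon>_def pos_le_divide_eq)
  have A: "A \<ge> t" "A > 0" and B: "B > 0" using t by (simp_all add: A_def B_def add_nonneg_pos)
  have e1: "d * (p / q) = (d - p) + \<epsilon>" by (simp add: \<epsilon>_def)
  have e2: "\<alpha> * (p / q) = a - \<epsilon>" using p pq by (simp add: \<alpha>_eq \<epsilon>_def field_simps)
  have e3: "\<beta> * (p / q) = - b" using p pq by (simp add: \<beta>_eq)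
  have V: "ball_wt \<alpha> \<beta> z t = t powr d * A powr \<alpha> * B powr \<beta>"
    by (simp only: ball_wt_def d_eq A_def B_def)
  have "ball_wt \<alpha> \<beta> z t powr (p / q) = t powr (d * (p / q)) * A powr (\<alpha> * (p / q)) * B powr (\<beta> * (p / q))"
    using t A B by (simp add: V powr_mult powr_powr)
  also have "\<dots> = t powr (d - p) * (A powr a * B powr (- b)) * (t / A) powr \<epsilon>"
    unfolding e1 e2 e3 powr_add using A t by (simp add: powr_diff powr_divide)
  also have "\<dots> \<le> t powr (d - p) * (A powr a * B powr (- b)) * 1"
    using A t \<epsilon> by (intro mult_left_mono powr_le1) auto
  finally show ?thesis by (simp add: A_def B_def)
qed


text \<open>Write \<omega> = (0, y/|y|) + \<delta>. The second component of z + t \<omega> is (|y| +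
  t) y/|y| up to an error below t/2: in these directions the point moves away from y = 0. The factor
  10 is a crude common bound for all comparisons.\<close>

lemma cone_bounds:
  fixes z \<omega> :: "'x \<times> 'y"
  assumes y: "snd z \<noteq> 0" and t: "t > 0" and \<omega>: "\<omega> \<in> ball (0, sgn (snd z)) (1/2)"
  shows "10 powr (- \<bar>a\<bar>) * 10 powr (- \<bar>b\<bar>) * ((norm (snd z) + t) powr a * (norm z + t) powr (- b))
      \<le> wt a (- b) (z + t *\<^sub>R \<omega>)"
    and "z + t *\<^sub>R \<omega> \<in> ball z (2 * t)"
proof -
  define A where "A = norm (snd z) + t"
  define B where "B = norm z + t"
  define \<zeta> where "\<zeta> = z + t *\<^sub>R \<omega>"
  define \<delta> where "\<delta> = \<omega> - (0, sgn (snd z))"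
  have n1: "norm ((0::'x, sgn (snd z))) = 1" using y by (simp add: norm_Pair norm_sgn)
  have \<delta>: "norm \<delta> < 1/2" using \<omega> by (simp add: \<delta>_def dist_norm norm_minus_commute)
  have "norm \<omega> \<le> norm (0::'x, sgn (snd z)) + norm \<delta>" unfolding \<delta>_def by (rule norm_triangle_sub)
  then have n\<omega>: "norm \<omega> < 3/2" using n1 \<delta> by linarith
  have nt\<omega>: "norm (t *\<^sub>R \<omega>) < 3/2 * t" using n\<omega> t by simp
  then show "z + t *\<^sub>R \<omega> \<in> ball z (2 * t)" using t by (simp add: dist_norm del: norm_scaleR)
  have yt: "snd z + t *\<^sub>R sgn (snd z) = A *\<^sub>R sgn (snd z)"
  proof -
    have "norm (snd z) *\<^sub>R sgn (snd z) = snd z" using y by (simp add: sgn_div_norm)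
    then show ?thesis by (simp add: A_def scaleR_add_left)
  qed
  have "norm (snd z + t *\<^sub>R sgn (snd z)) = A"
    unfolding yt using y t by (simp add: norm_sgn A_def)
  moreover have "snd \<zeta> = (snd z + t *\<^sub>R sgn (snd z)) + t *\<^sub>R snd \<delta>"
    by (simp add: \<zeta>_def \<delta>_def scaleR_diff_right)
  moreover have "norm (t *\<^sub>R snd \<delta>) \<le> t / 2"
    using t \<delta> norm_snd_le_norm[of \<delta>] by simp
  ultimately have y': "norm (snd \<zeta>) \<ge> A - t / 2" "norm (snd \<zeta>) \<le> A + t / 2"
    using norm_diff_ineq[of "snd z + t *\<^sub>R sgn (snd z)" "t *\<^sub>R snd \<delta>"]
      norm_triangle_ineq[of "snd z + t *\<^sub>R sgn (snd z)" "t *\<^sub>R snd \<delta>"] by simp_all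
  have z': "norm \<zeta> \<ge> norm z - 3/2 * t" "norm \<zeta> \<le> norm z + 3/2 * t"
    using nt\<omega> norm_diff_ineq[of z "t *\<^sub>R \<omega>"] norm_triangle_ineq[of z "t *\<^sub>R \<omega>"]
    unfolding \<zeta>_def by linarith+
  have yz: "norm (snd \<zeta>) \<le> norm \<zeta>" by (rule norm_snd_le_norm)
  have pos: "A > 0" "B > 0" "A \<ge> t" "B \<ge> t" using t by (simp_all add: A_def B_def add_nonneg_pos)
  have "10 powr (- \<bar>a\<bar>) * A powr a \<le> norm (snd \<zeta>) powr a"
    using pos y' t by (intro powr_comparable(2)) linarith+
  moreover have "10 powr (- \<bar>- b\<bar>) * B powr (- b) \<le> norm \<zeta> powr (- b)"
  proof (rule powr_comparable(2))
    \<comment> \<open>If t is small against |z|, the triangle inequality bounds |\<zeta>| from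
      below; otherwise the second component does, being at least t/2.\<close>
    show "B \<le> 10 * norm \<zeta>" using z' y' yz pos t B_def by linarith
    show "norm \<zeta> \<le> 10 * B" using z' pos t B_def norm_ge_zero[of z] by linarith
  qed (use pos in auto)
  ultimately have "(10 powr (- \<bar>a\<bar>) * A powr a) * (10 powr (- \<bar>b\<bar>) * B powr (- b)) \<le> wt a (- b) \<zeta>"
    unfolding wt_def by (intro mult_mono) auto
  then show "10 powr (- \<bar>a\<bar>) * 10 powr (- \<bar>b\<bar>) * ((norm (snd z) + t) powr a * (norm z + t) powr (- b))
      \<le> wt a (- b) (z + t *\<^sub>R \<omega>)"
    by (simp add: \<zeta>_def A_def B_def mult_ac)
qed

section \<open>Energy in the cone and the choice of the radius\<close>

definition layer_energy :: "('x \<times> 'y \<Rightarrow> real) \<Rightarrow> real \<Rightarrow> 'x \<times> 'y \<Rightarrow> ennreal" where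
  "layer_energy u \<tau> \<zeta> = ennreal (wt a (- b) \<zeta> * norm (grad u \<zeta>) powr p) * indicator (layer u \<tau>) \<zeta>"

lemma layer_energy_measurable:
  assumes "u \<in> test_funs"
  shows "layer_energy u \<tau> \<in> borel_measurable borel"
proof -
  note [measurable] = test_fun_measurable[OF assms]
  show ?thesis unfolding layer_energy_def by measurable
qed

text \<open>The substitution \<zeta> = z + t \<omega> has Jacobian t^d and maps the chosen
  directions into the ball of radius 2 t; on their image the energy weight is at least a constant
  times W = (|y| + t)^a (|z| + t)^(-b). The factor 1 / (t^d W) is at most t^(-p) V^(-p/q), with V
  the value of \<open>ball_wt\<close>.\<close>

lemma cone_energy:
  fixes z :: "'x \<times> 'y"
  assumes u: "u \<in> test_funs" and y: "snd z \<noteq> 0" and t: "t > 0"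
    and \<Phi>: "(\<integral>\<^sup>+\<zeta>. layer_energy u \<tau> \<zeta> * indicator (ball z (2 * t)) \<zeta> \<partial>lborel) \<le> ennreal \<Phi>" "\<Phi> \<ge> 0"
  shows "(\<integral>\<^sup>+\<omega>. ennreal ((norm (grad u (z + t *\<^sub>R \<omega>)) * indicator (layer u \<tau>) (z + t *\<^sub>R \<omega>)) powr p)
            * indicator (ball (0, sgn (snd z)) (1/2)) \<omega> \<partial>lborel)
    \<le> ennreal (10 powr \<bar>a\<bar> * 10 powr \<bar>b\<bar> * t powr (- p) * ball_wt \<alpha> \<beta> z t powr (- (p / q)) * \<Phi>)"
proof -
  note [measurable] = test_fun_measurable[OF u] layer_energy_measurable[OF u]
  define B where "B = ball (0::'x, sgn (snd z)) (1/2)"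
  have [measurable]: "B \<in> sets borel" by (simp add: B_def)
  define W where "W = (norm (snd z) + t) powr a * (norm z + t) powr (- b)"
  have W: "W > 0" using t by (simp add: W_def add_nonneg_pos less_imp_neq[THEN not_sym])
  define h where "h \<omega> = (norm (grad u (z + t *\<^sub>R \<omega>)) * indicator (layer u \<tau>) (z + t *\<^sub>R \<omega>)) powr p" for \<omega>
  have [measurable]: "h \<in> borel_measurable borel" unfolding h_def by measurable
  define c where "c = t powr d * (10 powr (- \<bar>a\<bar>) * 10 powr (- \<bar>b\<bar>) * W)"
  have c: "c > 0" using t W by (simp add: c_def)
  have le: "(\<integral>\<^sup>+\<omega>. ennreal (h \<omega>) * indicator B \<omega> \<partial>lborel) \<le> ennreal (\<Phi> / c)"
  proof -
    have "ennreal c * (\<integral>\<^sup>+\<omega>. ennreal (h \<omega>) * indicator B \<omega> \<partial>lborel)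
      = ennreal (t powr d) * (\<integral>\<^sup>+\<omega>. ennreal (10 powr (- \<bar>a\<bar>) * 10 powr (- \<bar>b\<bar>) * W) * (ennreal (h \<omega>) * indicator B \<omega>) \<partial>lborel)"
      using W by (simp add: nn_integral_cmult c_def ennreal_mult' mult.assoc)
    also have "\<dots> \<le> ennreal (t powr d) * (\<integral>\<^sup>+\<omega>. layer_energy u \<tau> (z + t *\<^sub>R \<omega>) * indicator (ball z (2 * t)) (z + t *\<^sub>R \<omega>) \<partial>lborel)"
    proof (intro mult_left_mono nn_integral_mono)
      fix \<omega>
      show "ennreal (10 powr (- \<bar>a\<bar>) * 10 powr (- \<bar>b\<bar>) * W) * (ennreal (h \<omega>) * indicator B \<omega>)
        \<le> layer_energy u \<tau> (z + t *\<^sub>R \<omega>) * indicator (ball z (2 * t)) (z + t *\<^sub>R \<omega>)"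
      proof (cases "\<omega> \<in> B \<and> z + t *\<^sub>R \<omega> \<in> layer u \<tau>")
        case True
        then have *: "10 powr (- \<bar>a\<bar>) * 10 powr (- \<bar>b\<bar>) * W \<le> wt a (- b) (z + t *\<^sub>R \<omega>)" "z + t *\<^sub>R \<omega> \<in> ball z (2 * t)"
          using cone_bounds[OF y t, of \<omega>] unfolding B_def W_def by blast+
        then have "ennreal (10 powr (- \<bar>a\<bar>) * 10 powr (- \<bar>b\<bar>) * W * h \<omega>) \<le> ennreal (wt a (- b) (z + t *\<^sub>R \<omega>) * norm (grad u (z + t *\<^sub>R \<omega>)) powr p)"
          using True unfolding h_def by (intro ennreal_leI mult_mono) auto
        then show ?thesis using True * W by (simp add: layer_energy_def flip: ennreal_mult')
      next
        case False
        then have "ennreal (h \<omega>) * indicator B \<omega> = 0" using p by (auto simp: h_def)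
        then show ?thesis by (simp only: mult_zero_right zero_le)
      qed
    qed simp
    also have "\<dots> = (\<integral>\<^sup>+\<zeta>. layer_energy u \<tau> \<zeta> * indicator (ball z (2 * t)) \<zeta> \<partial>lborel)"
      unfolding d_eq by (rule nn_integral_lborel_scale[OF _ t, symmetric]) (measurable; simp)
    also have "\<dots> \<le> ennreal \<Phi>" by (rule \<Phi>)
    finally have *: "ennreal c * (\<integral>\<^sup>+\<omega>. ennreal (h \<omega>) * indicator B \<omega> \<partial>lborel) \<le> ennreal \<Phi>" .
    have "(\<integral>\<^sup>+\<omega>. ennreal (h \<omega>) * indicator B \<omega> \<partial>lborel) = ennreal (1 / c) * (ennreal c * (\<integral>\<^sup>+\<omega>. ennreal (h \<omega>) * indicator B \<omega> \<partial>lborel))"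
      using c by (simp flip: mult.assoc ennreal_mult')
    also have "\<dots> \<le> ennreal (1 / c) * ennreal \<Phi>" by (intro mult_left_mono *) simp
    also have "\<dots> = ennreal (\<Phi> / c)" using c by (simp flip: ennreal_mult')
    finally show ?thesis .
  qed
  have "\<Phi> / c \<le> 10 powr \<bar>a\<bar> * 10 powr \<bar>b\<bar> * t powr (- p) * ball_wt \<alpha> \<beta> z t powr (- (p / q)) * \<Phi>"
  proof -
    let ?V = "ball_wt \<alpha> \<beta> z t powr (p / q)"
    have V: "?V > 0" "?V \<le> t powr (d - p) * W" using ball_wt_pos[OF t, of z] ball_wt_powr_le[OF t, of z] by (simp_all add: W_def)
    have "\<Phi> / c = 10 powr \<bar>a\<bar> * 10 powr \<bar>b\<bar> * t powr (- p) * (1 / (t powr (d - p) * W)) * \<Phi>"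
      using t W by (simp add: c_def powr_minus powr_diff field_simps)
    also have "\<dots> \<le> 10 powr \<bar>a\<bar> * 10 powr \<bar>b\<bar> * t powr (- p) * (1 / ?V) * \<Phi>"
      using V \<Phi>(2) W t by (intro mult_right_mono mult_left_mono divide_left_mono mult_pos_pos) auto
    also have "\<dots> = 10 powr \<bar>a\<bar> * 10 powr \<bar>b\<bar> * t powr (- p) * ball_wt \<alpha> \<beta> z t powr (- (p / q)) * \<Phi>"
      by (simp add: powr_minus_divide)
    finally show ?thesis .
  qed
  then show ?thesis using order_trans[OF le ennreal_leI] unfolding h_def B_def by simp
qed

text \<open>By contradiction: if every radius fails, the energy in the ball of radius 2 t is at most
  M min(1, X(t)/c). On the cone this bounds the integral of |grad u| over the part of the directions
  that lands in the layer by a multiple of \<open>\<kappa> t\<close>, and integration over t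
  contradicts the crossing estimate. With the factor M^(q/p-1) both sides scale alike when u and
  \<tau> are multiplied by a number and M by its p-th power.\<close>

lemma good_radius:
  "\<exists>c>0. \<forall>(u :: 'x \<times> 'y \<Rightarrow> real) z \<tau> M. u \<in> test_funs \<longrightarrow> \<tau> > 0 \<longrightarrow> M > 0 \<longrightarrow> snd z \<noteq> 0 \<longrightarrow> 2 * \<tau> \<le> \<bar>u z\<bar> \<longrightarrow>
     (\<integral>\<^sup>+\<zeta>. layer_energy u \<tau> \<zeta> \<partial>lborel) \<le> ennreal M \<longrightarrow>
     (\<exists>t>0. ennreal (ball_wt \<alpha> \<beta> z t * \<tau> powr q)
        \<le> ennreal (c * M powr (q / p - 1)) * (\<integral>\<^sup>+\<zeta>. layer_energy u \<tau> \<zeta> * indicator (ball z (2 * t)) \<zeta> \<partial>lborel))"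
proof -
  define vol where "vol = unit_ball_vol d * (1/2) ^ DIM('x \<times> 'y)"
  have vol: "vol > 0" by (simp add: vol_def d_eq unit_ball_vol_pos)
  have vol_ball: "emeasure lborel (ball (e :: 'x \<times> 'y) (1/2)) = ennreal vol" for e
    by (simp only: vol_def d_eq emeasure_ball)
  define c1 where "c1 = 10 powr \<bar>a\<bar> * 10 powr \<bar>b\<bar>"
  have c1: "c1 > 0" by (simp add: c1_def)
  define c3 where "c3 = (c1 / vol) powr (1 / p)"
  have c3: "c3 > 0" using c1 vol by (simp add: c3_def)
  \<comment> \<open>The bound 1 / (8 c3) is aimed at the end of the argument: 2 times 2 \<tau> c3
    vol times it is \<tau> vol / 2, half of what crossing the layer requires.\<close>
  obtain c where c: "c > 0" and int: "\<And>X. (\<forall>t>0. X t > 0) \<Longrightarrow> continuous_on {0<..} X \<Longrightarrow>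
    (\<forall>s t. 0 < s \<longrightarrow> s \<le> t \<longrightarrow> (t / s) powr growth_exp * X s \<le> X t) \<Longrightarrow>
    (\<integral>\<^sup>+t. ennreal (t powr (-1) * (min 1 (X t / c) powr (1 / p) * X t powr (- (1 / q)))) * indicator {0<..} t \<partial>lborel) \<le> ennreal (1 / (8 * c3))"
    using nn_integral_growth_bound[OF growth_exp_pos, of "1 / q" "1 / p" "1 / (8 * c3)"] p pq c3
    by (auto simp: divide_strict_left_mono)
  show ?thesis
  proof (rule exI[of _ c], intro conjI allI impI)
    fix u :: "'x \<times> 'y \<Rightarrow> real" and z \<tau> M
    assume u: "u \<in> test_funs" and \<tau>: "\<tau> > 0" and M: "M > 0" and y: "snd z \<noteq> 0" and uz: "2 * \<tau> \<le> \<bar>u z\<bar>"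
      and E: "(\<integral>\<^sup>+\<zeta>. layer_energy u \<tau> \<zeta> \<partial>lborel) \<le> ennreal M"
    note [measurable] = test_fun_measurable[OF u] layer_energy_measurable[OF u]
    define V where "V t = ball_wt \<alpha> \<beta> z t" for t
    have V: "V t > 0" if "t > 0" for t using ball_wt_pos[OF that] by (simp add: V_def)
    \<comment> \<open>For fixed \<tau> and M a multiple of V, hence with the same growth, but
      normalised so that c depends neither on u nor on \<tau> and M.\<close>
    define X where "X t = V t * \<tau> powr q / M powr (q / p)" for t
    have X: "X t > 0" if "t > 0" for t using V[OF that] \<tau> M by (simp add: X_def)
    let ?e = "(0::'x, sgn (snd z))"
    have e1: "norm ?e = 1" using y by (simp add: norm_Pair norm_sgn)
    show "\<exists>t>0. ennreal (ball_wt \<alpha> \<beta> z t * \<tau> powr q)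
        \<le> ennreal (c * M powr (q / p - 1)) * (\<integral>\<^sup>+\<zeta>. layer_energy u \<tau> \<zeta> * indicator (ball z (2 * t)) \<zeta> \<partial>lborel)"
    proof (rule ccontr)
      assume neg: "\<not> ?thesis"
      have \<Phi>: "(\<integral>\<^sup>+\<zeta>. layer_energy u \<tau> \<zeta> * indicator (ball z (2 * t)) \<zeta> \<partial>lborel) \<le> ennreal (M * min 1 (X t / c))" (is "?\<Phi> \<le> _")
        if t: "t > 0" for t
      proof -
        have "?\<Phi> \<le> (\<integral>\<^sup>+\<zeta>. layer_energy u \<tau> \<zeta> \<partial>lborel)" by (intro nn_integral_mono) (auto split: split_indicator)
        then have 1: "?\<Phi> \<le> ennreal M" using E by (rule order_trans)
        then obtain \<phi> where \<phi>: "?\<Phi> = ennreal \<phi>" "\<phi> \<ge> 0" by (cases ?\<Phi>) (auto simp: top_unique)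
        have "ennreal (c * M powr (q / p - 1)) * ?\<Phi> < ennreal (V t * \<tau> powr q)"
          using neg t unfolding V_def by (meson not_le)
        then have "c * M powr (q / p - 1) * \<phi> < V t * \<tau> powr q"
          unfolding \<phi>(1) using c \<phi>(2) V[OF t] by (simp add: ennreal_less_iff flip: ennreal_mult')
        then have "\<phi> \<le> M * (X t / c)"
          using c M by (simp add: X_def powr_diff field_simps)
        moreover have "\<phi> \<le> M" using 1 \<phi> M by simp
        ultimately have "\<phi> \<le> M * min 1 (X t / c)" by (simp add: min_def)
        then show ?thesis unfolding \<phi>(1) by (rule ennreal_leI)
      qed
      \<comment> \<open>Chosen such that \<open>\<kappa> t powr p * vol\<close> is exactly the bound
        that \<open>cone_energy\<close> gives; the powers of \<tau> cancel there because X^(-p/q)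
        contains \<tau>^(-p).\<close>
      define \<kappa> where "\<kappa> t = \<tau> * c3 * (t powr (-1) * (min 1 (X t / c) powr (1 / p) * X t powr (- (1 / q))))" for t
      have G: "(\<integral>\<^sup>+\<omega>. ennreal (norm (grad u (z + t *\<^sub>R \<omega>))) * indicator (layer u \<tau>) (z + t *\<^sub>R \<omega>)
          * indicator (ball ?e (1/2)) \<omega> \<partial>lborel) \<le> ennreal (2 * \<kappa> t * vol)" if t: "t > 0" for t
      proof -
        have \<kappa>: "\<kappa> t > 0" using \<tau> c3 t X[OF t] c unfolding \<kappa>_def by (simp add: min_def)
        have min0: "min 1 (X t / c) > 0" using X[OF t] c by simp
        have Xp: "X t powr (- (p / q)) = V t powr (- (p / q)) * \<tau> powr (- p) * M"
        proof -
          have "X t powr (- (p / q)) = V t powr (- (p / q)) * (\<tau> powr q) powr (- (p / q)) / (M powr (q / p)) powr (- (p / q))"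
            using V[OF t] \<tau> M by (simp add: X_def powr_divide powr_mult)
          also have "(\<tau> powr q) powr (- (p / q)) = \<tau> powr (- p)" using p pq by (simp add: powr_powr)
          also have "(M powr (q / p)) powr (- (p / q)) = 1 / M" using p pq M by (simp add: powr_powr powr_minus_divide)
          finally show ?thesis by simp
        qed
        have "\<kappa> t powr p = \<tau> powr p * (c1 / vol) * (t powr (- p) * (min 1 (X t / c) * X t powr (- (p / q))))"
        proof -
          have 1: "((c1 / vol) powr (1 / p)) powr p = c1 / vol" "(t powr (-1)) powr p = t powr (- p)"
            "((min 1 (X t / c)) powr (1 / p)) powr p = min 1 (X t / c)" "(X t powr (- (1 / q))) powr p = X t powr (- (p / q))"
            using c1 vol p min0 unfolding powr_powr by simp_all
          have "(x1 * x2 * (x3 * (x4 * x5))) powr p = x1 powr p * x2 powr p * (x3 powr p * (x4 powr p * x5 powr p))"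
            if "x1 \<ge> 0" "x2 \<ge> 0" "x3 \<ge> 0" "x4 \<ge> 0" "x5 \<ge> 0" for x1 x2 x3 x4 x5 :: real
            using that by (simp add: powr_mult)
          note 2 = this[of \<tau> "(c1 / vol) powr (1 / p)" "t powr (-1)" "(min 1 (X t / c)) powr (1 / p)" "X t powr (- (1 / q))"]
          show ?thesis unfolding \<kappa>_def c3_def using 2[unfolded 1] \<tau> by simp
        qed
        also have "\<dots> = (c1 / vol) * (t powr (- p) * (M * min 1 (X t / c) * V t powr (- (p / q))))"
          unfolding Xp using \<tau> by (simp add: powr_minus field_simps)
        finally have \<kappa>p: "\<kappa> t powr p * vol = c1 * t powr (- p) * V t powr (- (p / q)) * (M * min 1 (X t / c))"
          using vol by simp
        have "(\<integral>\<^sup>+\<omega>. ennreal (norm (grad u (z + t *\<^sub>R \<omega>)) * indicator (layer u \<tau>) (z + t *\<^sub>R \<omega>))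
          * indicator (ball ?e (1/2)) \<omega> \<partial>lborel) \<le> ennreal (2 * \<kappa> t * vol)"
        proof (rule nn_integral_le_of_powr[OF _ _ _ _ _ p \<kappa>])
          show "(\<integral>\<^sup>+\<omega>. ennreal ((norm (grad u (z + t *\<^sub>R \<omega>)) * indicator (layer u \<tau>) (z + t *\<^sub>R \<omega>)) powr p)
            * indicator (ball ?e (1/2)) \<omega> \<partial>lborel) \<le> ennreal (\<kappa> t powr p * vol)"
            unfolding \<kappa>p using cone_energy[OF u y t \<Phi>[OF t]] M min0 by (simp add: c1_def V_def)
          show "emeasure lborel (ball ?e (1/2)) = ennreal vol" by (rule vol_ball)
        qed (use vol in auto)
        then show ?thesis by (simp add: ennreal_mult' ennreal_indicator)
      qed
      have "ennreal \<tau> * ennreal vol \<le> 2 * (\<integral>\<^sup>+t. (\<integral>\<^sup>+\<omega>. ennreal (norm (grad u (z + t *\<^sub>R \<omega>))) * indicator (layer u \<tau>) (z + t *\<^sub>R \<omega>)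
          * indicator (ball ?e (1/2)) \<omega> \<partial>lborel) * indicator {0<..} t \<partial>lborel)"
        using layer_crossing_average[OF u \<tau> uz e1] by (simp only: vol_ball)
      also have "\<dots> \<le> 2 * (\<integral>\<^sup>+t. ennreal (2 * \<tau> * c3 * vol) * (ennreal (t powr (-1) * (min 1 (X t / c) powr (1 / p) * X t powr (- (1 / q)))) * indicator {0<..} t) \<partial>lborel)"
      proof (intro mult_left_mono nn_integral_mono)
        fix t :: real
        show "(\<integral>\<^sup>+\<omega>. ennreal (norm (grad u (z + t *\<^sub>R \<omega>))) * indicator (layer u \<tau>) (z + t *\<^sub>R \<omega>)
          * indicator (ball ?e (1/2)) \<omega> \<partial>lborel) * indicator {0<..} t
          \<le> ennreal (2 * \<tau> * c3 * vol) * (ennreal (t powr (-1) * (min 1 (X t / c) powr (1 / p) * X t powr (- (1 / q)))) * indicator {0<..} t)"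
        proof (cases "t > 0")
          case True
          have "2 * \<kappa> t * vol = 2 * \<tau> * c3 * vol * (t powr (-1) * (min 1 (X t / c) powr (1 / p) * X t powr (- (1 / q))))"
            by (simp add: \<kappa>_def)
          then show ?thesis using G[OF True] True \<tau> c3 vol by (simp flip: ennreal_mult')
        qed simp
      qed simp
      also have "\<dots> = 2 * (ennreal (2 * \<tau> * c3 * vol) * (\<integral>\<^sup>+t. ennreal (t powr (-1) * (min 1 (X t / c) powr (1 / p) * X t powr (- (1 / q)))) * indicator {0<..} t \<partial>lborel))"
      proof (subst nn_integral_cmult)
        have [measurable]: "X \<in> borel_measurable borel"
          unfolding X_def V_def ball_wt_def by measurable
        show "(\<lambda>t. ennreal (t powr (-1) * (min 1 (X t / c) powr (1 / p) * X t powr (- (1 / q)))) * indicator {0<..} t) \<in> borel_measurable lborel"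
          by measurable
      qed simp
      also have "\<dots> \<le> 2 * (ennreal (2 * \<tau> * c3 * vol) * ennreal (1 / (8 * c3)))"
      proof (intro mult_left_mono int)
        show "\<forall>t>0. X t > 0" using X by blast
        show "continuous_on {0<..} X" unfolding X_def V_def ball_wt_def
          using M by (intro continuous_intros) (auto simp: add_nonneg_eq_0_iff)
        show "\<forall>s t. 0 < s \<longrightarrow> s \<le> t \<longrightarrow> (t / s) powr growth_exp * X s \<le> X t"
        proof (intro allI impI)
          fix s t :: real assume "0 < s" "s \<le> t"
          from ball_wt_growth[OF this, of z] have "((t / s) powr growth_exp * V s) * (\<tau> powr q / M powr (q / p)) \<le> V t * (\<tau> powr q / M powr (q / p))"
            unfolding V_def by (intro mult_right_mono) auto
          then show "(t / s) powr growth_exp * X s \<le> X t" by (simp add: X_def)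
        qed
      qed auto
      also have "\<dots> = ennreal (\<tau> * vol / 2)"
        using \<tau> vol c3 by (simp flip: ennreal_mult' ennreal_numeral)
      finally have "\<tau> * vol \<le> \<tau> * vol / 2" using \<tau> vol by (simp flip: ennreal_mult')
      then show False using \<tau> vol by simp
    qed
  qed (rule c)
qed

end

section \<open>The inequality for test functions\<close>

context critical_weights
begin

lemma ball_wt_unit_ge:
  fixes z :: "'x \<times> 'y"
  assumes "norm z \<le> R"
  shows "(R + 1) powr (- \<bar>\<alpha>\<bar>) * (R + 1) powr (- \<bar>\<beta>\<bar>) \<le> ball_wt \<alpha> \<beta> z 1"
proof -
  have R: "R \<ge> 0" using assms norm_ge_zero order_trans by blast
  have "norm (snd z) \<le> R" using norm_snd_le_norm assms by (rule order_trans)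
  then have "(R + 1) powr (- \<bar>\<alpha>\<bar>) * 1 powr \<alpha> \<le> (norm (snd z) + 1) powr \<alpha>"
    using R by (intro powr_comparable(2)) (auto simp: algebra_simps add_increasing)
  moreover have "(R + 1) powr (- \<bar>\<beta>\<bar>) * 1 powr \<beta> \<le> (norm z + 1) powr \<beta>"
    using R assms by (intro powr_comparable(2)) (auto simp: algebra_simps add_increasing)
  ultimately have "((R + 1) powr (- \<bar>\<alpha>\<bar>) * 1 powr \<alpha>) * ((R + 1) powr (- \<bar>\<beta>\<bar>) * 1 powr \<beta>)
      \<le> (norm (snd z) + 1) powr \<alpha> * (norm z + 1) powr \<beta>"
    by (intro mult_mono) auto
  then show ?thesis by (simp add: ball_wt_def)
qed

text \<open>Vitali's covering lemma needs bounded radii. For |z| \<le> R the value of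
  \<open>ball_wt\<close> at radius 1 has a positive lower bound, and its growth from 1 to t turns an
  upper bound at t into a bound for t itself.\<close>

lemma good_radius_bounded:
  fixes z :: "'x \<times> 'y"
  assumes "t > 0" "norm z \<le> R" "ball_wt \<alpha> \<beta> z t \<le> L"
  shows "t \<le> max 1 ((L / ((R + 1) powr (- \<bar>\<alpha>\<bar>) * (R + 1) powr (- \<bar>\<beta>\<bar>))) powr (1 / growth_exp))"
proof (cases "t \<le> 1")
  case False
  let ?v = "(R + 1) powr (- \<bar>\<alpha>\<bar>) * (R + 1) powr (- \<bar>\<beta>\<bar>)"
  have R: "R \<ge> 0" using assms norm_ge_zero order_trans by blast
  then have v: "?v > 0" by simp
  have "t powr growth_exp * ?v \<le> t powr growth_exp * ball_wt \<alpha> \<beta> z 1"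
    by (intro mult_left_mono ball_wt_unit_ge assms) simp
  also have "\<dots> \<le> ball_wt \<alpha> \<beta> z t" using ball_wt_growth[of 1 t z] False by simp
  also have "\<dots> \<le> L" by (rule assms)
  finally have "t powr growth_exp \<le> L / ?v" using v by (simp add: pos_le_divide_eq del: powr_gt_zero)
  then have "(t powr growth_exp) powr (1 / growth_exp) \<le> (L / ?v) powr (1 / growth_exp)"
    using growth_exp_pos by (intro powr_mono2) auto
  then have "t \<le> (L / ?v) powr (1 / growth_exp)"
    using growth_exp_pos assms by (simp add: powr_powr)
  then show ?thesis by linarith
qed simp

text \<open>The balls of radius 2 T(z) selected by Vitali's lemma are disjoint, so their energies
  add up to at most the energy of the layer. The balls of radius 10 T(z), five times as large, cover
  the set, and their mass is bounded by a multiple of \<open>ball_wt\<close> at T(z).\<close>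

lemma weak_type:
  "\<exists>C\<ge>0. \<forall>(u :: 'x \<times> 'y \<Rightarrow> real) \<tau> M. u \<in> test_funs \<longrightarrow> \<tau> > 0 \<longrightarrow> M > 0 \<longrightarrow>
     (\<integral>\<^sup>+\<zeta>. layer_energy u \<tau> \<zeta> \<partial>lborel) \<le> ennreal M \<longrightarrow>
     (\<integral>\<^sup>+\<zeta>. ennreal (wt \<alpha> \<beta> \<zeta>) * indicator {\<zeta>. 2 * \<tau> \<le> \<bar>u \<zeta>\<bar>} \<zeta> \<partial>lborel)
        \<le> ennreal (C * M powr (q / p - 1) * \<tau> powr (- q)) * (\<integral>\<^sup>+\<zeta>. layer_energy u \<tau> \<zeta> \<partial>lborel)"
proof -
  obtain c where c: "c > 0" and good: "\<And>(u :: 'x \<times> 'y \<Rightarrow> real) z \<tau> M. u \<in> test_funs \<Longrightarrow> \<tau> > 0 \<Longrightarrow> M > 0 \<Longrightarrow> snd z \<noteq> 0 \<Longrightarrow> 2 * \<tau> \<le> \<bar>u z\<bar> \<Longrightarrow>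
     (\<integral>\<^sup>+\<zeta>. layer_energy u \<tau> \<zeta> \<partial>lborel) \<le> ennreal M \<Longrightarrow>
     \<exists>t>0. ennreal (ball_wt \<alpha> \<beta> z t * \<tau> powr q)
        \<le> ennreal (c * M powr (q / p - 1)) * (\<integral>\<^sup>+\<zeta>. layer_energy u \<tau> \<zeta> * indicator (ball z (2 * t)) \<zeta> \<partial>lborel)"
    using good_radius by blast
  obtain K where K: "K \<ge> 0" and ball: "\<And>(z::'x \<times> 'y) t. t > 0 \<Longrightarrow>
    (\<integral>\<^sup>+\<zeta>. ennreal (wt \<alpha> \<beta> \<zeta>) * indicator (ball z (10 * t)) \<zeta> \<partial>lborel) \<le> ennreal (K * ball_wt \<alpha> \<beta> z t)"
    using nn_integral_wt_ball[OF \<alpha>_gt exponents(2)[unfolded d_eq], of 10] by auto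
  have "(\<integral>\<^sup>+\<zeta>. ennreal (wt \<alpha> \<beta> \<zeta>) * indicator {\<zeta>. 2 * \<tau> \<le> \<bar>u \<zeta>\<bar>} \<zeta> \<partial>lborel)
        \<le> ennreal (K * c * M powr (q / p - 1) * \<tau> powr (- q)) * (\<integral>\<^sup>+\<zeta>. layer_energy u \<tau> \<zeta> \<partial>lborel)"
    if u: "u \<in> test_funs" and \<tau>: "\<tau> > 0" and M: "M > 0"
      and E: "(\<integral>\<^sup>+\<zeta>. layer_energy u \<tau> \<zeta> \<partial>lborel) \<le> ennreal M"
    for u :: "'x \<times> 'y \<Rightarrow> real" and \<tau> M
  proof -
    note [measurable] = test_fun_measurable[OF u] layer_energy_measurable[OF u]
    \<comment> \<open>At y = 0 there is no direction y/|y| to move in; these points do not count,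
      because \<open>wt\<close> is 0 there by \<open>0 powr \<alpha> = 0\<close>.\<close>
    define Z where "Z = {z. snd z \<noteq> 0 \<and> 2 * \<tau> \<le> \<bar>u z\<bar>}"
    define \<mu> where "\<mu> = c * M powr (q / p - 1)"
    have \<mu>: "\<mu> > 0" using c M by (simp add: \<mu>_def)
    define \<Phi> where "\<Phi> z t = (\<integral>\<^sup>+\<zeta>. layer_energy u \<tau> \<zeta> * indicator (ball z (2 * t)) \<zeta> \<partial>lborel)" for z t
    have "\<forall>z\<in>Z. \<exists>t>0. ennreal (ball_wt \<alpha> \<beta> z t * \<tau> powr q) \<le> ennreal \<mu> * \<Phi> z t"
      using good[OF u \<tau> M _ _ E] unfolding Z_def \<mu>_def \<Phi>_def by blast
    then obtain T where T: "\<And>z. z \<in> Z \<Longrightarrow> T z > 0"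
      "\<And>z. z \<in> Z \<Longrightarrow> ennreal (ball_wt \<alpha> \<beta> z (T z) * \<tau> powr q) \<le> ennreal \<mu> * \<Phi> z (T z)"
      by metis
    obtain R where R: "R > 0" "\<And>z. norm z \<ge> R \<Longrightarrow> u z = 0" "\<And>z. norm z \<ge> R \<Longrightarrow> grad u z = 0"
      using test_fun_support[OF u] by blast
    obtain B where B: "\<And>z. z \<in> Z \<Longrightarrow> T z \<le> B"
    proof -
      \<comment> \<open>In the inequality that defines \<open>T z\<close>, the energy in the ball is
        replaced by its bound \<open>M\<close>; this bounds \<open>ball_wt\<close> at the radius
        \<open>T z\<close>.\<close>
      define L where "L = \<mu> * M / \<tau> powr q"
      have "T z \<le> max 1 ((L / ((R + 1) powr (- \<bar>\<alpha>\<bar>) * (R + 1) powr (- \<bar>\<beta>\<bar>))) powr (1 / growth_exp))" if z: "z \<in> Z" for z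
      proof (rule good_radius_bounded[OF T(1)[OF z]])
        show "norm z \<le> R" using R(2)[of z] z \<tau> by (force simp: Z_def)
        have "\<Phi> z (T z) \<le> ennreal M"
          unfolding \<Phi>_def by (rule order_trans[OF nn_integral_mono E]) (auto split: split_indicator)
        then have "ennreal (ball_wt \<alpha> \<beta> z (T z) * \<tau> powr q) \<le> ennreal \<mu> * ennreal M"
          using T(2)[OF z] by (meson mult_left_mono order_trans zero_le)
        then have "ball_wt \<alpha> \<beta> z (T z) * \<tau> powr q \<le> \<mu> * M"
          using \<mu> M by (simp flip: ennreal_mult')
        then show "ball_wt \<alpha> \<beta> z (T z) \<le> L" using \<tau> by (simp add: L_def pos_le_divide_eq)
      qed
      then show thesis by (rule that)
    qed
    obtain C where C: "countable C" "C \<subseteq> Z"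
      "pairwise (\<lambda>i j. disjnt (cball i (2 * T i)) (cball j (2 * T j))) C"
      and cov: "\<And>i. i \<in> Z \<Longrightarrow> \<exists>j. j \<in> C \<and> \<not> disjnt (cball i (2 * T i)) (cball j (2 * T j)) \<and>
                        cball i (2 * T i) \<subseteq> ball j (5 * (2 * T j))"
      using Vitali_covering_lemma_cballs_balls[of Z "\<lambda>z. 2 * T z" "2 * B" "\<lambda>z. z"] T(1) B by (smt (verit))
    \<comment> \<open>The selected points are numbered by the elements of \<open>N\<close>; the
      remaining indices get empty balls, so that series over all naturals can be used.\<close>
    define N where "N = to_nat_on C ` C"
    define g where "g n = inv_into C (to_nat_on C) n" for n
    have g: "g n \<in> C" if "n \<in> N" for n using that by (simp add: N_def g_def inv_into_into)
    have g_inj: "g n \<noteq> g m" if "n \<in> N" "m \<in> N" "n \<noteq> m" for n m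
      using that by (metis N_def g_def f_inv_into_f)
    have g_surj: "\<exists>n\<in>N. g n = j" if "j \<in> C" for j
      using inv_into_f_f[OF inj_on_to_nat_on[OF C(1)] that] that
      by (intro bexI[of _ "to_nat_on C j"]) (simp_all add: N_def g_def)
    define A1 where "A1 n = (if n \<in> N then ball (g n) (10 * T (g n)) else {})" for n
    define A2 where "A2 n = (if n \<in> N then ball (g n) (2 * T (g n)) else {})" for n
    have [measurable]: "A1 n \<in> sets borel" "A2 n \<in> sets borel" for n by (simp_all add: A1_def A2_def)
    have disj: "disjoint_family A2"
      unfolding disjoint_family_on_def
    proof (intro ballI impI)
      fix n m :: nat assume "n \<noteq> m"
      show "A2 n \<inter> A2 m = {}"
      proof (cases "n \<in> N \<and> m \<in> N")
        case True
        then have "disjnt (cball (g n) (2 * T (g n))) (cball (g m) (2 * T (g m)))"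
          using C(3) g g_inj \<open>n \<noteq> m\<close> unfolding pairwise_def by metis
        then have "ball (g n) (2 * T (g n)) \<inter> ball (g m) (2 * T (g m)) = {}"
          using ball_subset_cball[of "g n" "2 * T (g n)"] ball_subset_cball[of "g m" "2 * T (g m)"]
          unfolding disjnt_def by blast
        then show ?thesis using True by (simp add: A2_def)
      qed (auto simp: A2_def)
    qed
    have step: "(\<integral>\<^sup>+\<zeta>. ennreal (wt \<alpha> \<beta> \<zeta>) * indicator (A1 n) \<zeta> \<partial>lborel)
        \<le> ennreal (K * \<mu> * \<tau> powr (- q)) * (\<integral>\<^sup>+\<zeta>. layer_energy u \<tau> \<zeta> * indicator (A2 n) \<zeta> \<partial>lborel)" for n
    proof (cases "n \<in> N")
      case True
      then have z: "g n \<in> Z" using g C(2) by blast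
      let ?z = "g n"
      have V: "ball_wt \<alpha> \<beta> ?z (T ?z) \<ge> 0" by (simp add: ball_wt_def)
      have "(\<integral>\<^sup>+\<zeta>. ennreal (wt \<alpha> \<beta> \<zeta>) * indicator (A1 n) \<zeta> \<partial>lborel) \<le> ennreal (K * ball_wt \<alpha> \<beta> ?z (T ?z))"
        using ball[OF T(1)[OF z], of ?z] True by (simp add: A1_def)
      also have "K * ball_wt \<alpha> \<beta> ?z (T ?z) = (K * \<tau> powr (- q)) * (ball_wt \<alpha> \<beta> ?z (T ?z) * \<tau> powr q)"
        using \<tau> by (simp add: powr_minus)
      also have "ennreal \<dots> = ennreal (K * \<tau> powr (- q)) * ennreal (ball_wt \<alpha> \<beta> ?z (T ?z) * \<tau> powr q)"
        using K by (simp add: ennreal_mult')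
      also have "\<dots> \<le> ennreal (K * \<tau> powr (- q)) * (ennreal \<mu> * \<Phi> ?z (T ?z))"
        by (intro mult_left_mono T(2) z) simp
      also have "\<dots> = ennreal (K * \<mu> * \<tau> powr (- q)) * \<Phi> ?z (T ?z)"
      proof -
        have "ennreal (K * \<mu> * \<tau> powr (- q)) = ennreal (K * \<tau> powr (- q)) * ennreal \<mu>"
          using K \<mu> by (subst ennreal_mult'[symmetric]) (simp_all add: mult_ac)
        then show ?thesis by (simp only: mult.assoc)
      qed
      also have "\<Phi> ?z (T ?z) = (\<integral>\<^sup>+\<zeta>. layer_energy u \<tau> \<zeta> * indicator (A2 n) \<zeta> \<partial>lborel)"
        using True by (simp add: \<Phi>_def A2_def)
      finally show ?thesis .
    qed (simp add: A1_def)
    have "(\<integral>\<^sup>+\<zeta>. ennreal (wt \<alpha> \<beta> \<zeta>) * indicator {\<zeta>. 2 * \<tau> \<le> \<bar>u \<zeta>\<bar>} \<zeta> \<partial>lborel)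
      \<le> (\<integral>\<^sup>+\<zeta>. (\<Sum>n. ennreal (wt \<alpha> \<beta> \<zeta>) * indicator (A1 n) \<zeta>) \<partial>lborel)"
    proof (rule nn_integral_mono)
      fix \<zeta> :: "'x \<times> 'y"
      show "ennreal (wt \<alpha> \<beta> \<zeta>) * indicator {\<zeta>. 2 * \<tau> \<le> \<bar>u \<zeta>\<bar>} \<zeta> \<le> (\<Sum>n. ennreal (wt \<alpha> \<beta> \<zeta>) * indicator (A1 n) \<zeta>)"
      proof (cases "\<zeta> \<in> Z")
        case True
        from cov[OF True] obtain j where j: "j \<in> C" "cball \<zeta> (2 * T \<zeta>) \<subseteq> ball j (5 * (2 * T j))" by blast
        then obtain n where n: "n \<in> N" "g n = j" using g_surj by blast
        have "\<zeta> \<in> cball \<zeta> (2 * T \<zeta>)" using T(1)[OF True] by simp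
        then have "\<zeta> \<in> ball j (5 * (2 * T j))" using j(2) by blast
        then have "\<zeta> \<in> A1 n" using n by (simp add: A1_def)
        then have "ennreal (wt \<alpha> \<beta> \<zeta>) * indicator {\<zeta>. 2 * \<tau> \<le> \<bar>u \<zeta>\<bar>} \<zeta> \<le> (\<Sum>n\<in>{n}. ennreal (wt \<alpha> \<beta> \<zeta>) * indicator (A1 n) \<zeta>)"
          by (auto split: split_indicator)
        also have "\<dots> \<le> (\<Sum>n. ennreal (wt \<alpha> \<beta> \<zeta>) * indicator (A1 n) \<zeta>)"
          by (rule sum_le_suminf) auto
        finally show ?thesis .
      next
        case False
        then have "wt \<alpha> \<beta> \<zeta> = 0 \<or> \<not> 2 * \<tau> \<le> \<bar>u \<zeta>\<bar>" by (auto simp: Z_def wt_def)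
        then show ?thesis by auto
      qed
    qed
    also have "\<dots> = (\<Sum>n. \<integral>\<^sup>+\<zeta>. ennreal (wt \<alpha> \<beta> \<zeta>) * indicator (A1 n) \<zeta> \<partial>lborel)"
      by (rule nn_integral_suminf) measurable
    also have "\<dots> \<le> (\<Sum>n. ennreal (K * \<mu> * \<tau> powr (- q)) * (\<integral>\<^sup>+\<zeta>. layer_energy u \<tau> \<zeta> * indicator (A2 n) \<zeta> \<partial>lborel))"
      by (intro suminf_le step summableI)
    also have "\<dots> = ennreal (K * \<mu> * \<tau> powr (- q)) * (\<integral>\<^sup>+\<zeta>. (\<Sum>n. layer_energy u \<tau> \<zeta> * indicator (A2 n) \<zeta>) \<partial>lborel)"
      by (subst nn_integral_suminf) (auto simp: ennreal_suminf_cmult)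
    also have "\<dots> \<le> ennreal (K * \<mu> * \<tau> powr (- q)) * (\<integral>\<^sup>+\<zeta>. layer_energy u \<tau> \<zeta> \<partial>lborel)"
      by (intro mult_left_mono nn_integral_mono)
        (auto simp: ennreal_suminf_cmult suminf_indicator[OF disj] split: split_indicator)
    finally show ?thesis by (simp add: \<mu>_def mult.assoc)
  qed
  then show ?thesis using K c by (intro exI[of _ "K * c"]) auto
qed

text \<open>The mass where |u| lies between 2 \<tau> and 4 \<tau> is charged to the layer from
  \<tau> to 2 \<tau>. With the same M, the total energy, for all heights, the factors \<tau>^q and
  \<tau>^(-q) cancel, and a sum of energies of disjoint layers remains. The function itself is never
  truncated: a layer enters only through its indicator.\<close>

lemma test_fun_inequality:
  "\<exists>C>0. \<forall>(u :: 'x \<times> 'y \<Rightarrow> real) M. u \<in> test_funs \<longrightarrow> M > 0 \<longrightarrow>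
     (\<integral>\<^sup>+\<zeta>. ennreal (wt a (- b) \<zeta> * norm (grad u \<zeta>) powr p) \<partial>lborel) \<le> ennreal M \<longrightarrow>
     (\<integral>\<^sup>+\<zeta>. ennreal (wt \<alpha> \<beta> \<zeta> * \<bar>u \<zeta>\<bar> powr q) \<partial>lborel) \<le> ennreal (C * M powr (q / p))"
proof -
  obtain C where C: "C \<ge> 0" and weak: "\<And>(u :: 'x \<times> 'y \<Rightarrow> real) \<tau> M. u \<in> test_funs \<Longrightarrow> \<tau> > 0 \<Longrightarrow> M > 0 \<Longrightarrow>
     (\<integral>\<^sup>+\<zeta>. layer_energy u \<tau> \<zeta> \<partial>lborel) \<le> ennreal M \<Longrightarrow>
     (\<integral>\<^sup>+\<zeta>. ennreal (wt \<alpha> \<beta> \<zeta>) * indicator {\<zeta>. 2 * \<tau> \<le> \<bar>u \<zeta>\<bar>} \<zeta> \<partial>lborel)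
        \<le> ennreal (C * M powr (q / p - 1) * \<tau> powr (- q)) * (\<integral>\<^sup>+\<zeta>. layer_energy u \<tau> \<zeta> \<partial>lborel)"
    using weak_type by blast
  have main: "(\<integral>\<^sup>+\<zeta>. ennreal (wt \<alpha> \<beta> \<zeta> * \<bar>u \<zeta>\<bar> powr q) \<partial>lborel) \<le> ennreal (4 powr q * C * M powr (q / p))"
    if u: "u \<in> test_funs" and M: "M > 0"
      and E: "(\<integral>\<^sup>+\<zeta>. ennreal (wt a (- b) \<zeta> * norm (grad u \<zeta>) powr p) \<partial>lborel) \<le> ennreal M"
    for u :: "'x \<times> 'y \<Rightarrow> real" and M
  proof -
    note [measurable] = test_fun_measurable[OF u] layer_energy_measurable[OF u]
    \<comment> \<open>\<open>int_decode\<close> runs through all integers, so the sum over the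
      heights 2^j becomes a series over the naturals.\<close>
    define \<tau> :: "nat \<Rightarrow> real" where "\<tau> n = 2 powr real_of_int (int_decode n)" for n
    have \<tau>: "\<tau> n > 0" for n by (simp add: \<tau>_def)
    have En: "(\<integral>\<^sup>+\<zeta>. layer_energy u (\<tau> n) \<zeta> \<partial>lborel) \<le> ennreal M" for n
      by (rule order_trans[OF nn_integral_mono E]) (auto simp: layer_energy_def split: split_indicator)
    have disj: "disjoint_family (\<lambda>n. layer u (\<tau> n))"
      unfolding disjoint_family_on_def
    proof (intro ballI impI)
      fix n m :: nat assume nm: "n \<noteq> m"
      show "layer u (\<tau> n) \<inter> layer u (\<tau> m) = {}"
      proof (rule ccontr)
        assume "layer u (\<tau> n) \<inter> layer u (\<tau> m) \<noteq> {}"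
        then have "\<tau> n < 2 * \<tau> m" "\<tau> m < 2 * \<tau> n" unfolding layer_def by force+
        moreover have two: "2 * \<tau> i = 2 powr (real_of_int (int_decode i + 1))" for i by (simp add: \<tau>_def powr_add)
        ultimately have "real_of_int (int_decode n) < real_of_int (int_decode m + 1)" "real_of_int (int_decode m) < real_of_int (int_decode n + 1)"
          unfolding two unfolding \<tau>_def by (auto elim!: powr_less_cancel simp del: of_int_add)
        then have "int_decode n = int_decode m" by linarith
        then show False using nm by (metis int_decode_inverse)
      qed
    qed
    let ?k = "ennreal (4 powr q * C * M powr (q / p - 1))"
    have "(\<integral>\<^sup>+\<zeta>. ennreal (wt \<alpha> \<beta> \<zeta> * \<bar>u \<zeta>\<bar> powr q) \<partial>lborel)
      \<le> (\<integral>\<^sup>+\<zeta>. (\<Sum>n. ennreal (4 powr q * \<tau> n powr q) * (ennreal (wt \<alpha> \<beta> \<zeta>) * indicator {\<zeta>. 2 * \<tau> n \<le> \<bar>u \<zeta>\<bar>} \<zeta>)) \<partial>lborel)"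
    proof (rule nn_integral_mono)
      fix \<zeta> :: "'x \<times> 'y"
      show "ennreal (wt \<alpha> \<beta> \<zeta> * \<bar>u \<zeta>\<bar> powr q) \<le> (\<Sum>n. ennreal (4 powr q * \<tau> n powr q) * (ennreal (wt \<alpha> \<beta> \<zeta>) * indicator {\<zeta>. 2 * \<tau> n \<le> \<bar>u \<zeta>\<bar>} \<zeta>))"
      proof (cases "u \<zeta> = 0")
        case False
        define L where "L = log 2 \<bar>u \<zeta>\<bar>"
        have uL: "\<bar>u \<zeta>\<bar> = 2 powr L" using False by (simp add: L_def)
        \<comment> \<open>For this index 2 \<tau> \<le> |u| \<le> 4 \<tau> at the point; its term
          alone dominates the left-hand side.\<close>
        define n where "n = int_encode (\<lfloor>L\<rfloor> - 1)"
        have \<tau>n: "\<tau> n = 2 powr (real_of_int \<lfloor>L\<rfloor> - 1)" by (simp add: \<tau>_def n_def)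
        have "2 * \<tau> n = 2 powr (real_of_int \<lfloor>L\<rfloor>)" by (simp add: \<tau>n powr_diff)
        also have "\<dots> \<le> 2 powr L" by (intro powr_mono) auto
        finally have lo: "2 * \<tau> n \<le> \<bar>u \<zeta>\<bar>" by (simp add: uL)
        have "2 powr L \<le> 2 powr (real_of_int \<lfloor>L\<rfloor> + 1)" by (intro powr_mono) linarith+
        also have "\<dots> = 4 * \<tau> n" by (simp add: \<tau>n powr_diff powr_add)
        finally have "\<bar>u \<zeta>\<bar> powr q \<le> (4 * \<tau> n) powr q"
          using p pq unfolding uL by (intro powr_mono2) auto
        also have "\<dots> = 4 powr q * \<tau> n powr q" using \<tau>[of n] by (simp add: powr_mult)
        finally have "wt \<alpha> \<beta> \<zeta> * \<bar>u \<zeta>\<bar> powr q \<le> (4 powr q * \<tau> n powr q) * wt \<alpha> \<beta> \<zeta>"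
          by (metis mult.commute mult_left_mono wt_nonneg)
        then have "ennreal (wt \<alpha> \<beta> \<zeta> * \<bar>u \<zeta>\<bar> powr q)
          \<le> (\<Sum>n\<in>{n}. ennreal (4 powr q * \<tau> n powr q) * (ennreal (wt \<alpha> \<beta> \<zeta>) * indicator {\<zeta>. 2 * \<tau> n \<le> \<bar>u \<zeta>\<bar>} \<zeta>))"
          using lo by (simp add: ennreal_leI flip: ennreal_mult')
        also have "\<dots> \<le> (\<Sum>n. ennreal (4 powr q * \<tau> n powr q) * (ennreal (wt \<alpha> \<beta> \<zeta>) * indicator {\<zeta>. 2 * \<tau> n \<le> \<bar>u \<zeta>\<bar>} \<zeta>))"
          by (rule sum_le_suminf) auto
        finally show ?thesis .
      qed simp
    qed
    also have "\<dots> = (\<Sum>n. ennreal (4 powr q * \<tau> n powr q) * (\<integral>\<^sup>+\<zeta>. ennreal (wt \<alpha> \<beta> \<zeta>) * indicator {\<zeta>. 2 * \<tau> n \<le> \<bar>u \<zeta>\<bar>} \<zeta> \<partial>lborel))"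
      by (subst nn_integral_suminf) (auto simp: nn_integral_cmult)
    also have "\<dots> \<le> (\<Sum>n. ?k * (\<integral>\<^sup>+\<zeta>. layer_energy u (\<tau> n) \<zeta> \<partial>lborel))"
    proof (intro suminf_le summableI)
      fix n
      have "ennreal (4 powr q * \<tau> n powr q) * (\<integral>\<^sup>+\<zeta>. ennreal (wt \<alpha> \<beta> \<zeta>) * indicator {\<zeta>. 2 * \<tau> n \<le> \<bar>u \<zeta>\<bar>} \<zeta> \<partial>lborel)
        \<le> ennreal (4 powr q * \<tau> n powr q) * (ennreal (C * M powr (q / p - 1) * \<tau> n powr (- q)) * (\<integral>\<^sup>+\<zeta>. layer_energy u (\<tau> n) \<zeta> \<partial>lborel))"
        by (intro mult_left_mono weak u \<tau> M En) simp
      also have "\<dots> = ennreal ((4 powr q * \<tau> n powr q) * (C * M powr (q / p - 1) * \<tau> n powr (- q))) * (\<integral>\<^sup>+\<zeta>. layer_energy u (\<tau> n) \<zeta> \<partial>lborel)"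
        using C by (simp add: ennreal_mult' mult.assoc)
      also have "(4 powr q * \<tau> n powr q) * (C * M powr (q / p - 1) * \<tau> n powr (- q)) = 4 powr q * C * M powr (q / p - 1)"
        using \<tau>[of n] by (simp add: powr_minus)
      finally show "ennreal (4 powr q * \<tau> n powr q) * (\<integral>\<^sup>+\<zeta>. ennreal (wt \<alpha> \<beta> \<zeta>) * indicator {\<zeta>. 2 * \<tau> n \<le> \<bar>u \<zeta>\<bar>} \<zeta> \<partial>lborel)
        \<le> ?k * (\<integral>\<^sup>+\<zeta>. layer_energy u (\<tau> n) \<zeta> \<partial>lborel)" .
    qed
    also have "\<dots> = ?k * (\<integral>\<^sup>+\<zeta>. (\<Sum>n. layer_energy u (\<tau> n) \<zeta>) \<partial>lborel)"
      by (subst nn_integral_suminf) (auto simp: ennreal_suminf_cmult)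
    also have "\<dots> \<le> ?k * (\<integral>\<^sup>+\<zeta>. ennreal (wt a (- b) \<zeta> * norm (grad u \<zeta>) powr p) \<partial>lborel)"
      unfolding layer_energy_def
      by (intro mult_left_mono nn_integral_mono)
        (auto simp: ennreal_suminf_cmult suminf_indicator[OF disj] split: split_indicator)
    also have "\<dots> \<le> ?k * ennreal M" by (intro mult_left_mono E) simp
    also have "\<dots> = ennreal (4 powr q * C * M powr (q / p))"
      using C M by (simp add: powr_diff flip: ennreal_mult')
    finally show ?thesis .
  qed
  \<comment> \<open>Adding 1 makes the constant positive; a negative power of it is formed
    later.\<close>
  have le: "ennreal (4 powr q * C * M powr (q / p)) \<le> ennreal ((4 powr q * C + 1) * M powr (q / p))" for M
    by (intro ennreal_leI mult_right_mono) auto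
  have "(\<integral>\<^sup>+\<zeta>. ennreal (wt \<alpha> \<beta> \<zeta> * \<bar>u \<zeta>\<bar> powr q) \<partial>lborel) \<le> ennreal ((4 powr q * C + 1) * M powr (q / p))"
    if "u \<in> test_funs" "M > 0"
      "(\<integral>\<^sup>+\<zeta>. ennreal (wt a (- b) \<zeta> * norm (grad u \<zeta>) powr p) \<partial>lborel) \<le> ennreal M"
    for u :: "'x \<times> 'y \<Rightarrow> real" and M
    using order_trans[OF main[OF that] le] .
  moreover have "4 powr q * C + 1 > 0" using C by (simp add: add_nonneg_pos)
  ultimately show ?thesis by blast
qed

end

section \<open>Passing to the completion\<close>

text \<open>Convexity of the p-th power, applied to the combination of x / (1 - s) and y / s with
  weights 1 - s and s. The free parameter matters: as s tends to 0 the factor of x^p tends to 1, so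
  that approximating an energy costs nothing in the limit.\<close>

lemma powr_add_le:
  fixes x y s p :: real
  assumes "x \<ge> 0" "y \<ge> 0" "0 < s" "s < 1" "p \<ge> 1"
  shows "(x + y) powr p \<le> (1 - s) powr (1 - p) * x powr p + s powr (1 - p) * y powr p"
proof -
  have ge1: "r powr (1 - p) \<ge> 1" if "0 < r" "r \<le> 1" for r :: real
    using powr_mono2'[of "1 - p" r 1] that assms by simp
  show ?thesis
  proof (cases "x = 0 \<or> y = 0")
    case True
    then show ?thesis
    proof
      assume "x = 0"
      then show ?thesis using mult_right_mono[OF ge1[of s], of "y powr p"] assms by simp
    next
      assume "y = 0"
      then show ?thesis using mult_right_mono[OF ge1[of "1 - s"], of "x powr p"] assms by simp
    qed
  next
    case False
    then have xy: "x > 0" "y > 0" using assms by auto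
    have "((1 - s) *\<^sub>R (x / (1 - s)) + s *\<^sub>R (y / s)) powr p
        \<le> (1 - s) * (x / (1 - s)) powr p + s * (y / s) powr p"
      using assms xy by (intro convex_onD[OF powr_convex]) auto
    also have "(1 - s) *\<^sub>R (x / (1 - s)) + s *\<^sub>R (y / s) = x + y" using assms by simp
    also have "(1 - s) * (x / (1 - s)) powr p = (1 - s) powr (1 - p) * x powr p"
      using assms xy by (simp add: powr_divide powr_diff)
    also have "s * (y / s) powr p = s powr (1 - p) * y powr p"
      using assms xy by (simp add: powr_divide powr_diff)
    finally show ?thesis .
  qed
qed

lemma nn_integral_powr_add_le:
  fixes w :: "'a::euclidean_space \<Rightarrow> real" and F G :: "'a \<Rightarrow> 'b::euclidean_space"
  assumes [measurable]: "w \<in> borel_measurable borel" "F \<in> borel_measurable borel" "G \<in> borel_measurable borel"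
    and w: "\<And>z. w z \<ge> 0" and s: "0 < s" "s < 1" and p: "p \<ge> 1"
  shows "(\<integral>\<^sup>+z. ennreal (w z * norm (F z) powr p) \<partial>lborel)
    \<le> ennreal ((1 - s) powr (1 - p)) * (\<integral>\<^sup>+z. ennreal (w z * norm (G z) powr p) \<partial>lborel)
      + ennreal (s powr (1 - p)) * (\<integral>\<^sup>+z. ennreal (w z * norm (F z - G z) powr p) \<partial>lborel)"
proof -
  have "(\<integral>\<^sup>+z. ennreal (w z * norm (F z) powr p) \<partial>lborel)
    \<le> (\<integral>\<^sup>+z. ennreal ((1 - s) powr (1 - p)) * ennreal (w z * norm (G z) powr p)
      + ennreal (s powr (1 - p)) * ennreal (w z * norm (F z - G z) powr p) \<partial>lborel)"
  proof (rule nn_integral_mono)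
    fix z
    have "norm (F z) powr p \<le> (norm (G z) + norm (F z - G z)) powr p"
      using p by (intro powr_mono2 norm_triangle_sub) auto
    also have "\<dots> \<le> (1 - s) powr (1 - p) * norm (G z) powr p + s powr (1 - p) * norm (F z - G z) powr p"
      using s p by (intro powr_add_le) auto
    finally have "w z * norm (F z) powr p \<le> w z * ((1 - s) powr (1 - p) * norm (G z) powr p + s powr (1 - p) * norm (F z - G z) powr p)"
      using w by (intro mult_left_mono) auto
    also have "\<dots> = (1 - s) powr (1 - p) * (w z * norm (G z) powr p) + s powr (1 - p) * (w z * norm (F z - G z) powr p)"
      by (simp add: algebra_simps)
    finally show "ennreal (w z * norm (F z) powr p) \<le> ennreal ((1 - s) powr (1 - p)) * ennreal (w z * norm (G z) powr p)
      + ennreal (s powr (1 - p)) * ennreal (w z * norm (F z - G z) powr p)"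
      using w by (simp add: ennreal_leI flip: ennreal_mult' ennreal_plus)
  qed
  also have "\<dots> = ennreal ((1 - s) powr (1 - p)) * (\<integral>\<^sup>+z. ennreal (w z * norm (G z) powr p) \<partial>lborel)
      + ennreal (s powr (1 - p)) * (\<integral>\<^sup>+z. ennreal (w z * norm (F z - G z) powr p) \<partial>lborel)"
    by (subst nn_integral_add) (auto simp: nn_integral_cmult)
  finally show ?thesis .
qed

text \<open>Along a subsequence the integrals are below 2^(-n), so the sum of the functions has
  finite integral and is finite almost everywhere; its terms then tend to 0.\<close>

lemma AE_subseq_of_nn_integral_tendsto_0:
  fixes f :: "nat \<Rightarrow> 'a \<Rightarrow> real"
  assumes [measurable]: "\<And>n. f n \<in> borel_measurable M" and nonneg: "\<And>n x. f n x \<ge> 0"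
    and lim: "(\<lambda>n. \<integral>\<^sup>+x. ennreal (f n x) \<partial>M) \<longlonglongrightarrow> 0"
  obtains r :: "nat \<Rightarrow> nat" where "strict_mono r" "AE x in M. (\<lambda>n. f (r n) x) \<longlonglongrightarrow> 0"
proof -
  have ex: "\<exists>N. \<forall>k\<ge>N. (\<integral>\<^sup>+x. ennreal (f k x) \<partial>M) < ennreal ((1/2) ^ n)" for n :: nat
    using order_tendstoD(2)[OF lim, of "ennreal ((1/2) ^ n)"] by (simp add: eventually_sequentially)
  then obtain N where N: "\<And>n k. k \<ge> N n \<Longrightarrow> (\<integral>\<^sup>+x. ennreal (f k x) \<partial>M) < ennreal ((1/2) ^ n)"
    by metis
  define r where "r = rec_nat (N 0) (\<lambda>n m. max (N (Suc n)) (Suc m))"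
  have r: "r n < r (Suc n)" for n by (simp add: r_def)
  have rN: "r n \<ge> N n" for n by (cases n) (simp_all add: r_def)
  have "(\<integral>\<^sup>+x. (\<Sum>n. ennreal (f (r n) x)) \<partial>M) = (\<Sum>n. \<integral>\<^sup>+x. ennreal (f (r n) x) \<partial>M)"
    by (rule nn_integral_suminf) measurable
  also have "\<dots> \<le> (\<Sum>n. ennreal ((1/2) ^ n))"
    using N[OF rN] by (intro suminf_le summableI) (auto intro: less_imp_le)
  also have "\<dots> = ennreal (\<Sum>n. (1/2) ^ n)"
    by (intro suminf_ennreal2 summable_geometric) auto
  finally have "(\<integral>\<^sup>+x. (\<Sum>n. ennreal (f (r n) x)) \<partial>M) \<noteq> \<infinity>" by (auto simp: top_unique)
  then have "AE x in M. (\<Sum>n. ennreal (f (r n) x)) \<noteq> \<infinity>"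
    by (intro nn_integral_PInf_AE) measurable
  then have "AE x in M. (\<lambda>n. f (r n) x) \<longlonglongrightarrow> 0"
  proof eventually_elim
    case (elim x)
    then have "summable (\<lambda>n. f (r n) x)" using nonneg by (intro summable_suminf_not_top) auto
    then show ?case by (rule summable_LIMSEQ_zero)
  qed
  moreover have "strict_mono r" using r by (simp add: strict_mono_Suc_iff)
  ultimately show thesis using that by blast
qed

text \<open>The energies of the approximating test functions are eventually below every M > M0 but
  may exceed M0, hence the strict inequality. Convergence with the weight \<open>h\<close>, positive
  almost everywhere, gives a subsequence that converges almost everywhere, and Fatou's lemma
  transfers the bound. \<open>K\<close> is an arbitrary function: letting M tend to M0 is left to
  the application.\<close>

lemma D1p_inequality:
  fixes w h v :: "'a::euclidean_space \<Rightarrow> real"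
  assumes p: "p > 1" and q: "q > 0"
    and [measurable]: "w \<in> borel_measurable borel" "h \<in> borel_measurable borel" "v \<in> borel_measurable borel"
    and nonneg: "\<And>z. w z \<ge> 0" "\<And>z. h z \<ge> 0" "\<And>z. v z \<ge> 0"
    and h: "AE z in lborel. h z > 0"
    and fin: "\<And>\<phi>. \<phi> \<in> test_funs \<Longrightarrow> (\<integral>\<^sup>+z. ennreal (w z * norm (grad \<phi> z) powr p) \<partial>lborel) < \<infinity>"
    and ineq: "\<And>\<phi> M. \<phi> \<in> test_funs \<Longrightarrow> M > 0 \<Longrightarrow>
      (\<integral>\<^sup>+z. ennreal (w z * norm (grad \<phi> z) powr p) \<partial>lborel) \<le> ennreal M \<Longrightarrow>
      (\<integral>\<^sup>+z. ennreal (v z * \<bar>\<phi> z\<bar> powr q) \<partial>lborel) \<le> ennreal (K M)"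
    and D: "D1p w h p u G"
  obtains M0 where "M0 \<ge> 0" "(\<integral>\<^sup>+z. ennreal (w z * norm (G z) powr p) \<partial>lborel) = ennreal M0"
    "\<And>M. M > M0 \<Longrightarrow> (\<integral>\<^sup>+z. ennreal (v z * \<bar>u z\<bar> powr q) \<partial>lborel) \<le> ennreal (K M)"
proof -
  from D obtain \<phi> where [measurable]: "u \<in> borel_measurable borel" "G \<in> borel_measurable borel"
    and \<phi>: "\<And>n. \<phi> n \<in> test_funs"
    and limG: "(\<lambda>n. \<integral>\<^sup>+z. ennreal (w z * norm (grad (\<phi> n) z - G z) powr p) \<partial>lborel) \<longlonglongrightarrow> 0"
    and limu: "(\<lambda>n. \<integral>\<^sup>+z. ennreal (h z * \<bar>\<phi> n z - u z\<bar> powr p) \<partial>lborel) \<longlonglongrightarrow> 0"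
    unfolding D1p_def by blast
  have [measurable]: "\<phi> n \<in> borel_measurable borel" "grad (\<phi> n) \<in> borel_measurable borel" for n
    using test_fun_measurable[OF \<phi>] by blast+
  let ?N = "\<lambda>n. \<integral>\<^sup>+z. ennreal (w z * norm (grad (\<phi> n) z - G z) powr p) \<partial>lborel"
  let ?G = "\<integral>\<^sup>+z. ennreal (w z * norm (G z) powr p) \<partial>lborel"
  have "?G < \<infinity>"
  proof -
    obtain n where n: "?N n < 1"
      using order_tendstoD(2)[OF limG, of 1] by (auto simp: eventually_sequentially)
    have sym: "(\<integral>\<^sup>+z. ennreal (w z * norm (G z - grad (\<phi> n) z) powr p) \<partial>lborel) = ?N n"
      by (simp add: norm_minus_commute)
    have "?G \<le> ennreal ((1 - 1/2) powr (1 - p)) * (\<integral>\<^sup>+z. ennreal (w z * norm (grad (\<phi> n) z) powr p) \<partial>lborel)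
      + ennreal ((1/2) powr (1 - p)) * (\<integral>\<^sup>+z. ennreal (w z * norm (G z - grad (\<phi> n) z) powr p) \<partial>lborel)"
      using nonneg p by (intro nn_integral_powr_add_le) auto
    also have "\<dots> < \<infinity>"
      using fin[OF \<phi>[of n]] n unfolding sym by (auto simp: ennreal_mult_less_top less_top intro: order.strict_trans)
    finally show ?thesis .
  qed
  then obtain M0 where M0: "M0 \<ge> 0" "?G = ennreal M0" by (cases ?G) auto
  obtain r :: "nat \<Rightarrow> nat" where r: "strict_mono r"
    "AE z in lborel. (\<lambda>n. h z * \<bar>\<phi> (r n) z - u z\<bar> powr p) \<longlonglongrightarrow> 0"
  proof (rule AE_subseq_of_nn_integral_tendsto_0[OF _ _ limu])
    show "(\<lambda>z. h z * \<bar>\<phi> n z - u z\<bar> powr p) \<in> borel_measurable lborel" for n by measurable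
    show "h z * \<bar>\<phi> n z - u z\<bar> powr p \<ge> 0" for n z using nonneg by simp
  qed (rule that)
  have AEv: "AE z in lborel. (\<lambda>n. ennreal (v z * \<bar>\<phi> (r n) z\<bar> powr q)) \<longlonglongrightarrow> ennreal (v z * \<bar>u z\<bar> powr q)"
    using r(2) h
  proof eventually_elim
    case (elim z)
    have "(\<lambda>n. inverse (h z) * (h z * \<bar>\<phi> (r n) z - u z\<bar> powr p)) \<longlonglongrightarrow> inverse (h z) * 0"
      by (intro tendsto_mult tendsto_const elim)
    then have "(\<lambda>n. \<bar>\<phi> (r n) z - u z\<bar> powr p) \<longlonglongrightarrow> 0" using elim(2) by simp
    then have "(\<lambda>n. (\<bar>\<phi> (r n) z - u z\<bar> powr p) powr (1 / p)) \<longlonglongrightarrow> 0 powr (1 / p)"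
      using p by (intro tendsto_powr2 tendsto_const) auto
    then have "(\<lambda>n. \<bar>\<phi> (r n) z - u z\<bar>) \<longlonglongrightarrow> 0" using p by (simp add: powr_powr)
    then have "(\<lambda>n. \<phi> (r n) z) \<longlonglongrightarrow> u z"
      using LIM_zero_cancel tendsto_rabs_zero_iff by blast
    then have "(\<lambda>n. v z * \<bar>\<phi> (r n) z\<bar> powr q) \<longlonglongrightarrow> v z * \<bar>u z\<bar> powr q"
      using q by (intro tendsto_mult tendsto_const tendsto_powr2 tendsto_rabs) auto
    then show ?case by (rule tendsto_ennrealI)
  qed
  have bound: "(\<integral>\<^sup>+z. ennreal (v z * \<bar>u z\<bar> powr q) \<partial>lborel) \<le> ennreal (K M)" if M: "M > M0" for M
  proof -
    have "((\<lambda>s. (1 - s) powr (1 - p) * M0) \<longlongrightarrow> (1 - 0) powr (1 - p) * M0) (at_right 0)"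
      by (intro tendsto_intros) auto
    then have "\<forall>\<^sub>F s in at_right 0. (1 - s) powr (1 - p) * M0 < M"
      using M by (intro order_tendstoD(2)) auto
    moreover have "\<forall>\<^sub>F s in at_right (0::real). 0 < s \<and> s < 1"
      unfolding eventually_at_right_field by (intro exI[of _ 1]) auto
    ultimately obtain s where s: "(1 - s) powr (1 - p) * M0 < M" "0 < s" "s < 1"
      using eventually_happens'[OF _ eventually_conj] by (metis (mono_tags, lifting) trivial_limit_at_right_real)
    \<comment> \<open>What \<open>(1 - s) powr (1 - p) * M0\<close> leaves of \<open>M\<close>,
      divided by the factor with which the approximation error enters.\<close>
    define \<delta> where "\<delta> = (M - (1 - s) powr (1 - p) * M0) / s powr (1 - p)"
    have \<delta>: "\<delta> > 0" using s by (simp add: \<delta>_def)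
    have ev: "\<forall>\<^sub>F n in sequentially. ?N n < ennreal \<delta>"
      using order_tendstoD(2)[OF limG, of "ennreal \<delta>"] \<delta> by simp
    have ev2: "\<forall>\<^sub>F n in sequentially. (\<integral>\<^sup>+z. ennreal (v z * \<bar>\<phi> (r n) z\<bar> powr q) \<partial>lborel) \<le> ennreal (K M)"
    proof -
      have "\<forall>\<^sub>F n in sequentially. ?N (r n) < ennreal \<delta>"
        using ev r(1) by (rule eventually_subseq[rotated])
      then show ?thesis
      proof eventually_elim
        case (elim n)
        have "(\<integral>\<^sup>+z. ennreal (w z * norm (grad (\<phi> (r n)) z) powr p) \<partial>lborel)
          \<le> ennreal ((1 - s) powr (1 - p)) * ?G + ennreal (s powr (1 - p)) * ?N (r n)"
          using nonneg p s by (intro nn_integral_powr_add_le) auto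
        also have "\<dots> \<le> ennreal ((1 - s) powr (1 - p)) * ennreal M0 + ennreal (s powr (1 - p)) * ennreal \<delta>"
          using elim M0 by (intro add_mono mult_left_mono) auto
        also have "\<dots> = ennreal ((1 - s) powr (1 - p) * M0 + s powr (1 - p) * \<delta>)"
          using M0 \<delta> by (simp add: ennreal_mult')
        also have "(1 - s) powr (1 - p) * M0 + s powr (1 - p) * \<delta> = M" using s by (simp add: \<delta>_def)
        finally show ?case using M M0 by (intro ineq \<phi>) auto
      qed
    qed
    have "(\<integral>\<^sup>+z. ennreal (v z * \<bar>u z\<bar> powr q) \<partial>lborel)
      = (\<integral>\<^sup>+z. liminf (\<lambda>n. ennreal (v z * \<bar>\<phi> (r n) z\<bar> powr q)) \<partial>lborel)"
      using AEv by (intro nn_integral_cong_AE) (auto dest!: lim_imp_Liminf[rotated])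
    also have "\<dots> \<le> liminf (\<lambda>n. \<integral>\<^sup>+z. ennreal (v z * \<bar>\<phi> (r n) z\<bar> powr q) \<partial>lborel)"
      by (rule nn_integral_liminf) measurable
    also have "\<dots> \<le> liminf (\<lambda>n::nat. ennreal (K M))" using ev2 by (rule Liminf_mono)
    also have "\<dots> = ennreal (K M)" by (simp add: Liminf_const)
    finally show ?thesis .
  qed
  show thesis using that[OF M0 bound] .
qed

text \<open>The mass of u is finite, so that the quotient is not read as 0, and it is nonzero
  because \<open>v\<close> > 0 almost everywhere. The bound holds for all M above the energy, and
  therefore for the energy itself.\<close>

lemma best_const_geI:
  fixes w h v :: "'a::euclidean_space \<Rightarrow> real"
  assumes p: "p > 1" and q: "q > 0" and c: "c > 0"
    and [measurable]: "w \<in> borel_measurable borel" "h \<in> borel_measurable borel" "v \<in> borel_measurable borel"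
    and nonneg: "\<And>z. w z \<ge> 0" "\<And>z. h z \<ge> 0" "\<And>z. v z \<ge> 0"
    and pos: "AE z in lborel. h z > 0" "AE z in lborel. v z > 0"
    and fin: "\<And>\<phi>. \<phi> \<in> test_funs \<Longrightarrow> (\<integral>\<^sup>+z. ennreal (w z * norm (grad \<phi> z) powr p) \<partial>lborel) < \<infinity>"
    and ineq: "\<And>\<phi> M. \<phi> \<in> test_funs \<Longrightarrow> M > 0 \<Longrightarrow>
      (\<integral>\<^sup>+z. ennreal (w z * norm (grad \<phi> z) powr p) \<partial>lborel) \<le> ennreal M \<Longrightarrow>
      (\<integral>\<^sup>+z. ennreal (v z * \<bar>\<phi> z\<bar> powr q) \<partial>lborel) \<le> ennreal ((M / c) powr (q / p))"
  shows "ennreal c \<le> best_const w h v p q"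
  unfolding best_const_def
proof (rule INF_greatest, clarify)
  fix u G assume D: "D1p w h p u G" and nz: "\<not> (AE z in lborel. u z = 0)"
  obtain M0 where M0: "M0 \<ge> 0" "(\<integral>\<^sup>+z. ennreal (w z * norm (G z) powr p) \<partial>lborel) = ennreal M0"
    "\<And>M. M > M0 \<Longrightarrow> (\<integral>\<^sup>+z. ennreal (v z * \<bar>u z\<bar> powr q) \<partial>lborel) \<le> ennreal ((M / c) powr (q / p))"
    by (rule D1p_inequality[where K = "\<lambda>M. (M / c) powr (q / p)", OF p q assms(4-6) nonneg pos(1) fin ineq D]) (assumption | rule that)+
  let ?J = "\<integral>\<^sup>+z. ennreal (v z * \<bar>u z\<bar> powr q) \<partial>lborel"
  have "?J < \<infinity>" using M0(3)[of "M0 + 1"] by (auto simp: less_top intro: le_less_trans)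
  then obtain J where J: "J \<ge> 0" "?J = ennreal J" by (cases ?J) auto
  have [measurable]: "u \<in> borel_measurable borel" using D by (simp add: D1p_def)
  have "J \<noteq> 0"
  proof
    assume "J = 0"
    then have "?J = 0" using J by simp
    then have "AE z in lborel. ennreal (v z * \<bar>u z\<bar> powr q) = 0"
      by (subst (asm) nn_integral_0_iff_AE) auto
    then have "AE z in lborel. u z = 0"
      using pos(2) by eventually_elim (use nonneg in \<open>auto simp: ennreal_eq_0_iff mult_le_0_iff not_le\<close>)
    with nz show False by blast
  qed
  with J have J0: "J > 0" by simp
  have le: "c * J powr (p / q) \<le> M" if M: "M > M0" for M
  proof -
    have "J \<le> (M / c) powr (q / p)" using M0(3)[OF M] unfolding J(2) by simp
    then have "J powr (p / q) \<le> ((M / c) powr (q / p)) powr (p / q)"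
      using J p q by (intro powr_mono2) auto
    also have "\<dots> = M / c" using p q c M M0(1) by (simp add: powr_powr)
    finally show ?thesis using c by (simp add: field_simps)
  qed
  then have "c * J powr (p / q) \<le> M0" by (rule dense_ge)
  then have "c \<le> M0 / J powr (p / q)" using J0 by (simp add: pos_le_divide_eq)
  then have "ennreal c \<le> ennreal (M0 / J powr (p / q))" by (rule ennreal_leI)
  also have "\<dots> = ennreal M0 / ennreal_pow ?J (p / q)"
    using J0 M0(1) J by (simp add: ennreal_pow_def divide_ennreal)
  finally show "ennreal c \<le> (\<integral>\<^sup>+z. ennreal (w z * norm (G z) powr p) \<partial>lborel) / ennreal_pow ?J (p / q)"
    unfolding M0(2) .
qed

section \<open>Rescaled test functions\<close>

lemma D1p_test_fun:
  assumes "\<phi> \<in> test_funs" "p > 0"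
  shows "D1p w h p \<phi> (grad \<phi>)"
  unfolding D1p_def using assms test_fun_measurable[OF assms(1)]
  by (intro conjI exI[of _ "\<lambda>_. \<phi>"]) auto

lemma test_fun_not_AE_0:
  fixes \<phi> :: "'a::euclidean_space \<Rightarrow> real"
  assumes \<phi>: "\<phi> \<in> test_funs" and z: "\<phi> z1 \<noteq> 0"
  shows "\<not> (AE z in lborel. \<phi> z = 0)"
proof
  assume AE: "AE z in lborel. \<phi> z = 0"
  have op: "open {z. \<phi> z \<noteq> 0}"
    using test_fun_continuous(1)[OF \<phi>] by (intro open_Collect_neq continuous_intros)
  then obtain r where r: "r > 0" "ball z1 r \<subseteq> {z. \<phi> z \<noteq> 0}"
    using z open_contains_ball by (metis (mono_tags, lifting) mem_Collect_eq)
  have "AE z in lborel. z \<notin> ball z1 r" using AE by eventually_elim (use r in auto)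
  then have "emeasure lborel {z \<in> space lborel. z \<in> ball z1 r} = 0" by (rule emeasure_eq_0_AE)
  then have "emeasure lborel (ball z1 r) = 0" by (simp add: ball_def)
  then show False using r(1) by (simp add: emeasure_ball unit_ball_vol_pos less_imp_neq[THEN not_sym])
qed

lemma best_const_le_quotient:
  fixes \<phi> :: "'a::euclidean_space \<Rightarrow> real"
  assumes "\<phi> \<in> test_funs" "\<phi> z1 \<noteq> 0" "p > 0"
  shows "best_const w h v p q \<le> (\<integral>\<^sup>+z. ennreal (w z * norm (grad \<phi> z) powr p) \<partial>lborel) /
        ennreal_pow (\<integral>\<^sup>+z. ennreal (v z * \<bar>\<phi> z\<bar> powr q) \<partial>lborel) (p / q)"
  unfolding best_const_def
  by (rule INF_lower2[of "(\<phi>, grad \<phi>)"]) (use D1p_test_fun[OF assms(1,3)] test_fun_not_AE_0[OF assms(1,2)] in auto)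

lemma nn_integral_bounded_support:
  fixes f :: "'a::euclidean_space \<Rightarrow> real"
  assumes "\<And>z. norm (f z) \<le> K" "\<And>z. norm z \<ge> R \<Longrightarrow> f z = 0"
  shows "(\<integral>\<^sup>+z. ennreal (f z) \<partial>lborel) < \<infinity>"
proof -
  have "(\<integral>\<^sup>+z. ennreal (f z) \<partial>lborel) \<le> (\<integral>\<^sup>+z. ennreal K * indicator (cball (0::'a) R) z \<partial>lborel)"
  proof (rule nn_integral_mono)
    fix z :: 'a
    have "f z \<le> K" using assms(1)[of z] by simp
    then show "ennreal (f z) \<le> ennreal K * indicator (cball 0 R) z"
      using assms(2)[of z] by (cases "norm z \<le> R") (auto intro: ennreal_leI)
  qed
  also have "\<dots> = ennreal K * emeasure lborel (cball (0::'a) R)"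
    by (subst nn_integral_cmult_indicator) auto
  also have "\<dots> < \<infinity>" by (simp add: ennreal_mult_less_top emeasure_lborel_cball_finite[unfolded infinity_ennreal_def])
  finally show ?thesis .
qed

lemma test_fun_energy:
  fixes \<phi> :: "'a::euclidean_space \<Rightarrow> real"
  assumes \<phi>: "\<phi> \<in> test_funs" and p: "p > 0"
  obtains I where "I \<ge> 0" "(\<integral>\<^sup>+z. ennreal (norm (grad \<phi> z) powr p) \<partial>lborel) = ennreal I"
proof -
  obtain R where R: "R > 0" "\<And>z. norm z \<ge> R \<Longrightarrow> \<phi> z = 0" "\<And>z. norm z \<ge> R \<Longrightarrow> grad \<phi> z = 0"
    using test_fun_support[OF \<phi>] by blast
  obtain K where K: "K > 0" "\<And>z. \<bar>\<phi> z\<bar> \<le> K" "\<And>z. norm (grad \<phi> z) \<le> K"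
    using test_fun_bounded[OF \<phi>] by blast
  have "(\<integral>\<^sup>+z. ennreal (norm (grad \<phi> z) powr p) \<partial>lborel) < \<infinity>"
    using K R p by (intro nn_integral_bounded_support[where K = "K powr p" and R = R]) (auto intro: powr_mono2)
  then show thesis using that by (cases "\<integral>\<^sup>+z. ennreal (norm (grad \<phi> z) powr p) \<partial>lborel") auto
qed

lemma test_fun_mass:
  fixes \<phi> :: "'a::euclidean_space \<Rightarrow> real"
  assumes \<phi>: "\<phi> \<in> test_funs" and z: "\<phi> z1 \<noteq> 0" and q: "q > 0"
  obtains J where "J > 0" "(\<integral>\<^sup>+z. ennreal (\<bar>\<phi> z\<bar> powr q) \<partial>lborel) = ennreal J"
proof -
  note [measurable] = test_fun_measurable[OF \<phi>]
  obtain R where R: "R > 0" "\<And>z. norm z \<ge> R \<Longrightarrow> \<phi> z = 0" "\<And>z. norm z \<ge> R \<Longrightarrow> grad \<phi> z = 0"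
    using test_fun_support[OF \<phi>] by blast
  obtain K where K: "K > 0" "\<And>z. \<bar>\<phi> z\<bar> \<le> K" "\<And>z. norm (grad \<phi> z) \<le> K"
    using test_fun_bounded[OF \<phi>] by blast
  let ?J = "\<integral>\<^sup>+z. ennreal (\<bar>\<phi> z\<bar> powr q) \<partial>lborel"
  have "?J < \<infinity>"
    using K R q by (intro nn_integral_bounded_support[where K = "K powr q" and R = R]) (auto intro: powr_mono2)
  then obtain J where J: "J \<ge> 0" "?J = ennreal J" by (cases ?J) auto
  have "J \<noteq> 0"
  proof
    assume "J = 0"
    then have "?J = 0" using J by simp
    then have "AE z in lborel. ennreal (\<bar>\<phi> z\<bar> powr q) = 0"
      by (subst (asm) nn_integral_0_iff_AE) auto
    then have "AE z in lborel. \<phi> z = 0" by eventually_elim (auto simp: ennreal_eq_0_iff)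
    with test_fun_not_AE_0[OF \<phi> z] show False by blast
  qed
  with J that show thesis by simp
qed

lemma wt_energy_finite:
  fixes \<phi> :: "'x::euclidean_space \<times> 'y::euclidean_space \<Rightarrow> real"
  assumes \<phi>: "\<phi> \<in> test_funs" and p: "p > 0"
    and "real DIM('y) + \<alpha> > 0" "real DIM('x \<times> 'y) + \<alpha> + \<beta> > 0"
  shows "(\<integral>\<^sup>+z. ennreal (wt \<alpha> \<beta> z * norm (grad \<phi> z) powr p) \<partial>lborel) < \<infinity>"
proof -
  obtain R where R: "R > 0" "\<And>z. norm z \<ge> R \<Longrightarrow> \<phi> z = 0" "\<And>z. norm z \<ge> R \<Longrightarrow> grad \<phi> z = 0"
    using test_fun_support[OF \<phi>] by blast
  obtain K where K: "K > 0" "\<And>z. \<bar>\<phi> z\<bar> \<le> K" "\<And>z. norm (grad \<phi> z) \<le> K"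
    using test_fun_bounded[OF \<phi>] by blast
  obtain C where C: "C \<ge> 0" "\<forall>r>0. (\<integral>\<^sup>+z. ennreal (wt \<alpha> \<beta> (z::'x \<times> 'y)) * indicator {z. norm z < r} z \<partial>lborel)
           \<le> ennreal (C * r powr (real DIM('x \<times> 'y) + \<alpha> + \<beta>))"
    using nn_integral_wt_ball_0[OF assms(3,4)] by blast
  have "(\<integral>\<^sup>+z. ennreal (wt \<alpha> \<beta> z * norm (grad \<phi> z) powr p) \<partial>lborel)
    \<le> (\<integral>\<^sup>+z. ennreal (K powr p) * (ennreal (wt \<alpha> \<beta> (z::'x \<times> 'y)) * indicator {z. norm z < R} z) \<partial>lborel)"
  proof (rule nn_integral_mono)
    fix z :: "'x \<times> 'y"
    show "ennreal (wt \<alpha> \<beta> z * norm (grad \<phi> z) powr p) \<le> ennreal (K powr p) * (ennreal (wt \<alpha> \<beta> z) * indicator {z. norm z < R} z)"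
    proof (cases "norm z < R")
      case True
      have "norm (grad \<phi> z) powr p \<le> K powr p" using K p by (intro powr_mono2) auto
      then have "wt \<alpha> \<beta> z * norm (grad \<phi> z) powr p \<le> K powr p * wt \<alpha> \<beta> z"
        by (metis mult.commute mult_left_mono wt_nonneg)
      then show ?thesis using True by (simp add: ennreal_leI flip: ennreal_mult')
    next
      case False
      then show ?thesis using R(3)[of z] p by simp
    qed
  qed
  also have "\<dots> = ennreal (K powr p) * (\<integral>\<^sup>+z. ennreal (wt \<alpha> \<beta> (z::'x \<times> 'y)) * indicator {z. norm z < R} z \<partial>lborel)"
    by (rule nn_integral_cmult) measurable
  also have "\<dots> \<le> ennreal (K powr p) * ennreal (C * R powr (real DIM('x \<times> 'y) + \<alpha> + \<beta>))"
    using C(2) R(1) by (intro mult_left_mono) auto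
  also have "\<dots> < \<infinity>" by (simp add: ennreal_mult_less_top)
  finally show ?thesis .
qed

text \<open>Tested with \<phi>((z - ctr) / \<epsilon>): the substitution gives \<epsilon>^d in both
  integrals and the gradient \<epsilon>^(-p), while on the rescaled support the weights are replaced
  by the constants \<open>A\<close> from above and \<open>B\<close> from below. Both vanishing
  results and the comparison with the Sobolev constant use it, with different \<open>ctr\<close>,
  \<epsilon>, \<open>A\<close> and \<open>B\<close>.\<close>

lemma best_const_scaled_le:
  fixes \<phi> w v h :: "'a::euclidean_space \<Rightarrow> real"
  assumes \<phi>: "\<phi> \<in> test_funs" and z1: "\<phi> z1 \<noteq> 0" and p: "p > 0" and q: "q > 0" and \<epsilon>: "\<epsilon> > 0"
    and A: "A \<ge> 0" and B: "B > 0"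
    and R: "\<And>z. norm z \<ge> R \<Longrightarrow> \<phi> z = 0" "\<And>z. norm z \<ge> R \<Longrightarrow> grad \<phi> z = 0"
    and [measurable]: "w \<in> borel_measurable borel" "v \<in> borel_measurable borel"
    and wA: "\<And>\<omega>. norm \<omega> < R \<Longrightarrow> w (ctr + \<epsilon> *\<^sub>R \<omega>) \<le> A"
    and vB: "\<And>\<omega>. norm \<omega> < R \<Longrightarrow> B \<le> v (ctr + \<epsilon> *\<^sub>R \<omega>)"
    and I: "I \<ge> 0" "(\<integral>\<^sup>+z. ennreal (norm (grad \<phi> z) powr p) \<partial>lborel) = ennreal I"
    and J: "J > 0" "(\<integral>\<^sup>+z. ennreal (\<bar>\<phi> z\<bar> powr q) \<partial>lborel) = ennreal J"
  shows "best_const w h v p q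
    \<le> ennreal (A * \<epsilon> powr (real DIM('a) - p) * I / (B * \<epsilon> powr real DIM('a) * J) powr (p / q))"
proof -
  note [measurable] = test_fun_measurable[OF \<phi>]
  define \<psi> where "\<psi> z = \<phi> ((1 / \<epsilon>) *\<^sub>R (z - ctr))" for z
  have \<psi>: "\<psi> \<in> test_funs" "grad \<psi> z = (1 / \<epsilon>) *\<^sub>R grad \<phi> ((1 / \<epsilon>) *\<^sub>R (z - ctr))" for z
    unfolding \<psi>_def using test_fun_affine[OF \<phi>, of "1 / \<epsilon>" ctr] \<epsilon> by simp_all
  note [measurable] = test_fun_measurable[OF \<psi>(1)]
  have unscale: "(1 / \<epsilon>) *\<^sub>R ((ctr + \<epsilon> *\<^sub>R \<omega>) - ctr) = \<omega>" for \<omega> using \<epsilon> by simp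
  have "\<psi> (ctr + \<epsilon> *\<^sub>R z1) \<noteq> 0" unfolding \<psi>_def unscale by (rule z1)
  note Q = best_const_le_quotient[OF \<psi>(1) this p, of w h v q]
  let ?N = "\<integral>\<^sup>+z. ennreal (w z * norm (grad \<psi> z) powr p) \<partial>lborel"
  let ?D = "\<integral>\<^sup>+z. ennreal (v z * \<bar>\<psi> z\<bar> powr q) \<partial>lborel"
  have N: "?N \<le> ennreal (A * \<epsilon> powr (real DIM('a) - p) * I)"
  proof -
    have "?N = ennreal (\<epsilon> powr real DIM('a)) * (\<integral>\<^sup>+\<omega>. ennreal (w (ctr + \<epsilon> *\<^sub>R \<omega>) * norm (grad \<psi> (ctr + \<epsilon> *\<^sub>R \<omega>)) powr p) \<partial>lborel)"
      by (rule nn_integral_lborel_scale[OF _ \<epsilon>]) measurable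
    also have "\<dots> \<le> ennreal (\<epsilon> powr real DIM('a)) * (\<integral>\<^sup>+\<omega>. ennreal (A * \<epsilon> powr (- p)) * ennreal (norm (grad \<phi> \<omega>) powr p) \<partial>lborel)"
    proof (intro mult_left_mono nn_integral_mono)
      fix \<omega>
      have "w (ctr + \<epsilon> *\<^sub>R \<omega>) * norm (grad \<psi> (ctr + \<epsilon> *\<^sub>R \<omega>)) powr p \<le> A * \<epsilon> powr (- p) * norm (grad \<phi> \<omega>) powr p"
      proof (cases "norm \<omega> < R")
        case True
        have "norm (grad \<psi> (ctr + \<epsilon> *\<^sub>R \<omega>)) powr p = \<epsilon> powr (- p) * norm (grad \<phi> \<omega>) powr p"
          unfolding \<psi>(2) unscale using \<epsilon> by (simp add: powr_divide powr_minus_divide)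
        then show ?thesis using wA[OF True] by (simp add: mult.assoc mult_right_mono)
      next
        case False
        then show ?thesis unfolding \<psi>(2) unscale using R(2)[of \<omega>] p by simp
      qed
      then show "ennreal (w (ctr + \<epsilon> *\<^sub>R \<omega>) * norm (grad \<psi> (ctr + \<epsilon> *\<^sub>R \<omega>)) powr p)
        \<le> ennreal (A * \<epsilon> powr (- p)) * ennreal (norm (grad \<phi> \<omega>) powr p)"
        using A by (simp add: ennreal_leI flip: ennreal_mult')
    qed simp
    also have "\<dots> = ennreal (\<epsilon> powr real DIM('a)) * (ennreal (A * \<epsilon> powr (- p)) * ennreal I)"
      by (subst nn_integral_cmult) (auto simp: I(2))
    also have "\<dots> = ennreal (\<epsilon> powr real DIM('a) * (A * \<epsilon> powr (- p) * I))"
      using A I(1) by (simp flip: ennreal_mult')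
    also have "\<epsilon> powr real DIM('a) * (A * \<epsilon> powr (- p) * I) = A * \<epsilon> powr (real DIM('a) - p) * I"
      using \<epsilon> by (simp add: powr_diff powr_minus_divide)
    finally show ?thesis .
  qed
  have D: "ennreal (B * \<epsilon> powr real DIM('a) * J) \<le> ?D"
  proof -
    have "ennreal (B * \<epsilon> powr real DIM('a) * J) = ennreal (\<epsilon> powr real DIM('a)) * (ennreal B * ennreal J)"
      using B J(1) by (simp add: mult_ac flip: ennreal_mult')
    also have "\<dots> = ennreal (\<epsilon> powr real DIM('a)) * (\<integral>\<^sup>+\<omega>. ennreal B * ennreal (\<bar>\<phi> \<omega>\<bar> powr q) \<partial>lborel)"
      by (subst nn_integral_cmult) (auto simp: J(2))
    also have "\<dots> \<le> ennreal (\<epsilon> powr real DIM('a)) * (\<integral>\<^sup>+\<omega>. ennreal (v (ctr + \<epsilon> *\<^sub>R \<omega>) * \<bar>\<psi> (ctr + \<epsilon> *\<^sub>R \<omega>)\<bar> powr q) \<partial>lborel)"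
    proof (intro mult_left_mono nn_integral_mono)
      fix \<omega>
      have "B * \<bar>\<phi> \<omega>\<bar> powr q \<le> v (ctr + \<epsilon> *\<^sub>R \<omega>) * \<bar>\<psi> (ctr + \<epsilon> *\<^sub>R \<omega>)\<bar> powr q"
        unfolding \<psi>_def unscale using vB[of \<omega>] R(1)[of \<omega>] q by (cases "norm \<omega> < R") (auto intro: mult_right_mono)
      then show "ennreal B * ennreal (\<bar>\<phi> \<omega>\<bar> powr q) \<le> ennreal (v (ctr + \<epsilon> *\<^sub>R \<omega>) * \<bar>\<psi> (ctr + \<epsilon> *\<^sub>R \<omega>)\<bar> powr q)"
        using B by (simp add: ennreal_leI flip: ennreal_mult')
    qed simp
    also have "\<dots> = ?D" by (rule nn_integral_lborel_scale[OF _ \<epsilon>, symmetric]) measurable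
    finally show ?thesis .
  qed
  show ?thesis
  \<comment> \<open>\<open>v\<close> is only bounded from below, so the denominator may be infinite;
    the quotient is then 0.\<close>
  proof (cases "?D = top")
    case True
    then have 0: "?N / ennreal_pow ?D (p / q) = 0" by (simp add: ennreal_pow_def)
    show ?thesis by (rule order_trans[OF Q[unfolded 0] zero_le])
  next
    case False
    then obtain \<Delta> where \<Delta>: "?D = ennreal \<Delta>" "\<Delta> \<ge> 0" by (cases ?D) auto
    have lo: "0 < B * \<epsilon> powr real DIM('a) * J" using B \<epsilon> J by simp
    have le: "B * \<epsilon> powr real DIM('a) * J \<le> \<Delta>" using D lo unfolding \<Delta>(1) using \<Delta>(2) by simp
    note Q
    also have "?N / ennreal_pow ?D (p / q) \<le> ennreal (A * \<epsilon> powr (real DIM('a) - p) * I) / ennreal_pow ?D (p / q)"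
      by (intro divide_right_mono_ennreal N)
    also have "\<dots> = ennreal (A * \<epsilon> powr (real DIM('a) - p) * I / \<Delta> powr (p / q))"
      using \<Delta> lo le A I by (simp add: ennreal_pow_def divide_ennreal)
    also have "\<dots> \<le> ennreal (A * \<epsilon> powr (real DIM('a) - p) * I / (B * \<epsilon> powr real DIM('a) * J) powr (p / q))"
      using lo le A I p q by (intro ennreal_leI divide_left_mono powr_mono2 mult_pos_pos) auto
    finally show ?thesis .
  qed
qed

section \<open>Necessity of the two conditions and comparison with the Sobolev constant\<close>

lemma ennreal_eq_0_of_powr_bound:
  fixes x :: ennreal
  assumes bound: "\<And>s. 0 < s \<Longrightarrow> s \<le> s0 \<Longrightarrow> x \<le> ennreal (C * s powr \<theta>)" and s0: "s0 > 0" and \<theta>: "\<theta> > 0"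
  shows "x = 0"
proof -
  have "((\<lambda>s. C * s powr \<theta>) \<longlongrightarrow> C * 0 powr \<theta>) (at_right 0)"
    using \<theta> by (intro tendsto_mult tendsto_const tendsto_powr2 tendsto_ident_at) (auto intro: eventually_mono[OF eventually_at_right_less])
  then have "((\<lambda>s. ennreal (C * s powr \<theta>)) \<longlongrightarrow> ennreal 0) (at_right 0)"
    using \<theta> by (intro tendsto_ennrealI) simp
  moreover have "\<forall>\<^sub>F s in at_right 0. x \<le> ennreal (C * s powr \<theta>)"
    unfolding eventually_at_right_field using s0 bound by (intro exI[of _ s0]) auto
  ultimately have "x \<le> ennreal 0"
    by (intro tendsto_lowerbound) auto
  then show ?thesis by simp
qed

lemma wt_near_1:
  fixes e :: "'y::euclidean_space"
  assumes e: "norm e = 1" and \<eta>: "\<eta> > 0"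
  obtains \<delta> where "\<delta> > 0" "\<And>\<zeta> :: 'x::euclidean_space \<times> 'y. dist \<zeta> (0, e) < \<delta> \<Longrightarrow> \<bar>wt \<alpha> \<beta> \<zeta> - 1\<bar> < \<eta>"
proof -
  have "isCont (wt \<alpha> \<beta>) (0::'x, e)"
    unfolding wt_def using e by (intro continuous_intros) auto
  then obtain \<delta> where "\<delta> > 0" "\<And>\<zeta>. dist \<zeta> (0::'x, e) < \<delta> \<Longrightarrow> dist (wt \<alpha> \<beta> \<zeta>) (wt \<alpha> \<beta> (0::'x, e)) < \<eta>"
    using \<eta> unfolding continuous_at_eps_delta by blast
  moreover have "wt \<alpha> \<beta> (0::'x, e) = 1" using e by (simp add: wt_def norm_Pair)
  ultimately show thesis using that by (auto simp: dist_real_def)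
qed

lemma unit_vector_exists:
  obtains e :: "'a::euclidean_space" where "norm e = 1"
  using norm_Basis nonempty_Basis by blast

text \<open>Near (0, e) the weights lie between 1/2 and 3/2, so only the unweighted scaling is left:
  the quotient is at most a multiple of s^\<theta> with \<theta> = d - p - dp/q, which is positive
  exactly if a1) fails.\<close>

lemma weighted_inf_0_supercritical:
  assumes p: "p > 0" and q: "q > 0" and super: "(real DIM('x::euclidean_space \<times> 'y::euclidean_space) - p) * q > real DIM('x \<times> 'y) * p"
  shows "weighted_inf TYPE('x \<times> 'y) p a b \<alpha> \<beta> q = 0"
proof -
  let ?d = "real DIM('x \<times> 'y)"
  obtain \<phi> :: "'x \<times> 'y \<Rightarrow> real" where \<phi>: "\<phi> \<in> test_funs" "\<phi> 0 \<noteq> 0" using bump_exists by blast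
  obtain R where R: "R > 0" "\<And>z. norm z \<ge> R \<Longrightarrow> \<phi> z = 0" "\<And>z. norm z \<ge> R \<Longrightarrow> grad \<phi> z = 0"
    using test_fun_support[OF \<phi>(1)] by blast
  obtain I where I: "I \<ge> 0" "(\<integral>\<^sup>+z. ennreal (norm (grad \<phi> z) powr p) \<partial>lborel) = ennreal I"
    using test_fun_energy[OF \<phi>(1) p] by blast
  obtain J where J: "J > 0" "(\<integral>\<^sup>+z. ennreal (\<bar>\<phi> z\<bar> powr q) \<partial>lborel) = ennreal J"
    using test_fun_mass[OF \<phi> q] by blast
  obtain e :: 'y where e: "norm e = 1" by (rule unit_vector_exists)
  obtain \<delta>1 where \<delta>1: "\<delta>1 > 0" "\<And>\<zeta> :: 'x \<times> 'y. dist \<zeta> (0, e) < \<delta>1 \<Longrightarrow> \<bar>wt a (- b) \<zeta> - 1\<bar> < 1/2"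
    using wt_near_1[OF e, of "1/2"] by (metis half_gt_zero_iff zero_less_one)
  obtain \<delta>2 where \<delta>2: "\<delta>2 > 0" "\<And>\<zeta> :: 'x \<times> 'y. dist \<zeta> (0, e) < \<delta>2 \<Longrightarrow> \<bar>wt \<alpha> \<beta> \<zeta> - 1\<bar> < 1/2"
    using wt_near_1[OF e, of "1/2"] by (metis half_gt_zero_iff zero_less_one)
  define s0 where "s0 = min \<delta>1 \<delta>2 / R"
  have s0: "s0 > 0" using \<delta>1 \<delta>2 R by (simp add: s0_def)
  define \<theta> where "\<theta> = ?d - p - ?d * (p / q)"
  have \<theta>: "\<theta> > 0" using super q by (simp add: \<theta>_def field_simps)
  define C where "C = 3/2 * I / (1/2 * J) powr (p / q)"
  have "weighted_inf TYPE('x \<times> 'y) p a b \<alpha> \<beta> q \<le> ennreal (C * s powr \<theta>)" if s: "0 < s" "s \<le> s0" for s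
  proof -
    have near: "dist ((0, e) + s *\<^sub>R \<omega>) (0, e) < min \<delta>1 \<delta>2" if "norm \<omega> < R" for \<omega> :: "'x \<times> 'y"
    proof -
      have "dist ((0, e) + s *\<^sub>R \<omega>) (0, e) = s * norm \<omega>" using s by (simp add: dist_norm)
      also have "\<dots> < s * R" using s that by simp
      also have "\<dots> \<le> s0 * R" using s R by (intro mult_right_mono) auto
      finally show ?thesis using R by (simp add: s0_def)
    qed
    have "weighted_inf TYPE('x \<times> 'y) p a b \<alpha> \<beta> q
      \<le> ennreal (3/2 * s powr (?d - p) * I / (1/2 * s powr ?d * J) powr (p / q))"
      unfolding weighted_inf_def
    proof (rule best_const_scaled_le[OF \<phi> p q s(1) _ _ R(2,3) _ _ _ _ I J, where ctr = "(0, e)"])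
      fix \<omega> :: "'x \<times> 'y" assume "norm \<omega> < R"
      then show "wt a (- b) ((0, e) + s *\<^sub>R \<omega>) \<le> 3/2" "1/2 \<le> wt \<alpha> \<beta> ((0, e) + s *\<^sub>R \<omega>)"
        using \<delta>1(2)[of "(0, e) + s *\<^sub>R \<omega>"] \<delta>2(2)[of "(0, e) + s *\<^sub>R \<omega>"] near[of \<omega>] by linarith+
    qed auto
    also have "3/2 * s powr (?d - p) * I / (1/2 * s powr ?d * J) powr (p / q) = C * s powr \<theta>"
    proof -
      have "(1/2 * s powr ?d * J) powr (p / q) = (1/2 * J) powr (p / q) * s powr (?d * (p / q))"
        using J s by (simp only: powr_mult powr_powr mult_ac)
      then show ?thesis unfolding C_def \<theta>_def using s by (simp add: powr_diff mult_ac)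
    qed
    finally show ?thesis .
  qed
  then show ?thesis by (rule ennreal_eq_0_of_powr_bound[OF _ s0 \<theta>])
qed

text \<open>On the ball of radius s/2 about (x0, s e) the norm |y| is comparable to s and |z| to 1,
  so the quotient is at most a multiple of s^\<theta> with \<theta> = a + d - p - (\<alpha> + d)
  p/q. For the weights of \<open>S_const\<close> this exponent is b - \<gamma>.\<close>

lemma weighted_inf_0_translation:
  assumes p: "p > 0" and q: "q > 0"
    and neg: "a + real DIM('x::euclidean_space \<times> 'y::euclidean_space) - p > (\<alpha> + real DIM('x \<times> 'y)) * (p / q)"
  shows "weighted_inf TYPE('x \<times> 'y) p a b \<alpha> \<beta> q = 0"
proof -
  let ?d = "real DIM('x \<times> 'y)"
  obtain \<phi> :: "'x \<times> 'y \<Rightarrow> real" where \<phi>: "\<phi> \<in> test_funs" "\<phi> 0 \<noteq> 0" using bump_exists by blast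
  obtain R where R: "R > 0" "\<And>z. norm z \<ge> R \<Longrightarrow> \<phi> z = 0" "\<And>z. norm z \<ge> R \<Longrightarrow> grad \<phi> z = 0"
    using test_fun_support[OF \<phi>(1)] by blast
  obtain I where I: "I \<ge> 0" "(\<integral>\<^sup>+z. ennreal (norm (grad \<phi> z) powr p) \<partial>lborel) = ennreal I"
    using test_fun_energy[OF \<phi>(1) p] by blast
  obtain J where J: "J > 0" "(\<integral>\<^sup>+z. ennreal (\<bar>\<phi> z\<bar> powr q) \<partial>lborel) = ennreal J"
    using test_fun_mass[OF \<phi> q] by blast
  obtain e :: 'y where e: "norm e = 1" by (rule unit_vector_exists)
  obtain x0 :: 'x where x0: "norm x0 = 1" by (rule unit_vector_exists)
  \<comment> \<open>The support lies in the ball of radius \<open>R\<close>; scaled by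
    \<open>s * t\<close> it fits into a ball of radius s/2, which keeps |y| between s/2 and 3
    s/2.\<close>
  define t where "t = 1 / (2 * R)"
  have t: "t > 0" using R by (simp add: t_def)
  define \<theta> where "\<theta> = a + (?d - p) - (\<alpha> + ?d) * (p / q)"
  have \<theta>: "\<theta> > 0" using neg by (simp add: \<theta>_def algebra_simps)
  define A where "A = 2 powr \<bar>a\<bar> * 2 powr \<bar>b\<bar>"
  define B where "B = 2 powr (- \<bar>\<alpha>\<bar>) * 2 powr (- \<bar>\<beta>\<bar>)"
  have AB: "A > 0" "B > 0" by (simp_all add: A_def B_def)
  define C where "C = A * t powr (?d - p) * I / (B * t powr ?d * J) powr (p / q)"
  have "weighted_inf TYPE('x \<times> 'y) p a b \<alpha> \<beta> q \<le> ennreal (C * s powr \<theta>)" if s: "0 < s" "s \<le> 1/2" for s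
  proof -
    have loc: "s \<le> 2 * norm (snd \<zeta>)" "norm (snd \<zeta>) \<le> 2 * s" "1 \<le> 2 * norm \<zeta>" "norm \<zeta> \<le> 2 * 1"
      if \<omega>: "norm \<omega> < R" and \<zeta>: "\<zeta> = (x0, s *\<^sub>R e) + (s * t) *\<^sub>R \<omega>" for \<zeta> \<omega> :: "'x \<times> 'y"
    proof -
      have "norm ((s * t) *\<^sub>R \<omega>) = s * t * norm \<omega>" using s t by simp
      also have "\<dots> < s * t * R" using s t \<omega> by simp
      also have "\<dots> = s / 2" using R by (simp add: t_def)
      finally have "\<zeta> \<in> ball (x0, s *\<^sub>R e) (s / 2)" by (simp add: \<zeta> dist_norm del: norm_scaleR)
      note b = norm_in_ball[OF this]
      have se: "norm (s *\<^sub>R e) = s" using s e by simp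
      have "norm (x0, s *\<^sub>R e) \<le> norm x0 + norm (s *\<^sub>R e)" by (rule norm_Pair_le)
      moreover have "norm x0 \<le> norm (x0, s *\<^sub>R e)" by (rule norm_fst_le)
      ultimately show "s \<le> 2 * norm (snd \<zeta>)" "norm (snd \<zeta>) \<le> 2 * s" "1 \<le> 2 * norm \<zeta>" "norm \<zeta> \<le> 2 * 1"
        using b s x0 se by simp_all
    qed
    have "weighted_inf TYPE('x \<times> 'y) p a b \<alpha> \<beta> q
      \<le> ennreal (A * s powr a * (s * t) powr (?d - p) * I / (B * s powr \<alpha> * (s * t) powr ?d * J) powr (p / q))"
      unfolding weighted_inf_def
    proof (rule best_const_scaled_le[OF \<phi> p q _ _ _ R(2,3) _ _ _ _ I J, where ctr = "(x0, s *\<^sub>R e)"])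
      fix \<omega> :: "'x \<times> 'y" assume \<omega>: "norm \<omega> < R"
      let ?\<zeta> = "(x0, s *\<^sub>R e) + (s * t) *\<^sub>R \<omega>"
      note l = loc[OF \<omega> refl]
      have "wt a (- b) ?\<zeta> \<le> (2 powr \<bar>a\<bar> * s powr a) * (2 powr \<bar>- b\<bar> * 1 powr (- b))"
        unfolding wt_def using s l by (intro mult_mono powr_comparable(1)) auto
      then show "wt a (- b) ?\<zeta> \<le> A * s powr a" by (simp add: A_def mult_ac)
      have "(2 powr (- \<bar>\<alpha>\<bar>) * s powr \<alpha>) * (2 powr (- \<bar>\<beta>\<bar>) * 1 powr \<beta>) \<le> wt \<alpha> \<beta> ?\<zeta>"
        unfolding wt_def using s l by (intro mult_mono powr_comparable(2)) auto
      then show "B * s powr \<alpha> \<le> wt \<alpha> \<beta> ?\<zeta>" by (simp add: B_def mult_ac)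
    qed (use s t AB in auto)
    also have "A * s powr a * (s * t) powr (?d - p) * I / (B * s powr \<alpha> * (s * t) powr ?d * J) powr (p / q) = C * s powr \<theta>"
    proof -
      have "B * s powr \<alpha> * (s * t) powr ?d * J = (B * t powr ?d * J) * s powr (\<alpha> + ?d)"
        using s t by (simp add: powr_mult powr_add)
      moreover have "((B * t powr ?d * J) * s powr (\<alpha> + ?d)) powr (p / q) = (B * t powr ?d * J) powr (p / q) * s powr ((\<alpha> + ?d) * (p / q))"
        using AB J by (simp only: powr_mult powr_powr)
      moreover have "A * s powr a * (s * t) powr (?d - p) * I = A * t powr (?d - p) * I * s powr (a + (?d - p))"
        using s t by (simp add: powr_mult powr_add)
      ultimately show ?thesis unfolding C_def \<theta>_def using s
        by (simp only: powr_diff[of s "a + (?d - p)"]) simp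
    qed
    finally show ?thesis .
  qed
  then show ?thesis by (rule ennreal_eq_0_of_powr_bound[OF _ _ \<theta>, of "1/2"]) auto
qed

text \<open>By \<open>scale\<close> the powers of the scaling parameter cancel, so the bump can be
  shrunk to (0, e) at no cost. There the weights tend to 1, and their deviation \<eta> disappears in
  the limit.\<close>

lemma weighted_inf_le_quotient:
  fixes \<phi> :: "'x::euclidean_space \<times> 'y::euclidean_space \<Rightarrow> real"
  assumes \<phi>: "\<phi> \<in> test_funs" "\<phi> z1 \<noteq> 0" and p: "p > 0" and q: "q > 0"
    and scale: "real DIM('x \<times> 'y) - p = real DIM('x \<times> 'y) * (p / q)"
    and I: "I \<ge> 0" "(\<integral>\<^sup>+z. ennreal (norm (grad \<phi> z) powr p) \<partial>lborel) = ennreal I"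
    and J: "J > 0" "(\<integral>\<^sup>+z. ennreal (\<bar>\<phi> z\<bar> powr q) \<partial>lborel) = ennreal J"
  shows "weighted_inf TYPE('x \<times> 'y) p a b \<alpha> \<beta> q \<le> ennreal (I / J powr (p / q))"
proof -
  let ?d = "real DIM('x \<times> 'y)"
  obtain R where R: "R > 0" "\<And>z. norm z \<ge> R \<Longrightarrow> \<phi> z = 0" "\<And>z. norm z \<ge> R \<Longrightarrow> grad \<phi> z = 0"
    using test_fun_support[OF \<phi>(1)] by blast
  obtain e :: 'y where e: "norm e = 1" by (rule unit_vector_exists)
  have bound: "weighted_inf TYPE('x \<times> 'y) p a b \<alpha> \<beta> q \<le> ennreal ((1 + \<eta>) * I / ((1 - \<eta>) * J) powr (p / q))"
    if \<eta>: "0 < \<eta>" "\<eta> < 1" for \<eta>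
  proof -
    obtain \<delta>1 where \<delta>1: "\<delta>1 > 0" "\<And>\<zeta> :: 'x \<times> 'y. dist \<zeta> (0, e) < \<delta>1 \<Longrightarrow> \<bar>wt a (- b) \<zeta> - 1\<bar> < \<eta>"
      using wt_near_1[OF e \<eta>(1)] by metis
    obtain \<delta>2 where \<delta>2: "\<delta>2 > 0" "\<And>\<zeta> :: 'x \<times> 'y. dist \<zeta> (0, e) < \<delta>2 \<Longrightarrow> \<bar>wt \<alpha> \<beta> \<zeta> - 1\<bar> < \<eta>"
      using wt_near_1[OF e \<eta>(1)] by metis
    define s where "s = min \<delta>1 \<delta>2 / R"
    have s: "s > 0" using \<delta>1 \<delta>2 R by (simp add: s_def)
    have near: "dist ((0, e) + s *\<^sub>R \<omega>) (0, e) < min \<delta>1 \<delta>2" if "norm \<omega> < R" for \<omega> :: "'x \<times> 'y"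
    proof -
      have "dist ((0, e) + s *\<^sub>R \<omega>) (0, e) = s * norm \<omega>" using s by (simp add: dist_norm)
      also have "\<dots> < s * R" using s that by simp
      finally show ?thesis using R by (simp add: s_def)
    qed
    have "weighted_inf TYPE('x \<times> 'y) p a b \<alpha> \<beta> q
      \<le> ennreal ((1 + \<eta>) * s powr (?d - p) * I / ((1 - \<eta>) * s powr ?d * J) powr (p / q))"
      unfolding weighted_inf_def
    proof (rule best_const_scaled_le[OF \<phi> p q s _ _ R(2,3) _ _ _ _ I J, where ctr = "(0, e)"])
      fix \<omega> :: "'x \<times> 'y" assume "norm \<omega> < R"
      then show "wt a (- b) ((0, e) + s *\<^sub>R \<omega>) \<le> 1 + \<eta>" "1 - \<eta> \<le> wt \<alpha> \<beta> ((0, e) + s *\<^sub>R \<omega>)"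
        using \<delta>1(2)[of "(0, e) + s *\<^sub>R \<omega>"] \<delta>2(2)[of "(0, e) + s *\<^sub>R \<omega>"] near[of \<omega>] by linarith+
    qed (use \<eta> in auto)
    also have "(1 + \<eta>) * s powr (?d - p) * I / ((1 - \<eta>) * s powr ?d * J) powr (p / q) = (1 + \<eta>) * I / ((1 - \<eta>) * J) powr (p / q)"
    proof -
      have "((1 - \<eta>) * s powr ?d * J) powr (p / q) = ((1 - \<eta>) * J) powr (p / q) * s powr (?d * (p / q))"
        using J s \<eta> by (simp only: powr_mult powr_powr mult_ac)
      then show ?thesis unfolding scale using s by simp
    qed
    finally show ?thesis .
  qed
  have "((\<lambda>\<eta>. (1 + \<eta>) * I / ((1 - \<eta>) * J) powr (p / q)) \<longlongrightarrow> (1 + 0) * I / ((1 - 0) * J) powr (p / q)) (at_right 0)"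
    using J by (intro tendsto_intros) auto
  then have "((\<lambda>\<eta>. ennreal ((1 + \<eta>) * I / ((1 - \<eta>) * J) powr (p / q))) \<longlongrightarrow> ennreal (I / J powr (p / q))) (at_right 0)"
    by (intro tendsto_ennrealI) simp
  moreover have "\<forall>\<^sub>F \<eta> in at_right 0. weighted_inf TYPE('x \<times> 'y) p a b \<alpha> \<beta> q \<le> ennreal ((1 + \<eta>) * I / ((1 - \<eta>) * J) powr (p / q))"
    unfolding eventually_at_right_field using bound by (intro exI[of _ 1]) auto
  ultimately show ?thesis by (intro tendsto_lowerbound) auto
qed

text \<open>Otherwise some real c would lie strictly between the two constants. By the comparison of
  quotients it satisfies the Sobolev inequality for all test functions, and passing to the
  completion gives c \<le> S, a contradiction. An intermediate c is taken because it is finite and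
  positive, whereas the weighted infimum is only an extended number.\<close>

lemma weighted_inf_le_Sobolev:
  assumes p: "1 < p" and pd: "p < real DIM('x::euclidean_space \<times> 'y::euclidean_space)"
    and q: "q = crit_exp DIM('x \<times> 'y) p"
  shows "weighted_inf TYPE('x \<times> 'y) p a b \<alpha> \<beta> q \<le> Sobolev_const TYPE('x \<times> 'y) p"
proof (rule ccontr)
  let ?d = "real DIM('x \<times> 'y)"
  let ?W = "weighted_inf TYPE('x \<times> 'y) p a b \<alpha> \<beta> q"
  have q0: "q > 0" unfolding q crit_exp_def using p pd by (intro divide_pos_pos mult_pos_pos) linarith+
  have scale: "?d - p = ?d * (p / q)"
  proof -
    have "D - p = D * (p / (D * p / (D - p)))" if "p < D" for D
      using p that by (simp add: divide_simps)
    from this[OF pd] show ?thesis by (simp only: q crit_exp_def)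
  qed
  assume "\<not> ?W \<le> Sobolev_const TYPE('x \<times> 'y) p"
  then have less: "Sobolev_const TYPE('x \<times> 'y) p < ?W" by (simp only: not_le)
  from dense[OF less] obtain x where x: "Sobolev_const TYPE('x \<times> 'y) p < x" "x < ?W" by blast
  have "x < top" using x(2) top_greatest by (rule less_le_trans)
  then obtain c where c: "x = ennreal c" "c \<ge> 0" by (cases x) auto
  have c0: "c > 0"
  proof (rule ccontr)
    assume "\<not> c > 0"
    then have "x = 0" using c by simp
    then show False using x(1) by simp
  qed
  have "ennreal c \<le> Sobolev_const TYPE('x \<times> 'y) p"
    unfolding Sobolev_const_def q[symmetric]
  proof (rule best_const_geI[OF p q0 c0])
    have "(\<lambda>z::'x \<times> 'y. norm z) \<in> borel_measurable borel" by measurable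
    then show "(\<lambda>z::'x \<times> 'y. norm z powr - p) \<in> borel_measurable borel" by measurable
    show "AE z in lborel. (norm (z::'x \<times> 'y) powr - p) > 0"
      using AE_lborel_singleton[of "0::'x \<times> 'y"] by eventually_elim auto
    show "(\<integral>\<^sup>+z. ennreal (1 * norm (grad \<phi> z) powr p) \<partial>lborel) < \<infinity>" if test: "\<phi> \<in> test_funs" for \<phi> :: "'x \<times> 'y \<Rightarrow> real"
    proof -
      obtain I where "I \<ge> 0" "(\<integral>\<^sup>+z. ennreal (norm (grad \<phi> z) powr p) \<partial>lborel) = ennreal I"
        using test_fun_energy[OF test, of p] p by auto
      then show ?thesis by simp
    qed
    fix \<phi> :: "'x \<times> 'y \<Rightarrow> real" and M
    assume \<phi>: "\<phi> \<in> test_funs" and M: "M > 0" and E: "(\<integral>\<^sup>+z. ennreal (1 * norm (grad \<phi> z) powr p) \<partial>lborel) \<le> ennreal M"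
    show "(\<integral>\<^sup>+z. ennreal (1 * \<bar>\<phi> z\<bar> powr q) \<partial>lborel) \<le> ennreal ((M / c) powr (q / p))"
    proof (cases "\<forall>z. \<phi> z = 0")
      case False
      then obtain z1 where z1: "\<phi> z1 \<noteq> 0" by blast
      obtain I where I: "I \<ge> 0" "(\<integral>\<^sup>+z. ennreal (norm (grad \<phi> z) powr p) \<partial>lborel) = ennreal I"
        using test_fun_energy[OF \<phi>, of p] p by auto
      obtain J where J: "J > 0" "(\<integral>\<^sup>+z. ennreal (\<bar>\<phi> z\<bar> powr q) \<partial>lborel) = ennreal J"
        using test_fun_mass[OF \<phi> z1 q0] by blast
      have "ennreal c \<le> ?W" using x c by simp
      also have "\<dots> \<le> ennreal (I / J powr (p / q))"
        using p by (intro weighted_inf_le_quotient[OF \<phi> z1 _ q0 scale I J]) auto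
      finally have "c \<le> I / J powr (p / q)" using I J by simp
      also have "\<dots> \<le> M / J powr (p / q)" using E M J unfolding mult_1 I(2) by (simp add: divide_right_mono)
      finally have "J powr (p / q) \<le> M / c" using c0 J by (simp add: field_simps)
      then have "(J powr (p / q)) powr (q / p) \<le> (M / c) powr (q / p)"
        using p q0 by (intro powr_mono2) auto
      then have "J \<le> (M / c) powr (q / p)" using p q0 J by (simp add: powr_powr)
      then show ?thesis using J(2) by (simp add: ennreal_leI)
    next
      case True
      then have "\<phi> = (\<lambda>_. 0)" by blast
      then show ?thesis using q0 by simp
    qed
  qed auto
  then show False using x c by simp
qed

section \<open>Positivity and the main result\<close>

text \<open>The set y = 0 lies in the hyperplane orthogonal to (0, e), which is a null set.\<close>

lemma AE_snd_nonzero: "AE z in lborel. snd (z :: 'x::euclidean_space \<times> 'y::euclidean_space) \<noteq> 0"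
proof -
  obtain e :: 'y where e: "norm e = 1" by (rule unit_vector_exists)
  define H where "H = {z :: 'x \<times> 'y. (0, e) \<bullet> z = 0}"
  have "(0::'x, e) \<noteq> 0" using e by (auto simp: prod_eq_iff)
  then have "negligible H" unfolding H_def by (intro negligible_hyperplane) auto
  moreover have "closed H" unfolding H_def by (rule closed_hyperplane)
  ultimately have "H \<in> null_sets lborel"
    by (simp add: negligible_iff_null_sets null_sets_completion_iff borel_closed)
  then have "AE z in lborel. z \<notin> H" by (rule AE_not_in)
  then show ?thesis by eventually_elim (auto simp: H_def inner_prod_def)
qed

lemma AE_wt_pos: "AE z in lborel. wt \<alpha> \<beta> (z :: 'x::euclidean_space \<times> 'y::euclidean_space) > 0"
  using AE_snd_nonzero by eventually_elim (auto simp: wt_def prod_eq_iff)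

lemma wt_shift_le:
  assumes "s \<ge> 0"
  shows "wt (\<alpha> + s) (\<beta> - s) z \<le> wt \<alpha> \<beta> z"
proof (cases "snd z = 0")
  case False
  then have z: "norm (snd z) > 0" "norm (snd z) \<le> norm z" "norm z > 0"
    using norm_snd_le_norm[of z] by (auto simp: prod_eq_iff)
  have "wt (\<alpha> + s) (\<beta> - s) z = wt \<alpha> \<beta> z * (norm (snd z) / norm z) powr s"
    using z by (simp add: wt_def powr_add powr_diff powr_divide)
  also have "\<dots> \<le> wt \<alpha> \<beta> z * 1"
    using z assms by (intro mult_left_mono powr_le1) auto
  finally show ?thesis by simp
qed (simp add: wt_def)

text \<open>The exponent \<alpha> depends on a, b, \<gamma> only through a - b + \<gamma>, and
  \<beta> only on \<gamma>. Replacing (a, b) by (a + \<gamma> - b, \<gamma>) therefore keeps the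
  mass and, as \<gamma> \<ge> b, does not increase the energy.\<close>

lemma S_const_pos:
  fixes p q a b \<gamma> :: real
  defines "d \<equiv> real DIM('x::euclidean_space \<times> 'y::euclidean_space)"
  assumes p: "1 < p" and pq: "p < q" and critical: "(d - p) * q \<le> d * p" and \<gamma>: "b \<le> \<gamma>"
    and a: "real DIM('y) + a > 0" and b: "b < d - p + a"
    and loc: "q * ((d - p + (a - b + \<gamma>)) / p) > d - real DIM('y)"
  shows "S_const TYPE('x \<times> 'y) p a b \<gamma> q > 0"
proof -
  define \<alpha> where "\<alpha> = - d + q * ((d - p + (a - b + \<gamma>)) / p)"
  define \<beta> where "\<beta> = - (\<gamma> * q / p)"
  interpret critical_weights p q "a + (\<gamma> - b)" \<gamma> \<alpha> \<beta> d "TYPE('x \<times> 'y)"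
    by unfold_locales (use p pq critical b loc in \<open>simp_all add: d_def \<alpha>_def \<beta>_def algebra_simps\<close>)
  obtain C where C: "C > 0" and ineq: "\<And>(u :: 'x \<times> 'y \<Rightarrow> real) M. u \<in> test_funs \<Longrightarrow> M > 0 \<Longrightarrow>
     (\<integral>\<^sup>+\<zeta>. ennreal (wt (a + (\<gamma> - b)) (- \<gamma>) \<zeta> * norm (grad u \<zeta>) powr p) \<partial>lborel) \<le> ennreal M \<Longrightarrow>
     (\<integral>\<^sup>+\<zeta>. ennreal (wt \<alpha> \<beta> \<zeta> * \<bar>u \<zeta>\<bar> powr q) \<partial>lborel) \<le> ennreal (C * M powr (q / p))"
    using test_fun_inequality by blast
  \<comment> \<open>The value of c for which C M^(q/p) = (M / c)^(q/p).\<close>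
  define c where "c = C powr (- (p / q))"
  have c: "c > 0" using C by (simp add: c_def)
  have "ennreal c \<le> best_const (wt a (- b) :: 'x \<times> 'y \<Rightarrow> real) (wt a (- b - p)) (wt \<alpha> \<beta>) p q"
  proof (rule best_const_geI[OF p _ c])
    show "q > 0" using p pq by simp
    show "(\<integral>\<^sup>+z. ennreal (wt a (- b) z * norm (grad \<phi> z) powr p) \<partial>lborel) < \<infinity>" if "\<phi> \<in> test_funs" for \<phi> :: "'x \<times> 'y \<Rightarrow> real"
      using p a b by (intro wt_energy_finite[OF that]) (auto simp: d_def)
    fix \<phi> :: "'x \<times> 'y \<Rightarrow> real" and M
    assume \<phi>: "\<phi> \<in> test_funs" and M: "M > 0"
      and E: "(\<integral>\<^sup>+z. ennreal (wt a (- b) z * norm (grad \<phi> z) powr p) \<partial>lborel) \<le> ennreal M"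
    have "(\<integral>\<^sup>+\<zeta>. ennreal (wt (a + (\<gamma> - b)) (- \<gamma>) \<zeta> * norm (grad \<phi> \<zeta>) powr p) \<partial>lborel)
      \<le> (\<integral>\<^sup>+z. ennreal (wt a (- b) z * norm (grad \<phi> z) powr p) \<partial>lborel)"
    proof (intro nn_integral_mono ennreal_leI mult_right_mono)
      show "wt (a + (\<gamma> - b)) (- \<gamma>) z \<le> wt a (- b) z" for z :: "'x \<times> 'y"
        using wt_shift_le[of "\<gamma> - b" a "- b" z] \<gamma> by simp
    qed simp
    then have "(\<integral>\<^sup>+\<zeta>. ennreal (wt \<alpha> \<beta> \<zeta> * \<bar>\<phi> \<zeta>\<bar> powr q) \<partial>lborel) \<le> ennreal (C * M powr (q / p))"
      using E by (intro ineq \<phi> M) (rule order_trans)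
    also have "C * M powr (q / p) = (M / c) powr (q / p)"
    proof -
      have "c powr (q / p) = 1 / C" using C p pq by (simp add: c_def powr_powr)
      then show ?thesis using M c by (simp add: powr_divide)
    qed
    finally show "(\<integral>\<^sup>+z. ennreal (wt \<alpha> \<beta> z * \<bar>\<phi> z\<bar> powr q) \<partial>lborel) \<le> ennreal ((M / c) powr (q / p))" .
  qed (auto intro: AE_wt_pos)
  then have "ennreal c \<le> S_const TYPE('x \<times> 'y) p a b \<gamma> q"
    unfolding S_const_def weighted_inf_def Hconst_def \<alpha>_def \<beta>_def d_def .
  then show ?thesis using c by (metis ennreal_less_zero_iff less_le_trans)
qed

theorem theorem1p1:
  fixes d k :: nat and p a b \<gamma> :: real
  assumes "CARD('m) = d - k" and "CARD('k) = k" and "d > k" and "k \<ge> 1"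
    and "1 < p"
    and "real k + a > 0"
    and "b < real d - p + a"
  shows "(\<forall>q. p < q \<and> q * Hconst d p (a - b + \<gamma>) > real d - real k \<longrightarrow>
            (S_const TYPE((real^'m) \<times> (real^'k)) p a b \<gamma> q > 0 \<longleftrightarrow>
               (real d - p) * q \<le> real d * p \<and> \<gamma> \<ge> b))
       \<and> (p < real d \<and> crit_exp d p * Hconst d p (a - b + \<gamma>) > real d - real k \<longrightarrow>
            S_const TYPE((real^'m) \<times> (real^'k)) p a b \<gamma> (crit_exp d p) =
              weighted_inf TYPE((real^'m) \<times> (real^'k)) p a b
                ((a - b + \<gamma>) * crit_exp d p / p) (- (\<gamma> * crit_exp d p / p)) (crit_exp d p)
          \<and> weighted_inf TYPE((real^'m) \<times> (real^'k)) p a b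
                ((a - b + \<gamma>) * crit_exp d p / p) (- (\<gamma> * crit_exp d p / p)) (crit_exp d p)
              \<le> Sobolev_const TYPE((real^'m) \<times> (real^'k)) p)"
proof -
  have k: "DIM(real^'k) = k" using assms by simp
  have d: "DIM((real^'m) \<times> (real^'k)) = d" using assms by simp
  have iff: "(S_const TYPE((real^'m) \<times> (real^'k)) p a b \<gamma> q > 0 \<longleftrightarrow>
               (real d - p) * q \<le> real d * p \<and> \<gamma> \<ge> b)"
    if q: "p < q" "q * Hconst d p (a - b + \<gamma>) > real d - real k" for q
  proof
    assume pos: "S_const TYPE((real^'m) \<times> (real^'k)) p a b \<gamma> q > 0"
    have q0: "q > 0" "p > 0" using q assms by auto
    have "(real d - p) * q \<le> real d * p"
    proof (rule ccontr)
      assume "\<not> ?thesis"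
      then have "(real d - p) * q > real d * p" by simp
      then have "(real DIM((real^'m) \<times> (real^'k)) - p) * q > real DIM((real^'m) \<times> (real^'k)) * p"
        unfolding d .
      from weighted_inf_0_supercritical[OF q0(2,1) this]
      have "S_const TYPE((real^'m) \<times> (real^'k)) p a b \<gamma> q = 0"
        unfolding S_const_def by blast
      with pos show False by simp
    qed
    moreover have "\<gamma> \<ge> b"
    proof (rule ccontr)
      assume "\<not> ?thesis"
      \<comment> \<open>This is the term subtracted in the exponent of the translated bumps; for
        \<gamma> < b it falls short of a + d - p by b - \<gamma>.\<close>
      moreover have "(- real d + q * Hconst d p (a - b + \<gamma>) + real d) * (p / q) = real d - p + (a - b + \<gamma>)"
        using q0 by (simp add: Hconst_def)
      ultimately have "a + real d - p > (- real d + q * Hconst d p (a - b + \<gamma>) + real d) * (p / q)" by linarith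
      then have "a + real DIM((real^'m) \<times> (real^'k)) - p
          > (- real d + q * Hconst d p (a - b + \<gamma>) + real DIM((real^'m) \<times> (real^'k))) * (p / q)"
        unfolding d .
      from weighted_inf_0_translation[OF q0(2,1) this]
      have "S_const TYPE((real^'m) \<times> (real^'k)) p a b \<gamma> q = 0"
        unfolding S_const_def d by blast
      with pos show False by simp
    qed
    ultimately show "(real d - p) * q \<le> real d * p \<and> \<gamma> \<ge> b" ..
  next
    assume "(real d - p) * q \<le> real d * p \<and> \<gamma> \<ge> b"
    then show "S_const TYPE((real^'m) \<times> (real^'k)) p a b \<gamma> q > 0"
      using assms(5-7) q by (intro S_const_pos) (simp_all only: d k Hconst_def)
  qed
  have eq: "S_const TYPE((real^'m) \<times> (real^'k)) p a b \<gamma> (crit_exp d p) =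
              weighted_inf TYPE((real^'m) \<times> (real^'k)) p a b
                ((a - b + \<gamma>) * crit_exp d p / p) (- (\<gamma> * crit_exp d p / p)) (crit_exp d p)"
    if "p < real d"
  proof -
    \<comment> \<open>This identity removes the term - d from the exponent of |y|.\<close>
    have "crit_exp d p * ((real d - p) / p) = real d" using that assms(5) by (simp add: crit_exp_def)
    then have "- real d + crit_exp d p * Hconst d p (a - b + \<gamma>) = (a - b + \<gamma>) * crit_exp d p / p"
      by (simp add: Hconst_def add_divide_distrib diff_divide_distrib algebra_simps)
    then show ?thesis unfolding S_const_def d by (rule arg_cong)
  qed
  have le: "weighted_inf TYPE((real^'m) \<times> (real^'k)) p a b
                ((a - b + \<gamma>) * crit_exp d p / p) (- (\<gamma> * crit_exp d p / p)) (crit_exp d p)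
              \<le> Sobolev_const TYPE((real^'m) \<times> (real^'k)) p" if "p < real d"
    using assms(5) that by (intro weighted_inf_le_Sobolev) (simp_all only: d)
  show ?thesis
    by (intro conjI allI impI iff eq le; elim conjE; assumption)
qed

end
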